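(* Let $K$ be a field and let $E$ be a row-finite directed graph. Then $$\mathrm{Spec}(L_K(E))=\bigsqcup_{M\in\mathcal{M}(E)}\mathrm{Spec}_M(L_K(E)).$$ Moreover, $\mathrm{Spec}_M(L_K(E))$ is homeomorphic to $\mathrm{Spec}(K[x,x^{-1}])$ if $M\in\mathcal{M}_\tau(E)$, and is homeomorphic to $\mathrm{Spec}(K)$ otherwise. In particular, if the set $\mathcal{M}(E)$ of maximal tails is finite, then the prime spectrum $\mathrm{Spec}(L_K(E))$ is the union of a finite number of strata $\mathrm{Spec}_M(L_K(E))$, with each stratum homeomorphic to a $0$- or $1$-dimensional torus (that is, to $\mathrm{Spec}(K)$ or to $\mathrm{Spec}(K[x,x^{-1}])$), and the primitive ideals of $L_K(E)$ are precisely those prime ideals that are maximal (under inclusion) in their stratum.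
   Context: Directed graphs. A directed graph $E=(E^0,E^1,r,s)$ consists of a set $E^0$ of vertices, a set $E^1$ of edges, and maps $r,s:E^1\to E^0$ (range and source); loops and parallel edges are allowed. $E$ is row-finite if $s^{-1}(v)$ is finite for every $v\in E^0$. A path is a sequence of edges $\mu=e_1\cdots e_n$ with $r(e_i)=s(e_{i+1})$ for $1\le i\le n-1$; $s(\mu)=s(e_1)$, $r(\mu)=r(e_n)$. It is a cycle if $s(\mu)=r(\mu)$ and $s(e_i)\neq s(e_j)$ for $i\neq j$. An edge $f$ is an exit for $\mu$ if there is $i$ with $s(f)=s(e_i)$ and $f\neq e_i$. For $v,w\in E^0$ write $v\ge w$ if $v=w$ or there is a path from $v$ to $w$. Leavitt path algebras. For a row-finite graph $E$ and a field $K$, $L_K(E)$ is the (associative, possibly non-unital) $K$-algebra generated by a set $\{v\mid v\in E^0\}$ of pairwise orthogonal idempotents together with a set of variables $\{e,e^*\mid e\in E^1\}$, subject to the relations: (1) $s(e)e=er(e)=e$ for all $e\in E^1$; (2) $r(e)e^*=e^*s(e)=e^*$ for all $e\in E^1$; (3) $e^*e'=\delta_{e,e'}r(e)$ for all $e,e'\in E^1$; (4) $v=\sum_{e\in E^1,\, s(e)=v}ee^*$ for every $v\in E^0$ with $s^{-1}(v)\neq\emptyset$. Maximal tails. A nonempty subset $M\subseteq E^0$ is a maximal tail if: (1) $v\in E^0$, $w\in M$ and $v\ge w$ imply $v\in M$; (2) if $v\in M$ and $s^{-1}(v)\neq\emptyset$ then there is $e\in E^1$ with $s(e)=v$ and $r(e)\in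 M$; (3) if $v,w\in M$ then there is $y\in M$ with $v\ge y$ and $w\ge y$. $\mathcal{M}(E)$ is the set of maximal tails. A maximal tail $M$ is also regarded as a graph, with vertex set $M$ and edges those $e\in E^1$ with $r(e)\in M$ (then also $s(e)\in M$). $\mathcal{M}_\gamma(E)$ is the set of $M\in\mathcal{M}(E)$ such that every cycle in $M$ has an exit in the graph $M$, and $\mathcal{M}_\tau(E)=\mathcal{M}(E)\setminus\mathcal{M}_\gamma(E)$. Spectra and strata. $\mathrm{Spec}(A)$ is the set of (proper two-sided) prime ideals of $A$ with the Zariski topology (closed sets are the sets of primes containing a given ideal). For $M\in\mathcal{M}(E)$, the stratum corresponding to $M$ is $\mathrm{Spec}_M(L_K(E))=\{P\in\mathrm{Spec}(L_K(E)) : P\cap E^0=E^0\setminus M\}$, with the subspace topology. An ideal is primitive if it is the annihilator of a simple right module. *)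

theory Defs
  imports
    "HOL-Analysis.Abstract_Topology"
    "HOL-Algebra.QuotRing"
    "HOL-Algebra.Ideal_Product"
    "HOL-Library.Poly_Mapping"
    "HOL-Library.Disjoint_Sets"
    "Graph_Theory.Arc_Walk"
begin

section \<open>Rings without identity and their prime spectra\<close>

text \<open>
  Leavitt path algebras need not be unital, whereas \<^locale>\<open>ring\<close> and \<^locale>\<open>ideal\<close> require an
  identity.  We keep the record type of HOL-Algebra, but impose nothing on the field \<^const>\<open>one\<close>:
  its value is irrelevant to the ideals, spectra and modules below, and in \<open>free_algebra\<close> and
  \<open>LPA\<close> it need not lie in the carrier.
\<close>

locale rng = abelian_group R for R (structure) +
  assumes rng_m_closed: "\<lbrakk>x \<in> carrier R; y \<in> carrier R\<rbrakk> \<Longrightarrow> x \<otimes> y \<in> carrier R"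
    and rng_m_assoc: "\<lbrakk>x \<in> carrier R; y \<in> carrier R; z \<in> carrier R\<rbrakk>
          \<Longrightarrow> (x \<otimes> y) \<otimes> z = x \<otimes> (y \<otimes> z)"
    and rng_l_distr: "\<lbrakk>x \<in> carrier R; y \<in> carrier R; z \<in> carrier R\<rbrakk>
          \<Longrightarrow> (x \<oplus> y) \<otimes> z = x \<otimes> z \<oplus> y \<otimes> z"
    and rng_r_distr: "\<lbrakk>x \<in> carrier R; y \<in> carrier R; z \<in> carrier R\<rbrakk>
          \<Longrightarrow> z \<otimes> (x \<oplus> y) = z \<otimes> x \<oplus> z \<otimes> y"

locale rng_ideal = rng R + additive_subgroup I R for I and R (structure) +
  assumes rng_I_l_closed: "\<lbrakk>a \<in> I; x \<in> carrier R\<rbrakk> \<Longrightarrow> x \<otimes> a \<in> I"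
    and rng_I_r_closed: "\<lbrakk>a \<in> I; x \<in> carrier R\<rbrakk> \<Longrightarrow> a \<otimes> x \<in> I"

definition rng_prime_ideal :: "'a set \<Rightarrow> ('a, 'b) ring_scheme \<Rightarrow> bool" where
  "rng_prime_ideal P R \<longleftrightarrow> rng_ideal P R \<and> P \<noteq> carrier R \<and>
     (\<forall>I J. rng_ideal I R \<and> rng_ideal J R \<and> I \<cdot>\<^bsub>R\<^esub> J \<subseteq> P \<longrightarrow> I \<subseteq> P \<or> J \<subseteq> P)"

definition Spec :: "('a, 'b) ring_scheme \<Rightarrow> 'a set set" where
  "Spec R = {P. rng_prime_ideal P R}"

definition zariski :: "('a, 'b) ring_scheme \<Rightarrow> 'a set topology" where
  "zariski R = topology (\<lambda>U. \<exists>I. rng_ideal I R \<and> U = Spec R - {P \<in> Spec R. I \<subseteq> P})"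

lemma (in ring) rng: "rng R"
  by unfold_locales (simp_all add: m_assoc l_distr r_distr)

lemma (in ring) rng_ideal_iff_ideal: "rng_ideal I R \<longleftrightarrow> ideal I R"
proof
  assume "rng_ideal I R"
  then interpret I: rng_ideal I R .
  show "ideal I R"
    by (intro ideal.intro ideal_axioms.intro)
      (auto intro: I.rng_I_l_closed I.rng_I_r_closed ring_axioms I.additive_subgroup_axioms)
next
  assume "ideal I R"
  then interpret I: ideal I R .
  show "rng_ideal I R"
    by (intro rng_ideal.intro rng_ideal_axioms.intro)
      (auto intro: I.I_l_closed I.I_r_closed rng I.additive_subgroup_axioms)
qed

lemma (in rng_ideal) ideal_prod_subset:
  assumes "J \<subseteq> carrier R"
  shows "I \<cdot> J \<subseteq> I" "J \<cdot> I \<subseteq> I"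
proof -
  show "I \<cdot> J \<subseteq> I"
  proof
    fix x assume "x \<in> I \<cdot> J"
    then show "x \<in> I" using assms by induction (auto intro: rng_I_r_closed)
  qed
  show "J \<cdot> I \<subseteq> I"
  proof
    fix x assume "x \<in> J \<cdot> I"
    then show "x \<in> I" using assms by induction (auto intro: rng_I_l_closed)
  qed
qed

context rng
begin

lemma rng_idealI:
  assumes "I \<subseteq> carrier R" "\<zero> \<in> I"
    and "\<And>x y. x \<in> I \<Longrightarrow> y \<in> I \<Longrightarrow> x \<oplus> y \<in> I"
    and "\<And>x. x \<in> I \<Longrightarrow> \<ominus> x \<in> I"
    and "\<And>a x. a \<in> I \<Longrightarrow> x \<in> carrier R \<Longrightarrow> x \<otimes> a \<in> I"
    and "\<And>a x. a \<in> I \<Longrightarrow> x \<in> carrier R \<Longrightarrow> a \<otimes> x \<in> I"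
  shows "rng_ideal I R"
proof -
  have "subgroup I (add_monoid R)"
    using assms(1-4) by (intro add.subgroupI) auto
  then show ?thesis
    using assms(5,6)
    by (intro rng_ideal.intro rng_ideal_axioms.intro rng_axioms additive_subgroup.intro)
qed

lemma rng_ideal_Inter:
  assumes "\<And>I. I \<in> S \<Longrightarrow> rng_ideal I R" "S \<noteq> {}"
  shows "rng_ideal (\<Inter>S) R"
proof -
  have sub: "additive_subgroup I R" if "I \<in> S" for I
    using assms(1)[OF that] rng_ideal.axioms(2) by blast
  have "\<Inter>S \<subseteq> carrier R"
    using assms(2) additive_subgroup.a_subset[OF sub] by blast
  moreover have "\<zero> \<in> \<Inter>S"
    using additive_subgroup.zero_closed[OF sub] by blast
  moreover have "x \<oplus> y \<in> \<Inter>S" if "x \<in> \<Inter>S" "y \<in> \<Inter>S" for x y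
    using additive_subgroup.a_closed[OF sub] that by blast
  moreover have "\<ominus> x \<in> \<Inter>S" if "x \<in> \<Inter>S" for x
    using additive_subgroup.a_inv_closed[OF sub] that by blast
  moreover have "x \<otimes> a \<in> \<Inter>S" "a \<otimes> x \<in> \<Inter>S" if "a \<in> \<Inter>S" "x \<in> carrier R" for a x
    using rng_ideal.rng_I_l_closed[OF assms(1)] rng_ideal.rng_I_r_closed[OF assms(1)] that
    by blast+
  ultimately show ?thesis
    by (rule rng_idealI)
qed

lemma rng_ideal_carrier: "rng_ideal (carrier R) R"
  by (intro rng_idealI) (auto intro: rng_m_closed)

lemma m_zero:
  assumes "x \<in> carrier R"
  shows "\<zero> \<otimes> x = \<zero>" "x \<otimes> \<zero> = \<zero>"
proof -
  have "\<zero> \<otimes> x \<oplus> \<zero> \<otimes> x = \<zero> \<otimes> x \<oplus> \<zero>"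
    using rng_l_distr[of \<zero> \<zero> x] assms rng_m_closed by simp
  then show "\<zero> \<otimes> x = \<zero>"
    using assms rng_m_closed by (metis add.l_cancel_one zero_closed r_zero)
  have "x \<otimes> \<zero> \<oplus> x \<otimes> \<zero> = x \<otimes> \<zero> \<oplus> \<zero>"
    using rng_r_distr[of \<zero> \<zero> x] assms rng_m_closed by simp
  then show "x \<otimes> \<zero> = \<zero>"
    using assms rng_m_closed by (metis add.l_cancel_one zero_closed r_zero)
qed

lemma rng_ideal_zero: "rng_ideal {\<zero>} R"
  by (intro rng_idealI) (auto simp: m_zero)

lemma istopology_zariski:
  "istopology (\<lambda>U. \<exists>I. rng_ideal I R \<and> U = Spec R - {P \<in> Spec R. I \<subseteq> P})"
  unfolding istopology_def
proof (intro conjI allI impI)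
  fix S T
  assume S: "\<exists>I. rng_ideal I R \<and> S = Spec R - {P \<in> Spec R. I \<subseteq> P}"
    and T: "\<exists>I. rng_ideal I R \<and> T = Spec R - {P \<in> Spec R. I \<subseteq> P}"
  from S obtain I where I: "rng_ideal I R" "S = Spec R - {P \<in> Spec R. I \<subseteq> P}"
    by (elim exE conjE)
  from T obtain J where J: "rng_ideal J R" "T = Spec R - {P \<in> Spec R. J \<subseteq> P}"
    by (elim exE conjE)
  have sub: "I \<subseteq> carrier R" "J \<subseteq> carrier R"
    using I(1) J(1) rng_ideal.axioms(2) additive_subgroup.a_subset by blast+
  have IJ: "I \<cdot> J \<subseteq> I \<inter> J"
    using rng_ideal.ideal_prod_subset(1)[OF I(1) sub(2)]
      rng_ideal.ideal_prod_subset(2)[OF J(1) sub(1)] by (rule Int_greatest)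
  have "I \<subseteq> P \<or> J \<subseteq> P" if "P \<in> Spec R" "I \<inter> J \<subseteq> P" for P
    using that I(1) J(1) IJ unfolding Spec_def rng_prime_ideal_def by blast
  then have "S \<inter> T = Spec R - {P \<in> Spec R. I \<inter> J \<subseteq> P}"
    unfolding I(2) J(2) by blast
  moreover have "rng_ideal (I \<inter> J) R"
    using rng_ideal_Inter[of "{I, J}"] I(1) J(1) by auto
  ultimately show "\<exists>I. rng_ideal I R \<and> S \<inter> T = Spec R - {P \<in> Spec R. I \<subseteq> P}"
    by blast
next
  fix \<K>
  assume "\<forall>K\<in>\<K>. \<exists>I. rng_ideal I R \<and> K = Spec R - {P \<in> Spec R. I \<subseteq> P}"
  from bchoice[OF this] obtain f where
    *: "\<forall>K\<in>\<K>. rng_ideal (f K) R \<and> K = Spec R - {P \<in> Spec R. f K \<subseteq> P}"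
    by (elim exE)
  have f: "\<And>K. K \<in> \<K> \<Longrightarrow> rng_ideal (f K) R"
    using * by simp
  have f_mem: "P \<in> K \<longleftrightarrow> P \<in> Spec R \<and> \<not> f K \<subseteq> P" if "K \<in> \<K>" for P K
  proof -
    have "P \<in> K \<longleftrightarrow> P \<in> Spec R - {P \<in> Spec R. f K \<subseteq> P}"
      using bspec[OF * that] by (elim conjE) (rule arg_cong[where f = "\<lambda>U. P \<in> U"])
    then show ?thesis by blast
  qed
  define J where "J = \<Inter>{I. rng_ideal I R \<and> \<Union>(f ` \<K>) \<subseteq> I}"
  have "\<Union>(f ` \<K>) \<subseteq> carrier R"
    using f rng_ideal.axioms(2) additive_subgroup.a_subset by blast
  then have J: "rng_ideal J R"
    unfolding J_def by (intro rng_ideal_Inter) (use rng_ideal_carrier in auto)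
  have J_iff: "J \<subseteq> P \<longleftrightarrow> (\<forall>K\<in>\<K>. f K \<subseteq> P)" if "P \<in> Spec R" for P
  proof
    assume "\<forall>K\<in>\<K>. f K \<subseteq> P"
    moreover have "rng_ideal P R" using that by (simp add: Spec_def rng_prime_ideal_def)
    ultimately show "J \<subseteq> P" unfolding J_def by blast
  next
    assume "J \<subseteq> P"
    then show "\<forall>K\<in>\<K>. f K \<subseteq> P" unfolding J_def by blast
  qed
  have "\<Union>\<K> = Spec R - {P \<in> Spec R. J \<subseteq> P}"
  proof (rule Set.set_eqI)
    fix P show "P \<in> \<Union>\<K> \<longleftrightarrow> P \<in> Spec R - {P \<in> Spec R. J \<subseteq> P}"
      using f_mem[of _ P] J_iff[of P] by auto
  qed
  with J show "\<exists>I. rng_ideal I R \<and> \<Union>\<K> = Spec R - {P \<in> Spec R. I \<subseteq> P}"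
    by blast
qed

lemma openin_zariski:
  "openin (zariski R) U \<longleftrightarrow> (\<exists>I. rng_ideal I R \<and> U = Spec R - {P \<in> Spec R. I \<subseteq> P})"
  unfolding zariski_def using topology_inverse'[OF istopology_zariski] by simp

end

lemma (in rng_ideal) rcoset_mult_add:
  assumes x: "x \<in> carrier R" and y: "y \<in> carrier R"
  shows "[mod I:] (I +> x) \<Otimes> (I +> y) = I +> (x \<otimes> y)"
proof -
  interpret abelian_subgroup I R
    by (intro abelian_subgroupI3 additive_subgroup_axioms abelian_group_axioms)
  have eq: "I +> (a \<otimes> b) = I +> (x \<otimes> y)" if a: "a \<in> I +> x" and b: "b \<in> I +> y" for a b
  proof -
    from a obtain h where h: "h \<in> I" "a = h \<oplus> x" unfolding a_r_coset_def' by blast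
    from b obtain k where k: "k \<in> I" "b = k \<oplus> y" unfolding a_r_coset_def' by blast
    have hk: "h \<in> carrier R" "k \<in> carrier R" using h(1) k(1) a_subset by auto
    have "a \<otimes> b = (h \<otimes> b \<oplus> x \<otimes> k) \<oplus> x \<otimes> y"
      using hk x y unfolding h(2) k(2)
      by (simp add: rng_l_distr rng_r_distr rng_m_closed a_ac)
    moreover have "h \<otimes> b \<oplus> x \<otimes> k \<in> I"
      using h(1) k x hk y by (intro a_closed rng_I_r_closed rng_I_l_closed) auto
    ultimately have "a \<otimes> b \<in> I +> (x \<otimes> y)"
      unfolding a_r_coset_def' by blast
    then show ?thesis
      using a_repr_independence'[OF _ rng_m_closed[OF x y]] by simp
  qed
  have "x \<in> I +> x" "y \<in> I +> y"
    using a_rcos_self x y by auto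
  then show ?thesis
    unfolding rcoset_mult_def using eq by blast
qed

lemma (in rng_ideal) rng_Quot: "rng (R Quot I)"
proof -
  interpret abelian_subgroup I R
    by (intro abelian_subgroupI3 additive_subgroup_axioms abelian_group_axioms)
  have "abelian_group (R Quot I)"
    by (rule comm_group_abelian_groupI)
      (simp add: FactRing_def a_factorgroup_is_comm_group[unfolded A_FactGroup_def'])
  then show ?thesis
    by (intro rng.intro rng_axioms.intro)
      (auto simp: FactRing_simps rcoset_mult_add a_rcos_sum rng_m_assoc rng_l_distr rng_r_distr
        rng_m_closed)
qed

text \<open>For commutative rings with identity this is the usual set of prime ideals.\<close>

lemma (in cring) Spec_eq_primeideals: "Spec R = {P. primeideal P R}"
proof (intro Set.set_eqI iffI CollectI)
  fix P assume "P \<in> Spec R"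
  then have P: "rng_prime_ideal P R" by (simp add: Spec_def)
  then have idl: "ideal P R" by (simp add: rng_prime_ideal_def rng_ideal_iff_ideal)
  interpret P: ideal P R by (rule idl)
  show "primeideal P R"
  proof (rule primeidealI[OF idl cring_axioms])
    show "carrier R \<noteq> P" using P by (auto simp: rng_prime_ideal_def)
    fix a b assume ab: "a \<in> carrier R" "b \<in> carrier R" "a \<otimes> b \<in> P"
    have "(PIdl a) \<cdot> (PIdl b) \<subseteq> P"
    proof
      fix x assume "x \<in> (PIdl a) \<cdot> (PIdl b)"
      then show "x \<in> P"
      proof induction
        case (prod i j)
        then obtain c d where cd: "c \<in> carrier R" "d \<in> carrier R" "i = c \<otimes> a" "j = d \<otimes> b"
          unfolding cgenideal_def by blast
        then have "i \<otimes> j = (c \<otimes> d) \<otimes> (a \<otimes> b)"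
          using ab by (simp add: m_ac)
        then show ?case
          using P.I_l_closed[OF ab(3)] cd by simp
      qed (rule P.a_closed)
    qed
    then have "(PIdl a) \<subseteq> P \<or> (PIdl b) \<subseteq> P"
      using P cgenideal_ideal ab unfolding rng_prime_ideal_def rng_ideal_iff_ideal by blast
    then show "a \<in> P \<or> b \<in> P"
      using cgenideal_self ab by blast
  qed
next
  fix P assume "P \<in> {P. primeideal P R}"
  then interpret P: primeideal P R by simp
  have "I \<subseteq> P \<or> J \<subseteq> P" if "ideal I R" "ideal J R" "I \<cdot> J \<subseteq> P" for I J
  proof (rule ccontr)
    assume "\<not> (I \<subseteq> P \<or> J \<subseteq> P)"
    then obtain a b where ab: "a \<in> I" "a \<notin> P" "b \<in> J" "b \<notin> P" by blast
    have "a \<otimes> b \<in> P"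
      by (rule subsetD[OF that(3) ideal_prod.prod[OF ab(1,3)]])
    then show False
      using P.I_prime[OF ideal.Icarr[OF that(1) ab(1)] ideal.Icarr[OF that(2) ab(3)]] ab by simp
  qed
  then show "P \<in> Spec R"
    using P.I_notcarr P.is_ideal
    by (auto simp: Spec_def rng_prime_ideal_def rng_ideal_iff_ideal)
qed

definition type_ring :: "'a::ring_1 ring" where
  "type_ring = \<lparr>carrier = UNIV, mult = (*), one = 1, zero = 0, add = (+)\<rparr>"

section \<open>Primitive ideals\<close>

locale right_rng_module = R: rng R + M: abelian_group M
  for R :: "('a, 'b) ring_scheme" and M :: "('m, 'c) ring_scheme" and act :: "'m \<Rightarrow> 'a \<Rightarrow> 'm" +
  assumes act_closed: "\<lbrakk>m \<in> carrier M; a \<in> carrier R\<rbrakk> \<Longrightarrow> act m a \<in> carrier M"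
    and act_add_left: "\<lbrakk>m \<in> carrier M; n \<in> carrier M; a \<in> carrier R\<rbrakk>
          \<Longrightarrow> act (m \<oplus>\<^bsub>M\<^esub> n) a = act m a \<oplus>\<^bsub>M\<^esub> act n a"
    and act_add_right: "\<lbrakk>m \<in> carrier M; a \<in> carrier R; b \<in> carrier R\<rbrakk>
          \<Longrightarrow> act m (a \<oplus>\<^bsub>R\<^esub> b) = act m a \<oplus>\<^bsub>M\<^esub> act m b"
    and act_assoc: "\<lbrakk>m \<in> carrier M; a \<in> carrier R; b \<in> carrier R\<rbrakk>
          \<Longrightarrow> act (act m a) b = act m (a \<otimes>\<^bsub>R\<^esub> b)"

definition simple_right_module ::
  "('a, 'b) ring_scheme \<Rightarrow> ('m, 'c) ring_scheme \<Rightarrow> ('m \<Rightarrow> 'a \<Rightarrow> 'm) \<Rightarrow> bool" where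
  "simple_right_module R M act \<longleftrightarrow> right_rng_module R M act \<and>
     (\<exists>m\<in>carrier M. \<exists>a\<in>carrier R. act m a \<noteq> \<zero>\<^bsub>M\<^esub>) \<and>
     (\<forall>N. additive_subgroup N M \<and> (\<forall>n\<in>N. \<forall>a\<in>carrier R. act n a \<in> N)
        \<longrightarrow> N = {\<zero>\<^bsub>M\<^esub>} \<or> N = carrier M)"

definition module_annihilator ::
  "('a, 'b) ring_scheme \<Rightarrow> ('m, 'c) ring_scheme \<Rightarrow> ('m \<Rightarrow> 'a \<Rightarrow> 'm) \<Rightarrow> 'a set" where
  "module_annihilator R M act = {a \<in> carrier R. \<forall>m\<in>carrier M. act m a = \<zero>\<^bsub>M\<^esub>}"

text \<open>
  A definition cannot quantify over types, so the elements of the module are taken in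
  \<^typ>\<open>'a set\<close>.  This is no restriction: a simple module is a quotient of the ring by a right ideal,
  hence can be realised on cosets; see \<open>primitive_idealI\<close> below.
\<close>

definition primitive_ideal :: "'a set \<Rightarrow> ('a, 'b) ring_scheme \<Rightarrow> bool" where
  "primitive_ideal P R \<longleftrightarrow>
     (\<exists>(M :: 'a set ring) act. simple_right_module R M act \<and> P = module_annihilator R M act)"

lemma primitive_idealI:
  fixes R :: "('a, 'b) ring_scheme" and M :: "('m, 'c) ring_scheme"
  assumes simple: "simple_right_module R M act"
  shows "primitive_ideal (module_annihilator R M act) R"
proof -
  interpret right_rng_module R M act
    using simple by (simp add: simple_right_module_def)
  obtain m0 a0 where m0: "m0 \<in> carrier M" and a0: "a0 \<in> carrier R" and nz: "act m0 a0 \<noteq> \<zero>\<^bsub>M\<^esub>"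
    using simple by (auto simp: simple_right_module_def)
  have dich: "N = {\<zero>\<^bsub>M\<^esub>} \<or> N = carrier M"
    if "additive_subgroup N M" "\<And>n a. n \<in> N \<Longrightarrow> a \<in> carrier R \<Longrightarrow> act n a \<in> N" for N
    using simple that unfolding simple_right_module_def by blast
  have act_zero: "act m \<zero>\<^bsub>R\<^esub> = \<zero>\<^bsub>M\<^esub>" if "m \<in> carrier M" for m
    using act_add_right[OF that R.zero_closed R.zero_closed] act_closed[OF that R.zero_closed]
    by simp
  have act_minus: "act m (\<ominus>\<^bsub>R\<^esub> a) = \<ominus>\<^bsub>M\<^esub> act m a" if "m \<in> carrier M" "a \<in> carrier R" for m a
    using act_add_right[OF that(1) R.a_inv_closed[OF that(2)] that(2)] that
    by (intro M.minus_equality[symmetric]) (simp_all add: act_zero act_closed R.l_neg)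
  have gen: "act m0 ` carrier R = carrier M"
  proof -
    have "additive_subgroup (act m0 ` carrier R) M"
    proof (intro additive_subgroup.intro M.add.subgroupI)
      show "act m0 ` carrier R \<subseteq> carrier M"
        using act_closed m0 by blast
      show "act m0 ` carrier R \<noteq> {}"
        using a0 by blast
      show "\<ominus>\<^bsub>M\<^esub> x \<in> act m0 ` carrier R" if "x \<in> act m0 ` carrier R" for x
        using that by (auto simp: act_minus[OF m0, symmetric])
      show "x \<oplus>\<^bsub>M\<^esub> y \<in> act m0 ` carrier R"
        if "x \<in> act m0 ` carrier R" "y \<in> act m0 ` carrier R" for x y
        using that by (auto simp: act_add_right[OF m0, symmetric])
    qed
    moreover have "act n a \<in> act m0 ` carrier R" if "n \<in> act m0 ` carrier R" "a \<in> carrier R" for n a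
      using that by (auto simp: act_assoc[OF m0] intro: R.rng_m_closed)
    ultimately show ?thesis
      using dich[of "act m0 ` carrier R"] a0 nz by blast
  qed
  define f where "f m = {a \<in> carrier R. act m0 a = m}" for m
  have inj: "inj_on f (carrier M)"
  proof (rule inj_onI)
    fix x y assume "x \<in> carrier M" "f x = f y"
    moreover obtain a where "a \<in> carrier R" "x = act m0 a"
      using \<open>x \<in> carrier M\<close> unfolding gen[symmetric] by blast
    ultimately show "x = y" unfolding f_def by blast
  qed
  define g where "g = inv_into (carrier M) f"
  have gf: "g (f m) = m" if "m \<in> carrier M" for m
    unfolding g_def by (rule inv_into_f_f[OF inj that])
  define M' :: "'a set ring" where
    "M' = \<lparr>carrier = f ` carrier M, mult = undefined, one = undefined,
           zero = f \<zero>\<^bsub>M\<^esub>, add = (\<lambda>x y. f (g x \<oplus>\<^bsub>M\<^esub> g y))\<rparr>"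
  define act' where "act' x a = f (act (g x) a)" for x a
  have M'_sel: "carrier M' = f ` carrier M" "\<zero>\<^bsub>M'\<^esub> = f \<zero>\<^bsub>M\<^esub>"
    "\<And>x y. x \<oplus>\<^bsub>M'\<^esub> y = f (g x \<oplus>\<^bsub>M\<^esub> g y)"
    by (simp_all add: M'_def)
  have "abelian_group M'"
  proof (rule abelian_groupI)
    fix x assume "x \<in> carrier M'"
    then obtain m where m: "m \<in> carrier M" "x = f m" unfolding M'_sel by blast
    then show "\<exists>y\<in>carrier M'. y \<oplus>\<^bsub>M'\<^esub> x = \<zero>\<^bsub>M'\<^esub>"
      by (intro bexI[of _ "f (\<ominus>\<^bsub>M\<^esub> m)"]) (simp_all add: M'_sel gf M.l_neg)
  qed (auto simp: M'_sel gf M.a_ac)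
  then interpret M': abelian_group M' .
  have "right_rng_module R M' act'"
    by unfold_locales
      (auto simp: M'_sel gf act'_def act_closed act_add_left act_add_right act_assoc)
  moreover have "\<exists>m\<in>carrier M'. \<exists>a\<in>carrier R. act' m a \<noteq> \<zero>\<^bsub>M'\<^esub>"
    using m0 a0 nz inj_onD[OF inj _ act_closed[OF m0 a0] M.zero_closed]
    by (intro bexI[of _ "f m0"] bexI[of _ a0]) (auto simp: M'_sel act'_def gf)
  moreover have "N' = {\<zero>\<^bsub>M'\<^esub>} \<or> N' = carrier M'"
    if sub: "additive_subgroup N' M'" and cl: "\<And>n a. n \<in> N' \<Longrightarrow> a \<in> carrier R \<Longrightarrow> act' n a \<in> N'" for N'
  proof -
    interpret N': additive_subgroup N' M' by (rule sub)
    define N where "N = {m \<in> carrier M. f m \<in> N'}"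
    have N': "N' = f ` N"
      using N'.a_subset unfolding N_def M'_sel by blast
    have "additive_subgroup N M"
    proof (intro additive_subgroup.intro M.add.subgroupI)
      show "N \<subseteq> carrier M" by (simp add: N_def)
      show "N \<noteq> {}" using N'.zero_closed unfolding N_def M'_sel by blast
      show "\<ominus>\<^bsub>M\<^esub> x \<in> N" if "x \<in> N" for x
      proof -
        have x: "x \<in> carrier M" "f x \<in> N'" using that by (simp_all add: N_def)
        have "\<ominus>\<^bsub>M'\<^esub> f x = f (\<ominus>\<^bsub>M\<^esub> x)"
          using x(1) by (intro M'.minus_equality) (simp_all add: M'_sel gf M.l_neg)
        then show ?thesis
          using x N'.a_inv_closed[OF x(2)] by (simp add: N_def)
      qed
      show "x \<oplus>\<^bsub>M\<^esub> y \<in> N" if "x \<in> N" "y \<in> N" for x y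
        using that N'.a_closed[of "f x" "f y"] by (simp add: N_def M'_sel gf)
    qed
    moreover have "act n a \<in> N" if "n \<in> N" "a \<in> carrier R" for n a
      using that cl[of "f n" a] by (simp add: N_def act'_def gf act_closed)
    ultimately have "N = {\<zero>\<^bsub>M\<^esub>} \<or> N = carrier M"
      by (rule dich)
    then show ?thesis
      unfolding N' M'_sel by auto
  qed
  ultimately have "simple_right_module R M' act'"
    unfolding simple_right_module_def by blast
  moreover have "module_annihilator R M act = module_annihilator R M' act'"
  proof -
    have "f (act m a) = f \<zero>\<^bsub>M\<^esub> \<longleftrightarrow> act m a = \<zero>\<^bsub>M\<^esub>" if "m \<in> carrier M" "a \<in> carrier R" for m a
      using inj_on_eq_iff[OF inj act_closed[OF that] M.zero_closed] .
    then show ?thesis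
      unfolding module_annihilator_def by (auto simp: M'_sel act'_def gf)
  qed
  ultimately show ?thesis
    unfolding primitive_ideal_def by blast
qed

section \<open>Maximal tails of a directed graph\<close>

text \<open>
  Range and source of an edge are \<^const>\<open>head\<close> and \<^const>\<open>tail\<close>; \<^term>\<open>out_arcs E v\<close> is the set of
  edges with source \<^term>\<open>v\<close>.
\<close>

definition row_finite :: "('v, 'e) pre_digraph \<Rightarrow> bool" where
  "row_finite E \<longleftrightarrow> (\<forall>v\<in>verts E. finite (out_arcs E v))"

text \<open>The empty walk accounts for the case \<open>v = w\<close>.\<close>

definition connects :: "('v, 'e) pre_digraph \<Rightarrow> 'v \<Rightarrow> 'v \<Rightarrow> bool" where
  "connects E v w \<longleftrightarrow> (\<exists>p. pre_digraph.awalk E v p w)"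

definition has_exit :: "('v, 'e) pre_digraph \<Rightarrow> 'e list \<Rightarrow> bool" where
  "has_exit E p \<longleftrightarrow> (\<exists>f\<in>arcs E. \<exists>e\<in>set p. tail E f = tail E e \<and> f \<noteq> e)"

definition maximal_tails :: "('v, 'e) pre_digraph \<Rightarrow> 'v set set" where
  "maximal_tails E = {M. M \<subseteq> verts E \<and> M \<noteq> {} \<and>
     (\<forall>v\<in>verts E. \<forall>w\<in>M. connects E v w \<longrightarrow> v \<in> M) \<and>
     (\<forall>v\<in>M. out_arcs E v \<noteq> {} \<longrightarrow> (\<exists>e\<in>arcs E. tail E e = v \<and> head E e \<in> M)) \<and>
     (\<forall>v\<in>M. \<forall>w\<in>M. \<exists>y\<in>M. connects E v y \<and> connects E w y)}"

definition tail_graph :: "('v, 'e) pre_digraph \<Rightarrow> 'v set \<Rightarrow> ('v, 'e) pre_digraph" where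
  "tail_graph E M =
     \<lparr>verts = M, arcs = {e \<in> arcs E. head E e \<in> M}, tail = tail E, head = head E\<rparr>"

definition maximal_tails_gamma :: "('v, 'e) pre_digraph \<Rightarrow> 'v set set" where
  "maximal_tails_gamma E = {M \<in> maximal_tails E.
     \<forall>p. pre_digraph.cycle (tail_graph E M) p \<longrightarrow> has_exit (tail_graph E M) p}"

definition maximal_tails_tau :: "('v, 'e) pre_digraph \<Rightarrow> 'v set set" where
  "maximal_tails_tau E = maximal_tails E - maximal_tails_gamma E"

text \<open>
  The library's cycles have pairwise distinct ranges of edges; for closed walks this is the same as
  pairwise distinct sources.
\<close>

lemma (in wf_digraph) cycle_iff_distinct_tails:
  "cycle p \<longleftrightarrow> (\<exists>u. awalk u p u) \<and> p \<noteq> [] \<and> distinct (map (tail G) p)"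
proof -
  have "distinct (tl (awalk_verts u p)) \<longleftrightarrow> distinct (map (tail G) p)"
    if "awalk u p u" "p \<noteq> []" for u
  proof -
    have "cas u q v \<Longrightarrow> awalk_verts u q = map (tail G) q @ [v]" for q u v
      by (induction q arbitrary: u) auto
    then have "awalk_verts u p = map (tail G) p @ [u]"
      using that(1) by (simp add: awalk_def)
    moreover have "tail G (hd p) = u"
      using that by (cases p) (auto simp: awalk_def)
    ultimately show ?thesis
      using that(2) by (cases p) auto
  qed
  then show ?thesis
    unfolding cycle_def by blast
qed

section \<open>Free algebras\<close>

text \<open>Words form the free monoid, written additively as required by \<^type>\<open>poly_mapping\<close>.\<close>

datatype 'g free_word = Word (letters: "'g list")

instantiation free_word :: (type) monoid_add
begin

definition "0 = Word []"

definition "w + w' = Word (letters w @ letters w')"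

instance
  by standard (simp_all add: zero_free_word_def plus_free_word_def)

end

text \<open>
  The free associative \<open>'k\<close>-algebra without identity on \<^term>\<open>X\<close>: finite linear combinations of
  nonempty words over \<^term>\<open>X\<close>.
\<close>

definition free_algebra :: "'g set \<Rightarrow> ('g free_word \<Rightarrow>\<^sub>0 'k::field) ring" where
  "free_algebra X = type_ring
     \<lparr>carrier := {f. \<forall>w\<in>Poly_Mapping.keys f. letters w \<noteq> [] \<and> set (letters w) \<subseteq> X}\<rparr>"

definition gen :: "'g \<Rightarrow> ('g free_word \<Rightarrow>\<^sub>0 'k::field)" where
  "gen g = Poly_Mapping.single (Word [g]) 1"

text \<open>
  Ideals of \<open>'k\<close>-algebras are closed under scalars; without identity this does not follow from
  closure under multiplication.  Multiplication by \<open>single 0 c\<close> is scalar multiplication by \<open>c\<close>.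
\<close>

definition generated_algebra_ideal ::
  "'g set \<Rightarrow> ('g free_word \<Rightarrow>\<^sub>0 'k::field) set \<Rightarrow> ('g free_word \<Rightarrow>\<^sub>0 'k) set" where
  "generated_algebra_ideal X S = \<Inter>{I. rng_ideal I (free_algebra X) \<and>
     (\<forall>c. \<forall>f\<in>I. Poly_Mapping.single 0 c * f \<in> I) \<and> S \<subseteq> I}"

lemma free_algebra_simps:
  "\<zero>\<^bsub>free_algebra X\<^esub> = 0" "f \<oplus>\<^bsub>free_algebra X\<^esub> g = f + g" "f \<otimes>\<^bsub>free_algebra X\<^esub> g = f * g"
  by (simp_all add: free_algebra_def type_ring_def)

lemma free_algebra_carrier:
  "f \<in> carrier (free_algebra X) \<longleftrightarrow>
     (\<forall>w\<in>Poly_Mapping.keys f. letters w \<noteq> [] \<and> set (letters w) \<subseteq> X)"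
  by (simp add: free_algebra_def)

lemma gen_in_free_algebra: "g \<in> X \<Longrightarrow> gen g \<in> carrier (free_algebra X)"
  by (simp add: free_algebra_carrier gen_def)

lemma free_algebra_add:
  assumes "f \<in> carrier (free_algebra X)" "g \<in> carrier (free_algebra X)"
  shows "f + g \<in> carrier (free_algebra X)"
  using assms Poly_Mapping.keys_add[of f g] unfolding free_algebra_carrier by blast

lemma free_algebra_diff:
  assumes "f \<in> carrier (free_algebra X)" "g \<in> carrier (free_algebra X)"
  shows "f - g \<in> carrier (free_algebra X)"
  using assms keys_diff[of f g] unfolding free_algebra_carrier by blast

lemma free_algebra_mult:
  assumes "f \<in> carrier (free_algebra X)" "g \<in> carrier (free_algebra X)"
  shows "f * g \<in> carrier (free_algebra X)"
  unfolding free_algebra_carrier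
proof
  fix w assume "w \<in> Poly_Mapping.keys (f * g)"
  then obtain u v where "w = u + v" "u \<in> Poly_Mapping.keys f" "v \<in> Poly_Mapping.keys g"
    using Poly_Mapping.keys_mult[of f g] by blast
  then show "letters w \<noteq> [] \<and> set (letters w) \<subseteq> X"
    using assms unfolding free_algebra_carrier by (simp add: plus_free_word_def)
qed

lemma free_algebra_scale:
  assumes "f \<in> carrier (free_algebra X)"
  shows "Poly_Mapping.single 0 c * f \<in> carrier (free_algebra X)"
  unfolding free_algebra_carrier
proof
  fix w assume "w \<in> Poly_Mapping.keys (Poly_Mapping.single 0 c * f)"
  then obtain u v where "w = u + v" "u \<in> Poly_Mapping.keys (Poly_Mapping.single 0 c)"
    "v \<in> Poly_Mapping.keys f"
    using Poly_Mapping.keys_mult[of "Poly_Mapping.single 0 c" f] by blast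
  then show "letters w \<noteq> [] \<and> set (letters w) \<subseteq> X"
    using assms unfolding free_algebra_carrier by (auto split: if_splits)
qed

lemma free_algebra_sum:
  assumes "\<And>i. i \<in> A \<Longrightarrow> h i \<in> carrier (free_algebra X)"
  shows "sum h A \<in> carrier (free_algebra X)"
  using assms
  by (induction A rule: infinite_finite_induct) (auto simp: free_algebra_carrier[of 0] intro: free_algebra_add)

lemma rng_free_algebra: "rng (free_algebra X :: ('g free_word \<Rightarrow>\<^sub>0 'k::field) ring)"
proof -
  have "abelian_group (free_algebra X :: ('g free_word \<Rightarrow>\<^sub>0 'k) ring)"
  proof (rule abelian_groupI)
    fix f :: "'g free_word \<Rightarrow>\<^sub>0 'k" assume "f \<in> carrier (free_algebra X)"
    then show "\<exists>g\<in>carrier (free_algebra X). g \<oplus>\<^bsub>free_algebra X\<^esub> f = \<zero>\<^bsub>free_algebra X\<^esub>"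
      by (intro bexI[of _ "- f"]) (simp_all add: free_algebra_simps free_algebra_carrier)
  qed (auto simp: free_algebra_simps free_algebra_carrier[of 0] add.assoc add.commute
      intro: free_algebra_add)
  then show ?thesis
    by (intro rng.intro rng_axioms.intro)
      (auto simp: free_algebra_simps algebra_simps intro: free_algebra_mult)
qed

lemma rng_ideal_generated_algebra_ideal:
  assumes "S \<subseteq> carrier (free_algebra X)"
  shows "rng_ideal (generated_algebra_ideal X S) (free_algebra X)"
  unfolding generated_algebra_ideal_def
proof (rule rng.rng_ideal_Inter[OF rng_free_algebra])
  have "carrier (free_algebra X) \<in> {I. rng_ideal I (free_algebra X) \<and>
     (\<forall>c. \<forall>f\<in>I. Poly_Mapping.single 0 c * f \<in> I) \<and> S \<subseteq> I}"
    using rng.rng_ideal_carrier[OF rng_free_algebra] free_algebra_scale assms by blast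
  then show "{I. rng_ideal I (free_algebra X) \<and>
     (\<forall>c. \<forall>f\<in>I. Poly_Mapping.single 0 c * f \<in> I) \<and> S \<subseteq> I} \<noteq> {}"
    by blast
qed blast

section \<open>Leavitt path algebras\<close>

datatype ('v, 'e) lpa_gen = Vertex 'v | Edge 'e | Ghost 'e

definition lpa_gens :: "('v, 'e) pre_digraph \<Rightarrow> ('v, 'e) lpa_gen set" where
  "lpa_gens E = Vertex ` verts E \<union> Edge ` arcs E \<union> Ghost ` arcs E"

inductive_set lpa_relations ::
  "('v, 'e) pre_digraph \<Rightarrow> (('v, 'e) lpa_gen free_word \<Rightarrow>\<^sub>0 'k::field) set"
  for E where
  idem: "v \<in> verts E \<Longrightarrow> gen (Vertex v) * gen (Vertex v) - gen (Vertex v) \<in> lpa_relations E"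
| orth: "\<lbrakk>v \<in> verts E; w \<in> verts E; v \<noteq> w\<rbrakk> \<Longrightarrow> gen (Vertex v) * gen (Vertex w) \<in> lpa_relations E"
| source_edge: "e \<in> arcs E \<Longrightarrow> gen (Vertex (tail E e)) * gen (Edge e) - gen (Edge e) \<in> lpa_relations E"
| edge_range: "e \<in> arcs E \<Longrightarrow> gen (Edge e) * gen (Vertex (head E e)) - gen (Edge e) \<in> lpa_relations E"
| range_ghost: "e \<in> arcs E \<Longrightarrow> gen (Vertex (head E e)) * gen (Ghost e) - gen (Ghost e) \<in> lpa_relations E"
| ghost_source: "e \<in> arcs E \<Longrightarrow> gen (Ghost e) * gen (Vertex (tail E e)) - gen (Ghost e) \<in> lpa_relations E"
| ghost_edge: "e \<in> arcs E \<Longrightarrow> gen (Ghost e) * gen (Edge e) - gen (Vertex (head E e)) \<in> lpa_relations E"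
| ghost_edge_neq: "\<lbrakk>e \<in> arcs E; f \<in> arcs E; e \<noteq> f\<rbrakk> \<Longrightarrow> gen (Ghost e) * gen (Edge f) \<in> lpa_relations E"
| vertex_sum: "\<lbrakk>v \<in> verts E; out_arcs E v \<noteq> {}\<rbrakk> \<Longrightarrow>
    gen (Vertex v) - (\<Sum>e\<in>out_arcs E v. gen (Edge e) * gen (Ghost e)) \<in> lpa_relations E"

definition lpa_ideal :: "('v, 'e) pre_digraph \<Rightarrow> (('v, 'e) lpa_gen free_word \<Rightarrow>\<^sub>0 'k::field) set" where
  "lpa_ideal E = generated_algebra_ideal (lpa_gens E) (lpa_relations E)"

definition LPA :: "'k::field itself \<Rightarrow> ('v, 'e) pre_digraph
    \<Rightarrow> (('v, 'e) lpa_gen free_word \<Rightarrow>\<^sub>0 'k) set ring" where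
  "LPA K E = free_algebra (lpa_gens E) Quot lpa_ideal E"

definition lpa_vertex :: "'k::field itself \<Rightarrow> ('v, 'e) pre_digraph \<Rightarrow> 'v
    \<Rightarrow> (('v, 'e) lpa_gen free_word \<Rightarrow>\<^sub>0 'k) set" where
  "lpa_vertex K E v = lpa_ideal E +>\<^bsub>free_algebra (lpa_gens E)\<^esub> gen (Vertex v)"

lemma rng_LPA:
  assumes "wf_digraph E"
  shows "rng (LPA K E)"
proof -
  have *: "lpa_relations E \<subseteq> carrier (free_algebra (lpa_gens E))"
  proof
    fix f assume "f \<in> lpa_relations E"
    then show "f \<in> carrier (free_algebra (lpa_gens E))"
    proof induction
      case (vertex_sum v)
      have "(\<Sum>e\<in>out_arcs E v. gen (Edge e) * gen (Ghost e)) \<in> carrier (free_algebra (lpa_gens E))"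
        by (intro free_algebra_sum free_algebra_mult gen_in_free_algebra)
          (auto simp: lpa_gens_def)
      then show ?case
        using vertex_sum by (intro free_algebra_diff gen_in_free_algebra) (auto simp: lpa_gens_def)
    qed (use wf_digraph.tail_in_verts[OF assms] wf_digraph.head_in_verts[OF assms] in
        \<open>auto simp: lpa_gens_def intro!: free_algebra_diff free_algebra_mult gen_in_free_algebra\<close>)
  qed
  interpret rng_ideal "lpa_ideal E" "free_algebra (lpa_gens E)"
    unfolding lpa_ideal_def by (rule rng_ideal_generated_algebra_ideal[OF *])
  show ?thesis
    unfolding LPA_def by (rule rng_Quot)
qed

definition stratum :: "'k::field itself \<Rightarrow> ('v, 'e) pre_digraph \<Rightarrow> 'v set
    \<Rightarrow> (('v, 'e) lpa_gen free_word \<Rightarrow>\<^sub>0 'k) set set set" where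
  "stratum K E M = {P \<in> Spec (LPA K E). {v \<in> verts E. lpa_vertex K E v \<in> P} = verts E - M}"

definition stratum_space :: "'k::field itself \<Rightarrow> ('v, 'e) pre_digraph \<Rightarrow> 'v set
    \<Rightarrow> (('v, 'e) lpa_gen free_word \<Rightarrow>\<^sub>0 'k) set set topology" where
  "stratum_space K E M = subtopology (zariski (LPA K E)) (stratum K E M)"

definition field_ring :: "'k::field itself \<Rightarrow> 'k ring" where
  "field_ring K = type_ring"

text \<open>\<open>K[x, x\<^sup>-\<^sup>1]\<close> as the group algebra of the integers; \<open>single n c\<close> stands for \<open>c x\<^sup>n\<close>.\<close>

definition laurent_ring :: "'k::field itself \<Rightarrow> (int \<Rightarrow>\<^sub>0 'k) ring" where
  "laurent_ring K = type_ring"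

end

theory Submission
  imports Defs "HOL-Library.Sublist"
begin

text \<open>
  The algebra is spanned by the elements \<open>\<mu>\<nu>\<^sup>*\<close> with paths \<open>\<mu>\<close>, \<open>\<nu>\<close> of common range, and the vertices
  that a prime ideal misses form a maximal tail \<open>M\<close>.  Let \<open>I\<close> be the ideal generated by the vertices
  outside \<open>M\<close>.  The action of the algebra on functions on the boundary paths in \<open>M\<close> shows that \<open>I\<close>
  contains no vertex of \<open>M\<close>, and that a cycle without exit is transcendental modulo \<open>I\<close>.

  Suppose that every cycle in \<open>M\<close> has an exit.  An element outside \<open>I\<close> can be multiplied by paths so as
  to become \<open>k u\<close> plus a combination of closed paths at a vertex \<open>u\<close> of \<open>M\<close>.  Conjugation by a path that
  leaves one of the closed paths through an exit removes that closed path, and after finitely many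
  steps only a multiple of a vertex of \<open>M\<close> is left.  Hence \<open>I\<close> is the only prime in the stratum.

  Otherwise \<open>M\<close> has a cycle \<open>c\<close> without exit, at a vertex \<open>v\<close> say.  All vertices of \<open>M\<close> connect to \<open>v\<close>,
  and the corner at \<open>v\<close> is \<open>K[c, c\<^sup>-\<^sup>1]\<close> modulo \<open>I\<close>.  The stratum consists of the primes that contain \<open>I\<close>
  but not \<open>v\<close>, and these correspond to the primes of the corner.  Such a prime is primitive precisely
  if the image of the corner in the quotient is a field.

  If there are finitely many maximal tails, then \<open>M\<close> is the set of vertices that connect to a single
  boundary path.  The finitely supported functions on the paths tail equivalent to it form a simple
  module, whose annihilator lies in the stratum of \<open>M\<close>; this makes \<open>I\<close> primitive in the first case.
\<close>


section \<open>Prime and primitive ideals of rings with local units\<close>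

text \<open>Without an identity, finite sums of vertices serve as local units. They allow primeness
  to be tested on elements, as \<open>a R b \<subseteq> P\<close>, and they make ring ideals closed
  under scalars. Calculations with paths take place in the free algebra modulo preimages of ideals,
  so that one representative can be read modulo several ideals at once. The ideal \<open>I\<close>
  is an intersection of ideals, so what it omits has to be seen in a representation that kills the
  vertices outside \<open>M\<close>. On a periodic boundary path the cycle alone would act as the
  identity; an integer counter attached to the path keeps its powers independent. For the simple
  modules the counter is dropped again, since it would create proper submodules. A prime that misses
  the idempotent \<open>v\<close> is determined by its corner, because
  \<open>v a j b v \<in> P\<close> for all \<open>a\<close>, \<open>b\<close> forces
  \<open>j \<in> P\<close>. This is what matches primes of the algebra with primes of the corner. A
  maximal tail is directed, but a single path need not be cofinal in it. With finitely many tails, a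
  path can be started at a vertex that rules out every smaller tail.\<close>

lemma rng_ideal_subset: "rng_ideal I R \<Longrightarrow> I \<subseteq> carrier R"
  using additive_subgroup.a_subset rng_ideal.axioms(2) by blast

section \<open>Congruence modulo an ideal\<close>

context rng
begin

text \<open>Membership in the carrier is part of the relation, so chains of congruences carry their
  own closure facts.\<close>

definition cong_mod :: "'a set \<Rightarrow> 'a \<Rightarrow> 'a \<Rightarrow> bool" where
  "cong_mod I x y \<longleftrightarrow> x \<in> carrier R \<and> y \<in> carrier R \<and> x \<ominus> y \<in> I"

lemma minus_mult_left:
  "\<lbrakk>x \<in> carrier R; y \<in> carrier R\<rbrakk> \<Longrightarrow> \<ominus> x \<otimes> y = \<ominus> (x \<otimes> y)"
  by (rule minus_equality[symmetric]) (simp_all add: rng_l_distr[symmetric] l_neg m_zero rng_m_closed)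

lemma minus_mult_right:
  "\<lbrakk>x \<in> carrier R; y \<in> carrier R\<rbrakk> \<Longrightarrow> x \<otimes> \<ominus> y = \<ominus> (x \<otimes> y)"
  by (rule minus_equality[symmetric]) (simp_all add: rng_r_distr[symmetric] l_neg m_zero rng_m_closed)

lemma diff_distrib:
  "\<lbrakk>x \<in> carrier R; y \<in> carrier R; z \<in> carrier R\<rbrakk> \<Longrightarrow> (x \<ominus> y) \<otimes> z = x \<otimes> z \<ominus> y \<otimes> z"
  "\<lbrakk>x \<in> carrier R; y \<in> carrier R; z \<in> carrier R\<rbrakk> \<Longrightarrow> z \<otimes> (x \<ominus> y) = z \<otimes> x \<ominus> z \<otimes> y"
  by (simp_all add: a_minus_def rng_l_distr rng_r_distr minus_mult_left minus_mult_right)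

end

context rng_ideal
begin

lemma carr: "x \<in> I \<Longrightarrow> x \<in> carrier R"
  using a_subset by blast

lemma cong_refl: "x \<in> carrier R \<Longrightarrow> cong_mod I x x"
  by (simp add: cong_mod_def a_minus_def r_neg)

lemma cong_sym: "cong_mod I x y \<Longrightarrow> cong_mod I y x"
  using a_inv_closed[of "x \<ominus> y"] by (auto simp: cong_mod_def a_minus_def minus_add a_comm)

lemma cong_trans [trans]: "\<lbrakk>cong_mod I x y; cong_mod I y z\<rbrakk> \<Longrightarrow> cong_mod I x z"
proof -
  assume "cong_mod I x y" "cong_mod I y z"
  moreover from this have "x \<ominus> z = (x \<ominus> y) \<oplus> (y \<ominus> z)"
    by (auto simp: cong_mod_def a_minus_def a_ac r_neg1 r_neg2)
  ultimately show ?thesis by (simp add: cong_mod_def)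
qed

lemma cong_mem: "\<lbrakk>cong_mod I x y; y \<in> I\<rbrakk> \<Longrightarrow> x \<in> I"
proof -
  assume *: "cong_mod I x y" "y \<in> I"
  then have "x = (x \<ominus> y) \<oplus> y"
    using carr[of y] by (auto simp: cong_mod_def a_minus_def a_assoc l_neg)
  with * show ?thesis by (metis a_closed cong_mod_def)
qed

lemma cong_zero: "x \<in> I \<Longrightarrow> cong_mod I x \<zero>"
  by (simp add: cong_mod_def a_minus_def carr)

lemma cong_add: "\<lbrakk>cong_mod I x y; cong_mod I x' y'\<rbrakk> \<Longrightarrow> cong_mod I (x \<oplus> x') (y \<oplus> y')"
proof -
  assume "cong_mod I x y" "cong_mod I x' y'"
  moreover from this have "(x \<oplus> x') \<ominus> (y \<oplus> y') = (x \<ominus> y) \<oplus> (x' \<ominus> y')"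
    by (auto simp: cong_mod_def a_minus_def a_ac minus_add)
  ultimately show ?thesis by (simp add: cong_mod_def)
qed

lemma cong_uminus: "cong_mod I x y \<Longrightarrow> cong_mod I (\<ominus> x) (\<ominus> y)"
  using a_inv_closed[of "x \<ominus> y"] by (auto simp: cong_mod_def a_minus_def minus_add)

lemma cong_mult: "\<lbrakk>cong_mod I x y; cong_mod I x' y'\<rbrakk> \<Longrightarrow> cong_mod I (x \<otimes> x') (y \<otimes> y')"
proof -
  assume *: "cong_mod I x y" "cong_mod I x' y'"
  have "cong_mod I (x \<otimes> x') (y \<otimes> x')"
    using * rng_I_r_closed[of "x \<ominus> y" x'] by (auto simp: cong_mod_def diff_distrib rng_m_closed)
  moreover have "cong_mod I (y \<otimes> x') (y \<otimes> y')"
    using * rng_I_l_closed[of "x' \<ominus> y'" y] by (auto simp: cong_mod_def diff_distrib rng_m_closed)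
  ultimately show ?thesis by (rule cong_trans)
qed

end

lemma (in rng) cong_mod_mono: "I \<subseteq> J \<Longrightarrow> cong_mod I x y \<Longrightarrow> cong_mod J x y"
  by (auto simp: cong_mod_def)

text \<open>A substitute for the identity: it gives \<open>a \<in> a R\<close> and
  \<open>a \<in> R a\<close> for each element separately. In a Leavitt path algebra \<open>u\<close>
  is a finite sum of vertices.\<close>

locale locally_unital_rng = rng +
  assumes local_unit: "a \<in> carrier R \<Longrightarrow> \<exists>u\<in>carrier R. u \<otimes> a = a \<and> a \<otimes> u = a"
begin

text \<open>The middle factor \<open>r\<close> ranges over the whole ring, so a factor next to
  \<open>y\<close> on the side of \<open>r\<close> is absorbed by \<open>r\<close>, and one on the
  other side by \<open>P\<close>.\<close>

lemma ideal_residual: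
  assumes "rng_ideal P R" "S \<subseteq> carrier R"
  shows "rng_ideal {y \<in> carrier R. \<forall>a\<in>S. \<forall>r\<in>carrier R. a \<otimes> r \<otimes> y \<in> P} R"
    and "rng_ideal {y \<in> carrier R. \<forall>a\<in>S. \<forall>r\<in>carrier R. y \<otimes> r \<otimes> a \<in> P} R"
proof -
  interpret P: rng_ideal P R by fact
  have S: "a \<in> carrier R" if "a \<in> S" for a using that assms(2) by blast
  show "rng_ideal {y \<in> carrier R. \<forall>a\<in>S. \<forall>r\<in>carrier R. a \<otimes> r \<otimes> y \<in> P} R"
  proof (rule rng_idealI, goal_cases)
    case (5 y x)
    then show ?case
      using S by (auto simp: rng_m_closed) (metis rng_m_assoc rng_m_closed)
  next
    case (6 y x)
    then show ?case
      using S P.rng_I_r_closed by (auto simp: rng_m_closed) (metis rng_m_assoc rng_m_closed)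
  qed (use S in \<open>auto simp: m_zero rng_r_distr minus_mult_right rng_m_closed\<close>)
  show "rng_ideal {y \<in> carrier R. \<forall>a\<in>S. \<forall>r\<in>carrier R. y \<otimes> r \<otimes> a \<in> P} R"
  proof (rule rng_idealI, goal_cases)
    case (5 y x)
    then show ?case
      using S P.rng_I_l_closed by (auto simp: rng_m_closed) (metis rng_m_assoc rng_m_closed)
  next
    case (6 y x)
    then show ?case
      using S by (auto simp: rng_m_closed) (metis rng_m_assoc rng_m_closed)
  qed (use S in \<open>auto simp: m_zero rng_l_distr minus_mult_left rng_m_closed\<close>)
qed

text \<open>For the forward direction, \<open>J\<close> collects the \<open>y\<close> with
  \<open>a R y \<subseteq> P\<close> and \<open>I\<close> the \<open>y\<close> with
  \<open>y R J \<subseteq> P\<close>. Both are ideals with \<open>I J \<subseteq> P\<close>, while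
  \<open>a \<in> I\<close> and \<open>b \<in> J\<close>.\<close>

lemma prime_elementwise:
  "rng_prime_ideal P R \<longleftrightarrow> rng_ideal P R \<and> P \<noteq> carrier R \<and>
     (\<forall>a\<in>carrier R. \<forall>b\<in>carrier R. (\<forall>x\<in>carrier R. a \<otimes> x \<otimes> b \<in> P) \<longrightarrow> a \<in> P \<or> b \<in> P)"
proof
  assume P: "rng_prime_ideal P R"
  then have idl: "rng_ideal P R" by (simp add: rng_prime_ideal_def)
  interpret P: rng_ideal P R by fact
  have "a \<in> P \<or> b \<in> P" if ab: "a \<in> carrier R" "b \<in> carrier R" "\<forall>x\<in>carrier R. a \<otimes> x \<otimes> b \<in> P" for a b
  proof -
    define J where "J = {y \<in> carrier R. \<forall>a\<in>{a}. \<forall>r\<in>carrier R. a \<otimes> r \<otimes> y \<in> P}"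
    define I where "I = {y \<in> carrier R. \<forall>a\<in>J. \<forall>r\<in>carrier R. y \<otimes> r \<otimes> a \<in> P}"
    have J: "rng_ideal J R"
      unfolding J_def by (rule ideal_residual(1)[OF idl]) (use ab in auto)
    have I: "rng_ideal I R"
      unfolding I_def by (rule ideal_residual(2)[OF idl]) (use rng_ideal_subset[OF J] in auto)
    have "I \<cdot> J \<subseteq> P"
    proof
      fix x assume "x \<in> I \<cdot> J"
      then show "x \<in> P"
      proof induction
        case (prod i j)
        then have c: "i \<in> carrier R" "j \<in> carrier R"
          using rng_ideal_subset I J by blast+
        \<comment> \<open>\<open>I\<close> controls only products with a middle factor; writing
          \<open>i\<close> as \<open>i u\<close> supplies one.\<close>
        obtain u where u: "u \<in> carrier R" "i \<otimes> u = i"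
          using local_unit[OF c(1)] by blast
        then show ?case using prod unfolding I_def by force
      qed (rule P.a_closed)
    qed
    then have "I \<subseteq> P \<or> J \<subseteq> P"
      using P I J by (simp add: rng_prime_ideal_def)
    moreover have "b \<in> J" using ab by (simp add: J_def)
    moreover have "a \<in> I" using ab by (auto simp: I_def J_def)
    ultimately show ?thesis by blast
  qed
  then show "rng_ideal P R \<and> P \<noteq> carrier R \<and>
     (\<forall>a\<in>carrier R. \<forall>b\<in>carrier R. (\<forall>x\<in>carrier R. a \<otimes> x \<otimes> b \<in> P) \<longrightarrow> a \<in> P \<or> b \<in> P)"
    using P by (simp add: rng_prime_ideal_def)
next
  assume P: "rng_ideal P R \<and> P \<noteq> carrier R \<and>
     (\<forall>a\<in>carrier R. \<forall>b\<in>carrier R. (\<forall>x\<in>carrier R. a \<otimes> x \<otimes> b \<in> P) \<longrightarrow> a \<in> P \<or> b \<in> P)"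
  have "I \<subseteq> P \<or> J \<subseteq> P" if IJ: "rng_ideal I R" "rng_ideal J R" "I \<cdot> J \<subseteq> P" for I J
  proof (rule ccontr)
    assume "\<not> (I \<subseteq> P \<or> J \<subseteq> P)"
    then obtain a b where ab: "a \<in> I" "a \<notin> P" "b \<in> J" "b \<notin> P" by blast
    then have c: "a \<in> carrier R" "b \<in> carrier R"
      using rng_ideal_subset IJ by blast+
    have "a \<otimes> x \<otimes> b \<in> P" if "x \<in> carrier R" for x
      by (rule subsetD[OF IJ(3) ideal_prod.prod[OF rng_ideal.rng_I_r_closed[OF IJ(1) ab(1) that] ab(3)]])
    then show False
      using bspec[OF bspec[OF conjunct2[OF conjunct2[OF P]] c(1)] c(2)] ab by simp
  qed
  then show "rng_prime_ideal P R" using P by (simp add: rng_prime_ideal_def)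
qed

end

context right_rng_module
begin

lemma act_zero: "m \<in> carrier M \<Longrightarrow> act m \<zero>\<^bsub>R\<^esub> = \<zero>\<^bsub>M\<^esub>"
  using act_add_right[of m "\<zero>\<^bsub>R\<^esub>" "\<zero>\<^bsub>R\<^esub>"] act_closed[of m "\<zero>\<^bsub>R\<^esub>"] by simp

lemma zero_act: "a \<in> carrier R \<Longrightarrow> act \<zero>\<^bsub>M\<^esub> a = \<zero>\<^bsub>M\<^esub>"
  using act_add_left[of "\<zero>\<^bsub>M\<^esub>" "\<zero>\<^bsub>M\<^esub>" a] act_closed[of "\<zero>\<^bsub>M\<^esub>" a] by simp

lemma act_minus: "\<lbrakk>m \<in> carrier M; a \<in> carrier R\<rbrakk> \<Longrightarrow> act m (\<ominus>\<^bsub>R\<^esub> a) = \<ominus>\<^bsub>M\<^esub> act m a"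
  using act_add_right[of m "\<ominus>\<^bsub>R\<^esub> a" a]
  by (intro M.minus_equality[symmetric]) (simp_all add: act_zero act_closed R.l_neg)

text \<open>Simplicity gives this as soon as \<open>m R\<close> is a nonzero submodule; the
  hypothesis on \<open>u\<close> puts \<open>m\<close> itself into \<open>m R\<close>.\<close>

lemma simple_generated:
  assumes simple: "simple_right_module R M act"
    and m: "m \<in> carrier M" "m \<noteq> \<zero>\<^bsub>M\<^esub>" and u: "u \<in> carrier R" "act m u = m"
  shows "act m ` carrier R = carrier M"
proof -
  have "additive_subgroup (act m ` carrier R) M"
  proof (intro additive_subgroup.intro M.add.subgroupI)
    show "act m ` carrier R \<subseteq> carrier M" "act m ` carrier R \<noteq> {}"
      using act_closed[OF m(1)] u(1) by auto
    show "\<ominus>\<^bsub>M\<^esub> x \<in> act m ` carrier R" if "x \<in> act m ` carrier R" for x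
      using that by (auto simp: act_minus[OF m(1), symmetric])
    show "x \<oplus>\<^bsub>M\<^esub> y \<in> act m ` carrier R"
      if "x \<in> act m ` carrier R" "y \<in> act m ` carrier R" for x y
      using that by (auto simp: act_add_right[OF m(1), symmetric])
  qed
  moreover have "\<forall>n\<in>act m ` carrier R. \<forall>a\<in>carrier R. act n a \<in> act m ` carrier R"
    by (auto simp: act_assoc[OF m(1)] intro: R.rng_m_closed)
  moreover have "m \<in> act m ` carrier R" using u by (metis image_eqI)
  ultimately show ?thesis using simple m(2) unfolding simple_right_module_def by blast
qed

end

context locally_unital_rng
begin

text \<open>If \<open>m a \<noteq> 0\<close>, then \<open>m a R\<close> is the whole module, so
  \<open>a R b \<subseteq> P\<close> makes \<open>b\<close> annihilate everything.\<close>

lemma primitive_imp_prime: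
  assumes "primitive_ideal P R"
  shows "rng_prime_ideal P R"
proof -
  obtain M :: "'a set ring" and act where simple: "simple_right_module R M act"
    and P: "P = module_annihilator R M act"
    using assms unfolding primitive_ideal_def by blast
  interpret right_rng_module R M act
    using simple by (simp add: simple_right_module_def)
  have ideal: "rng_ideal P R"
    by (rule rng_idealI)
      (auto simp: P module_annihilator_def act_zero act_minus act_add_right act_closed rng_m_closed
        act_assoc[symmetric] zero_act)
  have proper: "P \<noteq> carrier R"
    using simple by (auto simp: P module_annihilator_def simple_right_module_def)
  have "a \<in> P \<or> b \<in> P" if ab: "a \<in> carrier R" "b \<in> carrier R" "\<forall>x\<in>carrier R. a \<otimes> x \<otimes> b \<in> P" for a b
  proof (rule ccontr)
    assume n: "\<not> (a \<in> P \<or> b \<in> P)"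
    then obtain m where m: "m \<in> carrier M" "act m a \<noteq> \<zero>\<^bsub>M\<^esub>"
      using ab by (auto simp: P module_annihilator_def)
    have ma: "act m a \<in> carrier M" using m ab act_closed by simp
    obtain u where u: "u \<in> carrier R" "a \<otimes> u = a" using local_unit[OF ab(1)] by blast
    have N: "act (act m a) ` carrier R = carrier M"
      using u m ab(1) by (intro simple_generated[OF simple ma m(2) u(1)]) (simp add: act_assoc)
    have "act k b = \<zero>\<^bsub>M\<^esub>" if "k \<in> carrier M" for k
    proof -
      have "k \<in> act (act m a) ` carrier R" using that by (simp only: N)
      then obtain x where x: "x \<in> carrier R" "k = act (act m a) x" by (elim imageE)
      then have "act k b = act m (a \<otimes> x \<otimes> b)"
        using m ab by (simp add: act_assoc act_closed rng_m_closed rng_m_assoc)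
      then show ?thesis using ab x m by (auto simp: P module_annihilator_def)
    qed
    then show False using n ab by (auto simp: P module_annihilator_def)
  qed
  with ideal proper show ?thesis by (simp add: prime_elementwise)
qed

text \<open>Zorn's lemma gives an ideal maximal among those that contain \<open>J\<close> and avoid
  \<open>v\<close>. If it contains \<open>a R b\<close> but neither factor, maximality forces first
  \<open>a R v\<close> and then \<open>v R v\<close> into it, and \<open>v = v v v\<close> is a
  contradiction.\<close>

lemma prime_avoiding_idempotent:
  assumes J: "rng_ideal J R" and v: "v \<in> carrier R" "v \<otimes> v = v" "v \<notin> J"
  shows "\<exists>P. rng_prime_ideal P R \<and> J \<subseteq> P \<and> v \<notin> P"
proof -
  define Z where "Z = {P. rng_ideal P R \<and> J \<subseteq> P \<and> v \<notin> P}"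
  have "\<exists>P\<in>Z. \<forall>X\<in>Z. P \<subseteq> X \<longrightarrow> X = P"
  proof (rule subset_Zorn_nonempty)
    show "Z \<noteq> {}" using J v by (auto simp: Z_def)
    fix C assume C: "C \<noteq> {}" "subset.chain Z C"
    then have CZ: "\<And>c. c \<in> C \<Longrightarrow> rng_ideal c R \<and> J \<subseteq> c \<and> v \<notin> c"
      and tot: "\<And>c d. c \<in> C \<Longrightarrow> d \<in> C \<Longrightarrow> c \<subseteq> d \<or> d \<subseteq> c"
      unfolding subset.chain_def Z_def by auto
    have sub: "additive_subgroup c R" if "c \<in> C" for c
      using CZ[OF that] rng_ideal.axioms(2) by blast
    have "rng_ideal (\<Union>C) R"
    proof (rule rng_idealI)
      show "\<Union>C \<subseteq> carrier R" using CZ rng_ideal_subset by blast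
      show "\<zero> \<in> \<Union>C" using C(1) additive_subgroup.zero_closed[OF sub] by blast
      show "x \<oplus> y \<in> \<Union>C" if "x \<in> \<Union>C" "y \<in> \<Union>C" for x y
      proof -
        obtain c d where cd: "c \<in> C" "x \<in> c" "d \<in> C" "y \<in> d" using \<open>x \<in> \<Union>C\<close> \<open>y \<in> \<Union>C\<close> by blast
        then consider "x \<in> d" | "y \<in> c" using tot[OF cd(1,3)] by blast
        then show ?thesis
          using cd by cases (auto intro: additive_subgroup.a_closed[OF sub])
      qed
      show "\<ominus> x \<in> \<Union>C" if "x \<in> \<Union>C" for x
        using that by (auto intro: additive_subgroup.a_inv_closed[OF sub])
      show "x \<otimes> a \<in> \<Union>C" "a \<otimes> x \<in> \<Union>C" if "a \<in> \<Union>C" "x \<in> carrier R" for a x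
        using that by (auto intro: rng_ideal.rng_I_l_closed[OF conjunct1[OF CZ]]
          rng_ideal.rng_I_r_closed[OF conjunct1[OF CZ]])
    qed
    then show "\<Union>C \<in> Z" using CZ C(1) by (auto simp: Z_def)
  qed
  then obtain P where PZ: "P \<in> Z" and PX: "\<forall>X\<in>Z. P \<subseteq> X \<longrightarrow> X = P" by (elim bexE)
  from PZ have P: "rng_ideal P R" "J \<subseteq> P" "v \<notin> P" by (simp_all add: Z_def)
  have max: "X = P" if "rng_ideal X R" "P \<subseteq> X" "v \<notin> X" for X
  proof -
    have "X \<in> Z" unfolding Z_def using that(1,3) order_trans[OF P(2) that(2)] by blast
    then show ?thesis using PX that(2) by blast
  qed
  interpret P: rng_ideal P R by (rule P(1))
  have "a \<in> P \<or> b \<in> P" if ab: "a \<in> carrier R" "b \<in> carrier R" "\<forall>x\<in>carrier R. a \<otimes> x \<otimes> b \<in> P" for a b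
  proof (rule ccontr)
    assume n: "\<not> (a \<in> P \<or> b \<in> P)"
    define X where "X = {y \<in> carrier R. \<forall>a\<in>{a}. \<forall>r\<in>carrier R. a \<otimes> r \<otimes> y \<in> P}"
    have "rng_ideal X R"
      unfolding X_def by (rule ideal_residual(1)[OF P(1)]) (use ab(1) in simp)
    moreover have "P \<subseteq> X"
      using ab(1) by (auto simp: X_def rng_m_closed P.carr intro: P.rng_I_l_closed)
    moreover have "b \<in> X" using ab by (simp add: X_def)
    ultimately have "v \<in> X" using max[of X] n by blast
    define Y where "Y = {y \<in> carrier R. \<forall>a\<in>{v}. \<forall>r\<in>carrier R. y \<otimes> r \<otimes> a \<in> P}"
    have "rng_ideal Y R"
      unfolding Y_def by (rule ideal_residual(2)[OF P(1)]) (use v(1) in simp)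
    moreover have "P \<subseteq> Y"
      using v(1) by (auto simp: Y_def P.carr intro!: P.rng_I_r_closed)
    moreover have "a \<in> Y" using \<open>v \<in> X\<close> ab by (auto simp: X_def Y_def)
    ultimately have "v \<in> Y" using max[of Y] n by blast
    then have "v \<otimes> v \<otimes> v \<in> P" using v(1) unfolding Y_def by blast
    then show False using v(2) P(3) by simp
  qed
  moreover have "P \<noteq> carrier R" using P v by blast
  ultimately have "rng_prime_ideal P R" using P(1) by (simp add: prime_elementwise)
  then show ?thesis using P(2,3) by blast
qed

end

lemma (in rng) closedin_zariski:
  "closedin (zariski R) C \<longleftrightarrow> (\<exists>I. rng_ideal I R \<and> C = {P \<in> Spec R. I \<subseteq> P})"
  and topspace_zariski: "topspace (zariski R) = Spec R"
proof -
  have top: "topspace (zariski R) = Spec R"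
  proof
    show "topspace (zariski R) \<subseteq> Spec R"
      using openin_zariski[of "topspace (zariski R)"] by auto
    have "rng_ideal P R \<and> P \<noteq> carrier R" if "P \<in> Spec R" for P
      using that by (simp add: Spec_def rng_prime_ideal_def)
    then have "Spec R - {P \<in> Spec R. carrier R \<subseteq> P} = Spec R"
      using rng_ideal_subset by blast
    then have "openin (zariski R) (Spec R)"
      unfolding openin_zariski using rng_ideal_carrier by blast
    then show "Spec R \<subseteq> topspace (zariski R)" by (rule openin_subset)
  qed
  show "topspace (zariski R) = Spec R" by (rule top)
  have *: "(C \<subseteq> Spec R \<and> Spec R - C = Spec R - {P \<in> Spec R. I \<subseteq> P}) \<longleftrightarrow> C = {P \<in> Spec R. I \<subseteq> P}" for I
    by blast
  have "closedin (zariski R) C \<longleftrightarrow>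
    (\<exists>I. rng_ideal I R \<and> (C \<subseteq> Spec R \<and> Spec R - C = Spec R - {P \<in> Spec R. I \<subseteq> P}))"
    unfolding closedin_def top openin_zariski by iprover
  then show "closedin (zariski R) C \<longleftrightarrow> (\<exists>I. rng_ideal I R \<and> C = {P \<in> Spec R. I \<subseteq> P})"
    by (simp only: *)
qed

section \<open>Primes that avoid an idempotent with commutative corner\<close>

text \<open>
  Modulo \<open>I\<close>, the corner \<open>v R v\<close> is a copy of the commutative ring \<open>A\<close>.
\<close>

locale commutative_corner =
  locally_unital_rng R + idl: rng_ideal I R + A: cring A
  for R :: "('a, 'b) ring_scheme" (structure) and I :: "'a set"
    and A :: "('c, 'd) ring_scheme" and v :: 'a and h :: "'c \<Rightarrow> 'a" +
  assumes v_closed: "v \<in> carrier R" and v_idem: "v \<otimes> v = v"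
    and h_closed: "f \<in> carrier A \<Longrightarrow> h f \<in> carrier R"
    and h_one: "h \<one>\<^bsub>A\<^esub> = v"
    and h_add: "\<lbrakk>f \<in> carrier A; g \<in> carrier A\<rbrakk> \<Longrightarrow> cong_mod I (h (f \<oplus>\<^bsub>A\<^esub> g)) (h f \<oplus> h g)"
    and h_mult: "\<lbrakk>f \<in> carrier A; g \<in> carrier A\<rbrakk> \<Longrightarrow> cong_mod I (h (f \<otimes>\<^bsub>A\<^esub> g)) (h f \<otimes> h g)"
    and h_surj: "x \<in> carrier R \<Longrightarrow> \<exists>f\<in>carrier A. cong_mod I (v \<otimes> x \<otimes> v) (h f)"
    and h_inj: "\<lbrakk>f \<in> carrier A; h f \<in> I\<rbrakk> \<Longrightarrow> f = \<zero>\<^bsub>A\<^esub>"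
begin

section \<open>Contraction of ideals to the corner and extension from it\<close>

definition corner_primes :: "'a set set" where
  "corner_primes = {P \<in> Spec R. I \<subseteq> P \<and> v \<notin> P}"

text \<open>\<open>J\<close> need not contain \<open>I\<close>, so this is the contraction of
  \<open>J + I\<close> rather than of \<open>J\<close>; for \<open>I \<subseteq> J\<close> it
  simplifies as in \<open>pull_eq\<close>.\<close>

definition pull :: "'a set \<Rightarrow> 'c set" where
  "pull J = {f \<in> carrier A. \<exists>j\<in>J. cong_mod I (h f) j}"

text \<open>The largest ideal whose corner at \<open>v\<close> lies in the image of \<open>Q\<close>
  modulo \<open>I\<close>; the factors \<open>a\<close> and \<open>b\<close> make it
  two-sided.\<close>

definition push :: "'c set \<Rightarrow> 'a set" where
  "push Q = {r \<in> carrier R. \<forall>a\<in>carrier R. \<forall>b\<in>carrier R. \<exists>q\<in>Q. cong_mod I (v \<otimes> (a \<otimes> r \<otimes> b) \<otimes> v) (h q)}"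

lemma corner_primesD:
  assumes "P \<in> corner_primes"
  shows "rng_ideal P R" "P \<in> Spec R" "I \<subseteq> P" "v \<notin> P"
    and "\<lbrakk>a \<in> carrier R; b \<in> carrier R; \<And>x. x \<in> carrier R \<Longrightarrow> a \<otimes> x \<otimes> b \<in> P\<rbrakk> \<Longrightarrow> a \<in> P \<or> b \<in> P"
proof -
  show "P \<in> Spec R" "I \<subseteq> P" "v \<notin> P" using assms by (simp_all add: corner_primes_def)
  then have *: "rng_prime_ideal P R" by (simp add: Spec_def)
  then show "rng_ideal P R" by (simp add: rng_prime_ideal_def)
  show "a \<in> P \<or> b \<in> P"
    if "a \<in> carrier R" "b \<in> carrier R" "\<And>x. x \<in> carrier R \<Longrightarrow> a \<otimes> x \<otimes> b \<in> P"
    using * that by (simp add: prime_elementwise)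
qed

lemma cong_mem_super:
  "\<lbrakk>rng_ideal P R; I \<subseteq> P; cong_mod I x y; y \<in> P\<rbrakk> \<Longrightarrow> x \<in> P"
  by (rule rng_ideal.cong_mem[OF _ cong_mod_mono])

lemma h_corner:
  assumes "f \<in> carrier A"
  shows "cong_mod I (v \<otimes> h f) (h f)" "cong_mod I (h f \<otimes> v) (h f)"
  using h_mult[THEN idl.cong_sym, of "\<one>\<^bsub>A\<^esub>" f] h_mult[THEN idl.cong_sym, of f "\<one>\<^bsub>A\<^esub>"] assms
  by (simp_all add: h_one)

lemma h_zero: "cong_mod I (h \<zero>\<^bsub>A\<^esub>) \<zero>"
proof -
  have c: "h \<zero>\<^bsub>A\<^esub> \<in> carrier R" using h_closed by simp
  have "cong_mod I (\<ominus> h \<zero>\<^bsub>A\<^esub> \<oplus> h \<zero>\<^bsub>A\<^esub>) (\<ominus> h \<zero>\<^bsub>A\<^esub> \<oplus> (h \<zero>\<^bsub>A\<^esub> \<oplus> h \<zero>\<^bsub>A\<^esub>))"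
    using h_add[of "\<zero>\<^bsub>A\<^esub>" "\<zero>\<^bsub>A\<^esub>"] c by (intro idl.cong_add idl.cong_refl) simp_all
  then show ?thesis using c by (intro idl.cong_sym[of \<zero>]) (simp add: l_neg r_neg1)
qed

lemma h_uminus:
  assumes f: "f \<in> carrier A"
  shows "cong_mod I (h (\<ominus>\<^bsub>A\<^esub> f)) (\<ominus> h f)"
proof -
  have c: "h f \<in> carrier R" "h (\<ominus>\<^bsub>A\<^esub> f) \<in> carrier R" using h_closed f by simp_all
  have "cong_mod I (h (\<ominus>\<^bsub>A\<^esub> f) \<oplus> h f) (h \<zero>\<^bsub>A\<^esub>)"
    using h_add[of "\<ominus>\<^bsub>A\<^esub> f" f] f by (intro idl.cong_sym[of "h \<zero>\<^bsub>A\<^esub>"]) (simp add: A.l_neg)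
  also note h_zero
  finally have "cong_mod I (h (\<ominus>\<^bsub>A\<^esub> f) \<oplus> h f \<oplus> \<ominus> h f) (\<zero> \<oplus> \<ominus> h f)"
    using c by (intro idl.cong_add idl.cong_refl) simp_all
  then show ?thesis using c by (simp add: a_assoc r_neg)
qed

lemma pull_ideal:
  assumes "rng_ideal J R"
  shows "rng_ideal (pull J) A"
proof -
  interpret J: rng_ideal J R by fact
  show ?thesis
  proof (rule rng.rng_idealI[OF A.rng])
    show "pull J \<subseteq> carrier A" by (auto simp: pull_def)
    show "\<zero>\<^bsub>A\<^esub> \<in> pull J" using h_zero J.zero_closed by (auto simp: pull_def)
    fix f assume "f \<in> pull J"
    then obtain j where f: "f \<in> carrier A" "j \<in> J" "cong_mod I (h f) j" by (auto simp: pull_def)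
    show "\<ominus>\<^bsub>A\<^esub> f \<in> pull J"
      using f idl.cong_trans[OF h_uminus[OF f(1)] idl.cong_uminus[OF f(3)]] J.a_inv_closed[OF f(2)]
      by (auto simp: pull_def)
    { fix g assume "g \<in> pull J"
      then obtain k where g: "g \<in> carrier A" "k \<in> J" "cong_mod I (h g) k" by (auto simp: pull_def)
      show "f \<oplus>\<^bsub>A\<^esub> g \<in> pull J"
        using f g idl.cong_trans[OF h_add[OF f(1) g(1)] idl.cong_add[OF f(3) g(3)]]
          J.a_closed[OF f(2) g(2)] by (auto simp: pull_def)
    }
    fix g assume g: "g \<in> carrier A"
    have "cong_mod I (h (g \<otimes>\<^bsub>A\<^esub> f)) (h g \<otimes> j)"
      using idl.cong_trans[OF h_mult[OF g f(1)] idl.cong_mult[OF idl.cong_refl[OF h_closed[OF g]] f(3)]] .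
    moreover have "h g \<otimes> j \<in> J"
      using J.rng_I_l_closed[OF f(2) h_closed[OF g]] .
    ultimately show *: "g \<otimes>\<^bsub>A\<^esub> f \<in> pull J"
      using f(1) g by (auto simp: pull_def)
    then show "f \<otimes>\<^bsub>A\<^esub> g \<in> pull J" using f(1) g by (simp add: A.m_comm)
  qed
qed

lemma pull_eq:
  assumes "rng_ideal P R" "I \<subseteq> P"
  shows "pull P = {f \<in> carrier A. h f \<in> P}"
proof -
  have "cong_mod I (h f) (h f)" if "f \<in> carrier A" for f
    using h_closed[OF that] by (rule idl.cong_refl)
  then show ?thesis using cong_mem_super[OF assms] unfolding pull_def by blast
qed

text \<open>Ideals are compared with \<open>P\<close> through their corners: if
  \<open>v a j b v \<in> P\<close> for all \<open>a\<close> and \<open>b\<close>, primeness removes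
  first the right \<open>v\<close> and then the left one, because \<open>v \<notin> P\<close>. Hence
  \<open>pull\<close> is injective on these primes and maps closed sets to closed sets.\<close>

lemma pull_subset_iff:
  assumes J: "rng_ideal J R" and P: "P \<in> corner_primes"
  shows "pull J \<subseteq> pull P \<longleftrightarrow> J \<subseteq> P"
proof
  show "pull J \<subseteq> pull P" if "J \<subseteq> P" using that by (auto simp: pull_def)
next
  assume sub: "pull J \<subseteq> pull P"
  note P' = corner_primesD[OF P]
  have *: "v \<otimes> x \<otimes> v \<in> P" if x: "x \<in> J" for x
  proof -
    have xc: "x \<in> carrier R" using x rng_ideal_subset[OF J] by blast
    obtain f where f: "f \<in> carrier A" "cong_mod I (v \<otimes> x \<otimes> v) (h f)"
      using h_surj[OF xc] by blast
    have "v \<otimes> x \<otimes> v \<in> J"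
      using x v_closed by (intro rng_ideal.rng_I_r_closed[OF J] rng_ideal.rng_I_l_closed[OF J])
    then have "f \<in> pull J" using f idl.cong_sym by (auto simp: pull_def)
    then have "h f \<in> P" using sub pull_eq[OF P'(1,3)] by blast
    then show ?thesis using cong_mem_super[OF P'(1,3) f(2)] by blast
  qed
  show "J \<subseteq> P"
  proof
    fix j assume j: "j \<in> J"
    then have jc: "j \<in> carrier R" using rng_ideal_subset[OF J] by blast
    have "v \<otimes> a \<otimes> j \<in> P" if a: "a \<in> carrier R" for a
    proof -
      have "v \<otimes> (a \<otimes> j \<otimes> b) \<otimes> v \<in> P" if "b \<in> carrier R" for b
        using j a that
        by (intro * rng_ideal.rng_I_r_closed[OF J] rng_ideal.rng_I_l_closed[OF J])
      then have "(v \<otimes> a \<otimes> j) \<otimes> b \<otimes> v \<in> P" if "b \<in> carrier R" for b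
        using that a jc v_closed by (simp add: rng_m_assoc rng_m_closed)
      then show ?thesis
        using P'(4) P'(5)[of "v \<otimes> a \<otimes> j" v] a jc v_closed by (simp add: rng_m_closed)
    qed
    then show "j \<in> P" using P'(4) P'(5)[OF v_closed jc] by blast
  qed
qed

lemma corner_comm:
  assumes "x \<in> carrier R" "y \<in> carrier R"
  shows "cong_mod I ((v \<otimes> x \<otimes> v) \<otimes> (v \<otimes> y \<otimes> v)) ((v \<otimes> y \<otimes> v) \<otimes> (v \<otimes> x \<otimes> v))"
proof -
  obtain f where f: "f \<in> carrier A" "cong_mod I (v \<otimes> x \<otimes> v) (h f)" using h_surj assms by blast
  obtain g where g: "g \<in> carrier A" "cong_mod I (v \<otimes> y \<otimes> v) (h g)" using h_surj assms by blast
  have "cong_mod I ((v \<otimes> x \<otimes> v) \<otimes> (v \<otimes> y \<otimes> v)) (h f \<otimes> h g)"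
    using f g by (intro idl.cong_mult)
  also have "cong_mod I (h f \<otimes> h g) (h (f \<otimes>\<^bsub>A\<^esub> g))" using h_mult f g idl.cong_sym by blast
  also have "h (f \<otimes>\<^bsub>A\<^esub> g) = h (g \<otimes>\<^bsub>A\<^esub> f)" using f g by (simp add: A.m_comm)
  also have "cong_mod I (h (g \<otimes>\<^bsub>A\<^esub> f)) (h g \<otimes> h f)" using h_mult f g by blast
  also have "cong_mod I (h g \<otimes> h f) ((v \<otimes> y \<otimes> v) \<otimes> (v \<otimes> x \<otimes> v))"
    by (rule idl.cong_mult[OF idl.cong_sym[OF g(2)] idl.cong_sym[OF f(2)]])
  finally show ?thesis .
qed

text \<open>Only \<open>h f h g \<in> P\<close> is given, while primeness of \<open>P\<close> speaks
  of \<open>h f x h g\<close> for all \<open>x\<close>. The middle factor may be replaced by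
  \<open>v x v\<close>, which is some \<open>h k\<close> modulo \<open>I\<close>, and commutativity
  of \<open>A\<close> moves it to the front.\<close>

lemma pull_prime:
  assumes P: "P \<in> corner_primes"
  shows "pull P \<in> Spec A"
proof -
  note P' = corner_primesD[OF P]
  note eq = pull_eq[OF P'(1,3)]
  have "primeideal (pull P) A"
  proof (rule primeidealI)
    show "ideal (pull P) A" using pull_ideal[OF P'(1)] A.rng_ideal_iff_ideal by blast
    show "cring A" by (rule A.cring_axioms)
    have "\<one>\<^bsub>A\<^esub> \<notin> pull P" using P'(4) by (simp add: eq h_one)
    then show "carrier A \<noteq> pull P" using A.one_closed by blast
    fix f g assume fg: "f \<in> carrier A" "g \<in> carrier A" "f \<otimes>\<^bsub>A\<^esub> g \<in> pull P"
    have mem: "h f \<otimes> h g \<in> P"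
      using cong_mem_super[OF P'(1,3) idl.cong_sym[OF h_mult[OF fg(1,2)]]] fg(3) by (simp add: eq)
    have "h f \<otimes> x \<otimes> h g \<in> P" if x: "x \<in> carrier R" for x
    proof -
      obtain k where k: "k \<in> carrier A" "cong_mod I (v \<otimes> x \<otimes> v) (h k)" using h_surj x by blast
      note c = h_closed[OF fg(1)] h_closed[OF fg(2)] h_closed[OF k(1)]
      have "cong_mod I (h f \<otimes> x \<otimes> h g) ((h f \<otimes> v) \<otimes> x \<otimes> (v \<otimes> h g))"
        using c x by (intro idl.cong_mult idl.cong_sym[OF h_corner(2)] idl.cong_sym[OF h_corner(1)]
            idl.cong_refl fg)
      also have "\<dots> = h f \<otimes> (v \<otimes> x \<otimes> v) \<otimes> h g"
        using c x v_closed by (simp add: rng_m_assoc rng_m_closed)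
      also have "cong_mod I (h f \<otimes> (v \<otimes> x \<otimes> v) \<otimes> h g) (h f \<otimes> h k \<otimes> h g)"
        using c k by (intro idl.cong_mult idl.cong_refl)
      also have "cong_mod I (h f \<otimes> h k \<otimes> h g) (h (f \<otimes>\<^bsub>A\<^esub> k) \<otimes> h g)"
        using c k fg by (intro idl.cong_mult idl.cong_refl idl.cong_sym[OF h_mult])
      also have "h (f \<otimes>\<^bsub>A\<^esub> k) \<otimes> h g = h (k \<otimes>\<^bsub>A\<^esub> f) \<otimes> h g" using k fg by (simp add: A.m_comm)
      also have "cong_mod I (h (k \<otimes>\<^bsub>A\<^esub> f) \<otimes> h g) (h k \<otimes> h f \<otimes> h g)"
        using c k fg by (intro idl.cong_mult idl.cong_refl h_mult)
      also have "h k \<otimes> h f \<otimes> h g = h k \<otimes> (h f \<otimes> h g)" using c by (simp add: rng_m_assoc)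
      finally show ?thesis
        using cong_mem_super[OF P'(1,3)] rng_ideal.rng_I_l_closed[OF P'(1) mem c(3)] by blast
    qed
    then show "f \<in> pull P \<or> g \<in> pull P"
      using P'(5)[OF h_closed[OF fg(1)] h_closed[OF fg(2)]] fg by (simp add: eq)
  qed
  then show ?thesis by (simp add: A.Spec_eq_primeideals)
qed

text \<open>The factors \<open>a\<close> and \<open>b\<close> already absorb multiplication, so an
  additive subgroup \<open>T\<close> is enough. It is applied to the image of an ideal of
  \<open>A\<close>, and to the multiples of a corner element modulo a prime.\<close>

lemma corner_ideal:
  assumes T: "additive_subgroup T R"
  shows "rng_ideal {y \<in> carrier R. \<forall>a\<in>carrier R. \<forall>b\<in>carrier R. v \<otimes> (a \<otimes> y \<otimes> b) \<otimes> v \<in> T} R"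
proof (rule rng_idealI, goal_cases)
  case 2
  then show ?case
    using v_closed additive_subgroup.zero_closed[OF T] by (simp add: m_zero)
next
  case (3 x y)
  then show ?case
    using v_closed by (simp add: rng_l_distr rng_r_distr rng_m_closed additive_subgroup.a_closed[OF T])
next
  case (4 x)
  then show ?case
    using v_closed by (simp add: minus_mult_left minus_mult_right rng_m_closed additive_subgroup.a_inv_closed[OF T])
next
  case (5 y z)
  then have "a \<otimes> (z \<otimes> y) \<otimes> b = (a \<otimes> z) \<otimes> y \<otimes> b" if "a \<in> carrier R" "b \<in> carrier R" for a b
    using that by (simp add: rng_m_assoc rng_m_closed)
  then show ?case using 5 by (simp add: rng_m_closed)
next
  case (6 y z)
  then have "a \<otimes> (y \<otimes> z) \<otimes> b = a \<otimes> y \<otimes> (z \<otimes> b)" if "a \<in> carrier R" "b \<in> carrier R" for a b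
    using that by (simp add: rng_m_assoc rng_m_closed)
  then show ?case using 6 by (simp add: rng_m_closed)
qed blast

lemma push_ideal:
  assumes "ideal Q A"
  shows "rng_ideal (push Q) R" "I \<subseteq> push Q"
proof -
  interpret Q: ideal Q A by fact
  have qc: "q \<in> Q \<Longrightarrow> q \<in> carrier A" for q by (rule Q.Icarr)
  show "I \<subseteq> push Q"
  proof
    fix i assume i: "i \<in> I"
    have "v \<otimes> (a \<otimes> i \<otimes> b) \<otimes> v \<in> I" if "a \<in> carrier R" "b \<in> carrier R" for a b
      using i that v_closed by (intro idl.rng_I_r_closed idl.rng_I_l_closed)
    then have "cong_mod I (v \<otimes> (a \<otimes> i \<otimes> b) \<otimes> v) (h \<zero>\<^bsub>A\<^esub>)"
      if "a \<in> carrier R" "b \<in> carrier R" for a b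
      using that idl.cong_trans[OF idl.cong_zero idl.cong_sym[OF h_zero]] by blast
    then show "i \<in> push Q" using Q.zero_closed idl.carr[OF i] unfolding push_def by blast
  qed
  have "additive_subgroup {x. \<exists>q\<in>Q. cong_mod I x (h q)} R"
  proof (intro additive_subgroup.intro add.subgroupI)
    show "{x. \<exists>q\<in>Q. cong_mod I x (h q)} \<subseteq> carrier R" by (auto simp: cong_mod_def)
    show "{x. \<exists>q\<in>Q. cong_mod I x (h q)} \<noteq> {}"
      using idl.cong_sym[OF h_zero] Q.zero_closed by blast
  next
    fix x assume "x \<in> {x. \<exists>q\<in>Q. cong_mod I x (h q)}"
    then obtain q where q: "q \<in> Q" "cong_mod I x (h q)" by blast
    have "cong_mod I (\<ominus> x) (h (\<ominus>\<^bsub>A\<^esub> q))"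
      by (rule idl.cong_trans[OF idl.cong_uminus[OF q(2)] idl.cong_sym[OF h_uminus[OF qc[OF q(1)]]]])
    then show "\<ominus> x \<in> {x. \<exists>q\<in>Q. cong_mod I x (h q)}"
      using Q.a_inv_closed[OF q(1)] by blast
    fix y assume "y \<in> {x. \<exists>q\<in>Q. cong_mod I x (h q)}"
    then obtain p where p: "p \<in> Q" "cong_mod I y (h p)" by blast
    have "cong_mod I (x \<oplus> y) (h (q \<oplus>\<^bsub>A\<^esub> p))"
      by (rule idl.cong_trans[OF idl.cong_add[OF q(2) p(2)] idl.cong_sym[OF h_add[OF qc[OF q(1)] qc[OF p(1)]]]])
    then show "x \<oplus> y \<in> {x. \<exists>q\<in>Q. cong_mod I x (h q)}"
      using Q.a_closed[OF q(1) p(1)] by blast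
  qed
  from corner_ideal[OF this] show "rng_ideal (push Q) R"
    by (simp add: push_def)
qed

lemma h_cong_inj:
  assumes "f \<in> carrier A" "g \<in> carrier A" "cong_mod I (h f) (h g)"
  shows "f = g"
proof -
  have "cong_mod I (h (f \<oplus>\<^bsub>A\<^esub> \<ominus>\<^bsub>A\<^esub> g)) (h f \<oplus> h (\<ominus>\<^bsub>A\<^esub> g))" using h_add assms by simp
  also have "cong_mod I (h f \<oplus> h (\<ominus>\<^bsub>A\<^esub> g)) (h g \<oplus> \<ominus> h g)"
    using assms by (intro idl.cong_add h_uminus)
  also have "h g \<oplus> \<ominus> h g = \<zero>" using h_closed assms by (simp add: r_neg)
  finally have "h (f \<oplus>\<^bsub>A\<^esub> \<ominus>\<^bsub>A\<^esub> g) \<in> I" using idl.cong_mem idl.zero_closed by blast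
  then have "f \<oplus>\<^bsub>A\<^esub> \<ominus>\<^bsub>A\<^esub> g = \<zero>\<^bsub>A\<^esub>" using h_inj assms by simp
  then show ?thesis using A.minus_equality[of f "\<ominus>\<^bsub>A\<^esub> g"] assms by simp
qed

text \<open>The corner of \<open>push Q\<close> is no larger than \<open>Q\<close> because
  \<open>h\<close> is injective modulo \<open>I\<close>. It is no smaller because
  \<open>v a (h f) b v\<close> agrees with \<open>h\<close> of \<open>k f l\<close> modulo
  \<open>I\<close>, where \<open>k\<close> and \<open>l\<close> represent \<open>v a v\<close> and
  \<open>v b v\<close>.\<close>

lemma h_mem_push_iff:
  assumes Q: "ideal Q A" and f: "f \<in> carrier A"
  shows "h f \<in> push Q \<longleftrightarrow> f \<in> Q"
proof
  interpret Q: ideal Q A by fact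
  assume "h f \<in> push Q"
  then obtain q where q: "q \<in> Q" "cong_mod I (v \<otimes> (v \<otimes> h f \<otimes> v) \<otimes> v) (h q)"
    using v_closed by (auto simp: push_def)
  have "v \<otimes> (v \<otimes> h f \<otimes> v) \<otimes> v = (v \<otimes> v) \<otimes> h f \<otimes> (v \<otimes> v)"
    using v_closed h_closed[OF f] by (simp add: rng_m_assoc rng_m_closed del: v_idem)
  also have "\<dots> = v \<otimes> h f \<otimes> v" by (simp add: v_idem)
  finally have "cong_mod I (v \<otimes> h f \<otimes> v) (h q)" using q by simp
  moreover have "cong_mod I (v \<otimes> h f \<otimes> v) (h f)"
    using idl.cong_trans[OF idl.cong_mult[OF h_corner(1)[OF f] idl.cong_refl[OF v_closed]] h_corner(2)[OF f]] .
  ultimately have "f = q" using h_cong_inj f Q.Icarr[OF q(1)] idl.cong_sym idl.cong_trans by blast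
  then show "f \<in> Q" using q by simp
next
  interpret Q: ideal Q A by fact
  assume fQ: "f \<in> Q"
  have "\<exists>q\<in>Q. cong_mod I (v \<otimes> (a \<otimes> h f \<otimes> b) \<otimes> v) (h q)"
    if ab: "a \<in> carrier R" "b \<in> carrier R" for a b
  proof -
    obtain k where k: "k \<in> carrier A" "cong_mod I (v \<otimes> a \<otimes> v) (h k)" using h_surj ab by blast
    obtain l where l: "l \<in> carrier A" "cong_mod I (v \<otimes> b \<otimes> v) (h l)" using h_surj ab by blast
    note c = h_closed[OF f] h_closed[OF k(1)] h_closed[OF l(1)]
    have "v \<otimes> (a \<otimes> h f \<otimes> b) \<otimes> v = (v \<otimes> a) \<otimes> h f \<otimes> (b \<otimes> v)"
      using c ab v_closed by (simp add: rng_m_assoc rng_m_closed)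
    also have "cong_mod I \<dots> ((v \<otimes> a) \<otimes> (v \<otimes> (h f \<otimes> v)) \<otimes> (b \<otimes> v))"
    proof (intro idl.cong_mult idl.cong_refl)
      show "cong_mod I (h f) (v \<otimes> (h f \<otimes> v))"
        using idl.cong_sym[OF idl.cong_trans[OF idl.cong_mult[OF idl.cong_refl[OF v_closed]
              h_corner(2)[OF f]] h_corner(1)[OF f]]] .
    qed (use ab v_closed in \<open>auto intro: rng_m_closed\<close>)
    also have "\<dots> = (v \<otimes> a \<otimes> v) \<otimes> h f \<otimes> (v \<otimes> b \<otimes> v)"
      using c ab v_closed by (simp add: rng_m_assoc rng_m_closed)
    also have "cong_mod I \<dots> (h k \<otimes> h f \<otimes> h l)"
      using c k l by (intro idl.cong_mult idl.cong_refl)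
    also have "cong_mod I (h k \<otimes> h f \<otimes> h l) (h (k \<otimes>\<^bsub>A\<^esub> f) \<otimes> h l)"
      using c k l f by (intro idl.cong_mult idl.cong_refl idl.cong_sym[OF h_mult])
    also have "cong_mod I (h (k \<otimes>\<^bsub>A\<^esub> f) \<otimes> h l) (h (k \<otimes>\<^bsub>A\<^esub> f \<otimes>\<^bsub>A\<^esub> l))"
      using k l f by (intro idl.cong_sym[OF h_mult]) simp_all
    finally show ?thesis using Q.I_l_closed[OF fQ k(1)] Q.I_r_closed[OF _ l(1)] by blast
  qed
  then show "h f \<in> push Q" using h_closed[OF f] by (simp add: push_def)
qed

text \<open>If \<open>a\<close> and \<open>b\<close> lie outside, some \<open>v x a y v\<close> and
  \<open>v z b w v\<close> represent elements outside the prime \<open>Q\<close>. So does their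
  product, although it is a multiple of \<open>a (y v v z) b\<close>.\<close>

lemma push_prime:
  assumes Q: "Q \<in> Spec A"
  shows "push Q \<in> corner_primes" "pull (push Q) = Q"
proof -
  have Q': "primeideal Q A" using Q by (simp add: A.Spec_eq_primeideals)
  interpret Q: primeideal Q A by fact
  note mem = h_mem_push_iff[OF Q.is_ideal]
  note idl' = push_ideal[OF Q.is_ideal]
  show "pull (push Q) = Q"
    using mem Q.Icarr by (auto simp: pull_eq[OF idl'])
  have "\<one>\<^bsub>A\<^esub> \<notin> Q" using Q.I_notcarr Q.one_imp_carrier by blast
  then have v: "v \<notin> push Q" using mem[of "\<one>\<^bsub>A\<^esub>"] by (simp add: h_one)
  have "a \<in> push Q \<or> b \<in> push Q"
    if ab: "a \<in> carrier R" "b \<in> carrier R" "\<forall>x\<in>carrier R. a \<otimes> x \<otimes> b \<in> push Q" for a b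
  proof (rule ccontr)
    assume n: "\<not> (a \<in> push Q \<or> b \<in> push Q)"
    obtain x y where xy: "x \<in> carrier R" "y \<in> carrier R"
      "\<And>q. q \<in> Q \<Longrightarrow> \<not> cong_mod I (v \<otimes> (x \<otimes> a \<otimes> y) \<otimes> v) (h q)"
      using n ab(1) unfolding push_def by blast
    obtain z w where zw: "z \<in> carrier R" "w \<in> carrier R"
      "\<And>q. q \<in> Q \<Longrightarrow> \<not> cong_mod I (v \<otimes> (z \<otimes> b \<otimes> w) \<otimes> v) (h q)"
      using n ab(2) unfolding push_def by blast
    obtain f where f: "f \<in> carrier A" "cong_mod I (v \<otimes> (x \<otimes> a \<otimes> y) \<otimes> v) (h f)"
      using h_surj xy ab by (meson rng_m_closed)
    obtain g where g: "g \<in> carrier A" "cong_mod I (v \<otimes> (z \<otimes> b \<otimes> w) \<otimes> v) (h g)"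
      using h_surj zw ab by (meson rng_m_closed)
    have "f \<notin> Q" "g \<notin> Q" using f g xy zw by blast+
    then have nQ: "f \<otimes>\<^bsub>A\<^esub> g \<notin> Q" using Q.I_prime[OF f(1) g(1)] by blast
    have "cong_mod I (h (f \<otimes>\<^bsub>A\<^esub> g)) (h f \<otimes> h g)" using f g h_mult by blast
    also have "cong_mod I (h f \<otimes> h g) ((v \<otimes> (x \<otimes> a \<otimes> y) \<otimes> v) \<otimes> (v \<otimes> (z \<otimes> b \<otimes> w) \<otimes> v))"
      by (rule idl.cong_mult[OF idl.cong_sym[OF f(2)] idl.cong_sym[OF g(2)]])
    also have "\<dots> = (v \<otimes> x) \<otimes> (a \<otimes> ((y \<otimes> v) \<otimes> (v \<otimes> z)) \<otimes> b) \<otimes> (w \<otimes> v)"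
    proof -
      have "v \<otimes> (r \<otimes> s \<otimes> t) \<otimes> v = (v \<otimes> r) \<otimes> s \<otimes> (t \<otimes> v)"
        if "r \<in> carrier R" "s \<in> carrier R" "t \<in> carrier R" for r s t
        using that v_closed by (simp add: rng_m_assoc rng_m_closed)
      moreover have "(p \<otimes> a \<otimes> q) \<otimes> (r \<otimes> b \<otimes> s) = p \<otimes> (a \<otimes> (q \<otimes> r) \<otimes> b) \<otimes> s"
        if "p \<in> carrier R" "q \<in> carrier R" "r \<in> carrier R" "s \<in> carrier R" for p q r s
        using that ab(1,2) by (simp add: rng_m_assoc rng_m_closed)
      ultimately show ?thesis using ab(1,2) xy(1,2) zw(1,2) v_closed by (simp add: rng_m_closed)
    qed
    finally have *: "cong_mod I (h (f \<otimes>\<^bsub>A\<^esub> g))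
      ((v \<otimes> x) \<otimes> (a \<otimes> ((y \<otimes> v) \<otimes> (v \<otimes> z)) \<otimes> b) \<otimes> (w \<otimes> v))" .
    have "(v \<otimes> x) \<otimes> (a \<otimes> ((y \<otimes> v) \<otimes> (v \<otimes> z)) \<otimes> b) \<otimes> (w \<otimes> v) \<in> push Q"
      by (intro rng_ideal.rng_I_r_closed[OF idl'(1)] rng_ideal.rng_I_l_closed[OF idl'(1)]
        bspec[OF ab(3)] rng_m_closed xy(1,2) zw(1,2) v_closed)
    then have "h (f \<otimes>\<^bsub>A\<^esub> g) \<in> push Q" using cong_mem_super[OF idl' *] by blast
    then show False using mem f g nQ by simp
  qed
  moreover have "push Q \<noteq> carrier R" using v v_closed by blast
  ultimately have "rng_prime_ideal (push Q) R" using idl'(1) by (simp add: prime_elementwise)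
  then show "push Q \<in> corner_primes" using idl'(2) v by (simp add: corner_primes_def Spec_def)
qed

theorem corner_homeomorphic:
  "subtopology (zariski R) corner_primes homeomorphic_space zariski A"
proof -
  have A_rng: "rng A" by (rule A.rng)
  have sub: "corner_primes \<subseteq> Spec R" by (auto simp: corner_primes_def)
  then have top: "topspace (subtopology (zariski R) corner_primes) = corner_primes"
    by (auto simp: topspace_zariski)
  have inj: "inj_on pull corner_primes"
  proof (rule inj_onI)
    fix P P' assume P: "P \<in> corner_primes" "P' \<in> corner_primes" "pull P = pull P'"
    then have "P \<subseteq> P'" "P' \<subseteq> P"
      using pull_subset_iff[OF corner_primesD(1)] by blast+
    then show "P = P'" by blast
  qed
  have im: "pull ` corner_primes = Spec A"
    using pull_prime push_prime by (metis (no_types, lifting) image_eqI image_subsetI subsetI subset_antisym)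
  have "homeomorphic_map (subtopology (zariski R) corner_primes) (zariski A) pull"
  proof (rule bijective_closed_imp_homeomorphic_map)
    show "continuous_map (subtopology (zariski R) corner_primes) (zariski A) pull"
      unfolding continuous_map_closedin top
    proof (intro conjI allI impI)
      show "pull \<in> corner_primes \<rightarrow> topspace (zariski A)"
        using im by (auto simp: rng.topspace_zariski[OF A_rng])
      fix C assume "closedin (zariski A) C"
      then obtain J where J: "rng_ideal J A" "C = {Q \<in> Spec A. J \<subseteq> Q}"
        by (auto simp: rng.closedin_zariski[OF A_rng])
      \<comment> \<open>Preimages of closed sets are closed: containing \<open>J\<close> after
        contraction means containing the ideal generated by the image of \<open>J\<close>.\<close>
      define T where "T = \<Inter>{T. rng_ideal T R \<and> h ` J \<subseteq> T}"
      have "h ` J \<subseteq> carrier R" using h_closed rng_ideal_subset[OF J(1)] by blast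
      then have T: "rng_ideal T R"
        unfolding T_def by (intro rng_ideal_Inter) (use rng_ideal_carrier in auto)
      have "pull P \<in> C \<longleftrightarrow> T \<subseteq> P" if P: "P \<in> corner_primes" for P
      proof -
        note P' = corner_primesD[OF P]
        have "pull P \<in> C \<longleftrightarrow> J \<subseteq> pull P" using im P J by blast
        also have "\<dots> \<longleftrightarrow> h ` J \<subseteq> P"
          unfolding pull_eq[OF P'(1,3)] using rng_ideal_subset[OF J(1)] by blast
        also have "\<dots> \<longleftrightarrow> T \<subseteq> P" unfolding T_def using P'(1) by blast
        finally show ?thesis .
      qed
      then have "{P \<in> corner_primes. pull P \<in> C} = {P \<in> Spec R. T \<subseteq> P} \<inter> corner_primes"
        using sub by blast
      then show "closedin (subtopology (zariski R) corner_primes) {P \<in> corner_primes. pull P \<in> C}"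
        using T by (auto simp: closedin_subtopology closedin_zariski)
    qed
    show "closed_map (subtopology (zariski R) corner_primes) (zariski A) pull"
      unfolding closed_map_def
    proof (intro allI impI)
      fix U assume "closedin (subtopology (zariski R) corner_primes) U"
      then obtain J where J: "rng_ideal J R" "U = {P \<in> Spec R. J \<subseteq> P} \<inter> corner_primes"
        by (auto simp: closedin_subtopology closedin_zariski)
      have "pull ` U = {Q \<in> Spec A. pull J \<subseteq> Q}"
      proof (intro equalityI subsetI)
        fix Q assume "Q \<in> pull ` U"
        then show "Q \<in> {Q \<in> Spec A. pull J \<subseteq> Q}"
          using J pull_prime pull_subset_iff[OF J(1)] by auto
      next
        fix Q assume Q: "Q \<in> {Q \<in> Spec A. pull J \<subseteq> Q}"
        then have "J \<subseteq> push Q"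
          using iffD1[OF pull_subset_iff[OF J(1) push_prime(1)]] push_prime(2) by blast
        then have "push Q \<in> U" using Q push_prime(1) sub J by auto
        then show "Q \<in> pull ` U" using push_prime(2) Q by (metis (mono_tags, lifting) image_eqI mem_Collect_eq)
      qed
      then show "closedin (zariski A) (pull ` U)"
        using pull_ideal[OF J(1)] by (auto simp: rng.closedin_zariski[OF A_rng])
    qed
    show "pull ` topspace (subtopology (zariski R) corner_primes) = topspace (zariski A)"
      unfolding top im rng.topspace_zariski[OF A_rng] ..
    show "inj_on pull (topspace (subtopology (zariski R) corner_primes))"
      unfolding top by (rule inj)
  qed
  then show ?thesis by (rule homeomorphic_map_imp_homeomorphic_space)
qed

text \<open>For the simple module \<open>M\<close>, the subgroup \<open>M v\<close> is acted on by
  the corner, which is commutative modulo \<open>P\<close>. If \<open>q\<close> is a corner element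
  outside \<open>P\<close>, then \<open>w q t = w\<close> for some \<open>w\<close> that generates
  \<open>M v\<close> over the corner, and by commutativity \<open>q t\<close> is the identity on
  \<open>M v\<close>. So \<open>v - q t \<in> P\<close>, and an ideal above \<open>P\<close> that
  contains \<open>q\<close> also contains \<open>v\<close>.\<close>

lemma primitive_imp_maximal:
  assumes P: "P \<in> corner_primes" and prim: "primitive_ideal P R"
    and Q: "Q \<in> corner_primes" "P \<subseteq> Q"
  shows "Q = P"
proof (rule ccontr)
  assume "Q \<noteq> P"
  then obtain x where x: "x \<in> Q" "x \<notin> P" using Q(2) by blast
  note P' = corner_primesD[OF P] and Q' = corner_primesD[OF Q(1)]
  have xc: "x \<in> carrier R" using x rng_ideal_subset[OF Q'(1)] by blast
  obtain M :: "'a set ring" and act where simple: "simple_right_module R M act"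
    and ann: "P = module_annihilator R M act"
    using prim unfolding primitive_ideal_def by blast
  interpret right_rng_module R M act
    using simple by (simp add: simple_right_module_def)
  have act_cong: "act m a = act m b" if m: "m \<in> carrier M" and ab: "cong_mod P a b" for m a b
  proof -
    have c: "a \<in> carrier R" "b \<in> carrier R" "a \<ominus> b \<in> P" using ab by (auto simp: cong_mod_def)
    then have "act m (a \<ominus> b) = \<zero>\<^bsub>M\<^esub>" using m by (simp add: ann module_annihilator_def)
    then have "act m a \<oplus>\<^bsub>M\<^esub> \<ominus>\<^bsub>M\<^esub> act m b = \<zero>\<^bsub>M\<^esub>"
      using c m by (simp add: a_minus_def act_add_right act_minus)
    then show ?thesis
      using M.minus_equality[of "act m a" "\<ominus>\<^bsub>M\<^esub> act m b"] act_closed m c by simp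
  qed
  \<comment> \<open>Primeness of \<open>P\<close> moves \<open>x\<close> into the corner: the
    element \<open>v y x z v\<close> lies in \<open>Q\<close> but not in \<open>P\<close>.\<close>
  obtain y where y: "y \<in> carrier R" "v \<otimes> y \<otimes> x \<notin> P"
    using P'(5)[OF v_closed xc] P'(4) x by blast
  obtain z where z: "z \<in> carrier R" "(v \<otimes> y \<otimes> x) \<otimes> z \<otimes> v \<notin> P"
    using P'(5)[of "v \<otimes> y \<otimes> x" v] P'(4) y xc v_closed by (auto simp: rng_m_closed)
  define k where "k = y \<otimes> x \<otimes> z"
  define q where "q = v \<otimes> k \<otimes> v"
  have kc: "k \<in> carrier R" using y z xc by (simp add: k_def rng_m_closed)
  have qc: "q \<in> carrier R" using kc v_closed by (simp add: q_def rng_m_closed)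
  have vq: "v \<otimes> q = q" "q \<otimes> v = q"
    using kc v_closed v_idem by (simp_all add: q_def rng_m_assoc rng_m_closed)
      (simp add: rng_m_assoc[symmetric] rng_m_closed)
  have "q = (v \<otimes> y \<otimes> x) \<otimes> z \<otimes> v"
    using y(1) z(1) xc v_closed by (simp add: q_def k_def rng_m_assoc rng_m_closed)
  then have qP: "q \<notin> P" using z by simp
  have qQ: "q \<in> Q"
    unfolding q_def k_def
    by (intro rng_ideal.rng_I_r_closed[OF Q'(1)] rng_ideal.rng_I_l_closed[OF Q'(1)] x y z v_closed)
  obtain n where n: "n \<in> carrier M" "act n q \<noteq> \<zero>\<^bsub>M\<^esub>"
    using qP qc by (auto simp: ann module_annihilator_def)
  have nq: "act n q \<in> carrier M" using n qc act_closed by simp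
  have N: "act (act n q) ` carrier R = carrier M"
    using n qc v_closed by (intro simple_generated[OF simple nq n(2) v_closed]) (simp add: act_assoc vq)
  define w where "w = act n v"
  have wc: "w \<in> carrier M" using n v_closed act_closed by (simp add: w_def)
  obtain r where r: "r \<in> carrier R" "act (act n q) r = w"
    using wc unfolding N[symmetric] by blast
  define t where "t = v \<otimes> r \<otimes> v"
  have tc: "t \<in> carrier R" using r v_closed by (simp add: t_def rng_m_closed)
  have wv: "act w v = w" using n v_closed v_idem by (simp add: w_def act_assoc)
  have wq: "act w q = act n q" using n v_closed qc by (simp add: w_def act_assoc vq)
  have qt: "q \<otimes> t = q \<otimes> r \<otimes> v"
    using vq qc r(1) v_closed by (simp add: t_def rng_m_assoc[symmetric] rng_m_closed)
  have wqt: "act w (q \<otimes> t) = w"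
  proof -
    have "act w (q \<otimes> t) = act (act (act w q) r) v"
      using wc qc r(1) v_closed by (simp add: qt act_assoc rng_m_closed rng_m_assoc)
    then show ?thesis by (simp add: wq r(2) wv)
  qed
  have "act m (v \<ominus> q \<otimes> t) = \<zero>\<^bsub>M\<^esub>" if m: "m \<in> carrier M" for m
  proof -
    obtain s where s: "s \<in> carrier R" "m = act (act n q) s" using m unfolding N[symmetric] by blast
    define u where "u = v \<otimes> (q \<otimes> s) \<otimes> v"
    have uc: "u \<in> carrier R" using s qc v_closed by (simp add: u_def rng_m_closed)
    have u: "act m v = act w u"
      using s wc n qc v_closed vq by (simp add: u_def w_def act_assoc act_closed rng_m_closed
          rng_m_assoc[symmetric] v_idem)
    have "act m (q \<otimes> t) = act (act m v) (q \<otimes> t)"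
      using m v_closed qc tc vq by (simp add: act_assoc rng_m_closed rng_m_assoc[symmetric])
    also have "\<dots> = act w (u \<otimes> (q \<otimes> t))"
      using wc uc qc tc by (simp add: u act_assoc rng_m_closed)
    also have "\<dots> = act w ((q \<otimes> t) \<otimes> u)"
    proof (rule act_cong[OF wc])
      have "q \<otimes> t = v \<otimes> (k \<otimes> v \<otimes> t) \<otimes> v"
        using kc tc r(1) v_closed v_idem by (simp add: q_def t_def rng_m_assoc rng_m_closed)
      then show "cong_mod P (u \<otimes> (q \<otimes> t)) ((q \<otimes> t) \<otimes> u)"
        unfolding u_def using corner_comm[of "q \<otimes> s" "k \<otimes> v \<otimes> t"] s qc kc tc v_closed
        by (intro cong_mod_mono[OF P'(3)]) (simp add: rng_m_closed)
    qed
    also have "\<dots> = act (act w (q \<otimes> t)) u" using wc uc qc tc by (simp add: act_assoc rng_m_closed)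
    also have "\<dots> = act m v" by (simp add: wqt u)
    finally have "act m (q \<otimes> t) = act m v" .
    then show ?thesis
      using m v_closed qc tc act_closed
      by (simp add: a_minus_def act_add_right act_minus rng_m_closed M.r_neg)
  qed
  then have "v \<ominus> q \<otimes> t \<in> P"
    using v_closed qc tc by (simp add: ann module_annihilator_def rng_m_closed)
  then have "cong_mod Q v (q \<otimes> t)"
    using Q(2) v_closed qc tc by (auto simp: cong_mod_def rng_m_closed)
  moreover have "q \<otimes> t \<in> Q" using rng_ideal.rng_I_r_closed[OF Q'(1) qQ tc] .
  ultimately show False using rng_ideal.cong_mem[OF Q'(1)] Q'(4) by blast
qed

text \<open>The ideal \<open>J\<close> of elements whose corner lies in \<open>q R + P\<close>
  contains both \<open>P\<close> and \<open>q\<close>. If it missed \<open>v\<close>, a prime above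
  \<open>J\<close> that misses \<open>v\<close> would be a member of \<open>corner_primes\<close>
  strictly above \<open>P\<close>. So \<open>v \<in> J\<close>, which makes \<open>q\<close>
  invertible in the corner modulo \<open>P\<close>.\<close>

lemma corner_field:
  assumes P: "P \<in> corner_primes" and max: "\<And>Q. Q \<in> corner_primes \<Longrightarrow> P \<subseteq> Q \<Longrightarrow> Q = P"
    and x: "x \<in> carrier R" "v \<otimes> x \<otimes> v \<notin> P"
  shows "\<exists>r\<in>carrier R. cong_mod P v (v \<otimes> x \<otimes> v \<otimes> r)"
proof -
  note P' = corner_primesD[OF P]
  interpret P: rng_ideal P R by (rule P'(1))
  define q where "q = v \<otimes> x \<otimes> v"
  have qc: "q \<in> carrier R" using x v_closed by (simp add: q_def rng_m_closed)
  define J where "J = {y \<in> carrier R. \<forall>a\<in>carrier R. \<forall>b\<in>carrier R.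
    \<exists>r\<in>carrier R. cong_mod P (v \<otimes> (a \<otimes> y \<otimes> b) \<otimes> v) (q \<otimes> r)}"
  have PJ: "P \<subseteq> J"
  proof
    fix y assume y: "y \<in> P"
    have "cong_mod P (v \<otimes> (a \<otimes> y \<otimes> b) \<otimes> v) (q \<otimes> \<zero>)" if "a \<in> carrier R" "b \<in> carrier R" for a b
    proof -
      have "v \<otimes> (a \<otimes> y \<otimes> b) \<otimes> v \<in> P"
        using y that v_closed by (intro P.rng_I_r_closed P.rng_I_l_closed)
      then show ?thesis using P.cong_zero qc by (simp add: m_zero)
    qed
    then show "y \<in> J" using P.carr[OF y] zero_closed unfolding J_def by blast
  qed
  have "additive_subgroup {x. \<exists>r\<in>carrier R. cong_mod P x (q \<otimes> r)} R"
  proof (intro additive_subgroup.intro add.subgroupI)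
    show "{x. \<exists>r\<in>carrier R. cong_mod P x (q \<otimes> r)} \<subseteq> carrier R" by (auto simp: cong_mod_def)
    show "{x. \<exists>r\<in>carrier R. cong_mod P x (q \<otimes> r)} \<noteq> {}"
      using P.cong_refl[OF rng_m_closed[OF qc qc]] qc rng_m_closed by blast
  next
    fix x assume "x \<in> {x. \<exists>r\<in>carrier R. cong_mod P x (q \<otimes> r)}"
    then obtain r where r: "r \<in> carrier R" "cong_mod P x (q \<otimes> r)" by blast
    have "cong_mod P (\<ominus> x) (q \<otimes> \<ominus> r)"
      using P.cong_uminus[OF r(2)] qc r(1) by (simp add: minus_mult_right)
    then show "\<ominus> x \<in> {x. \<exists>r\<in>carrier R. cong_mod P x (q \<otimes> r)}"
      using r(1) by blast
    fix y assume "y \<in> {x. \<exists>r\<in>carrier R. cong_mod P x (q \<otimes> r)}"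
    then obtain s where s: "s \<in> carrier R" "cong_mod P y (q \<otimes> s)" by blast
    have "cong_mod P (x \<oplus> y) (q \<otimes> (r \<oplus> s))"
      using P.cong_add[OF r(2) s(2)] qc r(1) s(1) by (simp add: rng_r_distr)
    then show "x \<oplus> y \<in> {x. \<exists>r\<in>carrier R. cong_mod P x (q \<otimes> r)}"
      using r(1) s(1) by blast
  qed
  from corner_ideal[OF this] have J: "rng_ideal J R"
    by (simp add: J_def)
  have qJ: "q \<in> J"
  proof -
    have "\<exists>r\<in>carrier R. cong_mod P (v \<otimes> (a \<otimes> q \<otimes> b) \<otimes> v) (q \<otimes> r)"
      if ab: "a \<in> carrier R" "b \<in> carrier R" for a b
    proof -
      define a' where "a' = v \<otimes> a \<otimes> v"
      define b' where "b' = v \<otimes> b \<otimes> v"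
      have c: "a' \<in> carrier R" "b' \<in> carrier R" using ab v_closed by (simp_all add: a'_def b'_def rng_m_closed)
      have vq: "v \<otimes> q = q" "q \<otimes> v = q"
        using x v_closed v_idem by (simp_all add: q_def rng_m_assoc rng_m_closed)
          (simp add: rng_m_assoc[symmetric] rng_m_closed)
      have "v \<otimes> (a \<otimes> q \<otimes> b) \<otimes> v = v \<otimes> (a \<otimes> (v \<otimes> q \<otimes> v) \<otimes> b) \<otimes> v" by (simp add: vq)
      also have "\<dots> = (a' \<otimes> q) \<otimes> b'"
        using ab qc v_closed by (simp add: a'_def b'_def rng_m_assoc rng_m_closed)
      also have "cong_mod P \<dots> ((q \<otimes> a') \<otimes> b')"
        using corner_comm[of a x] ab x(1) c
        by (intro P.cong_mult[OF cong_mod_mono[OF P'(3)] P.cong_refl]) (simp_all add: a'_def q_def)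
      also have "(q \<otimes> a') \<otimes> b' = q \<otimes> (a' \<otimes> b')" using c qc by (simp add: rng_m_assoc)
      finally show ?thesis using c rng_m_closed by blast
    qed
    then show ?thesis using qc by (simp add: J_def)
  qed
  have "v \<in> J"
  proof (rule ccontr)
    assume "v \<notin> J"
    then obtain P2 where P2: "rng_prime_ideal P2 R" "J \<subseteq> P2" "v \<notin> P2"
      using prime_avoiding_idempotent[OF J v_closed v_idem] by blast
    then have "P2 \<in> corner_primes" using PJ P'(3) unfolding corner_primes_def Spec_def by blast
    then have "P2 = P" using max P2 PJ by blast
    then show False using qJ P2 x(2) by (auto simp: q_def)
  qed
  then obtain r where r: "r \<in> carrier R" "cong_mod P (v \<otimes> (v \<otimes> v \<otimes> v) \<otimes> v) (q \<otimes> r)"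
    using v_closed unfolding J_def by blast
  then show ?thesis by (auto simp: v_idem q_def)
qed

text \<open>The module is \<open>v R\<close> modulo \<open>P\<close>, realised on cosets. A nonzero
  \<open>v y\<close> generates it: primeness gives a corner element \<open>v y s v\<close> outside
  \<open>P\<close>, which is invertible by \<open>corner_field\<close>, so every \<open>v x\<close>
  is a multiple of \<open>v y\<close>. The annihilator consists of the \<open>a\<close> with
  \<open>v R a \<subseteq> P\<close>, which is \<open>P\<close> since
  \<open>v \<notin> P\<close>.\<close>

lemma maximal_imp_primitive:
  assumes P: "P \<in> corner_primes" and max: "\<And>Q. Q \<in> corner_primes \<Longrightarrow> P \<subseteq> Q \<Longrightarrow> Q = P"
  shows "primitive_ideal P R"
proof -
  note P' = corner_primesD[OF P]
  interpret P: rng_ideal P R by (rule P'(1))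
  interpret PA: abelian_subgroup P R
    by (intro abelian_subgroupI3 P.additive_subgroup_axioms abelian_group_axioms)
  define c where "c x = P +> x" for x
  have c_eq: "c x = c y \<longleftrightarrow> x \<ominus> y \<in> P" if "x \<in> carrier R" "y \<in> carrier R" for x y
  proof
    show "x \<ominus> y \<in> P" if "c x = c y"
      using that PA.a_rcos_self[of x] PA.a_rcos_module[of y x] \<open>x \<in> carrier R\<close> \<open>y \<in> carrier R\<close>
      by (simp add: c_def a_minus_def)
    show "c x = c y" if "x \<ominus> y \<in> P"
      using that PA.a_rcos_module[of y x] PA.a_repr_independence'[of x y] \<open>x \<in> carrier R\<close> \<open>y \<in> carrier R\<close>
      by (simp add: c_def a_minus_def)
  qed
  have c_cong: "c x = c y" if "cong_mod P x y" for x y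
    using that c_eq by (simp add: cong_mod_def)
  have c_add: "c x <+> c y = c (x \<oplus> y)" if "x \<in> carrier R" "y \<in> carrier R" for x y
    using that PA.a_rcos_sum by (simp add: c_def)
  have c_mult: "[mod P:] c x \<Otimes> c y = c (x \<otimes> y)" if "x \<in> carrier R" "y \<in> carrier R" for x y
    using that P.rcoset_mult_add by (simp add: c_def)
  have c_zero: "c \<zero> = P" using P.a_subset by (simp add: c_def)
  define M :: "'a set ring" where
    "M = \<lparr>carrier = (\<lambda>r. c (v \<otimes> r)) ` carrier R, mult = undefined, one = undefined,
      zero = P, add = set_add R\<rparr>"
  define act where "act X a = [mod P:] X \<Otimes> c a" for X a
  have sel: "carrier M = (\<lambda>r. c (v \<otimes> r)) ` carrier R" "\<zero>\<^bsub>M\<^esub> = P"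
    "\<And>X Y. X \<oplus>\<^bsub>M\<^esub> Y = X <+> Y" by (simp_all add: M_def)
  have act: "act (c (v \<otimes> r)) a = c (v \<otimes> (r \<otimes> a))" if "r \<in> carrier R" "a \<in> carrier R" for r a
    using that v_closed by (simp add: act_def c_mult rng_m_closed rng_m_assoc)
  have add: "c (v \<otimes> r) <+> c (v \<otimes> s) = c (v \<otimes> (r \<oplus> s))" if "r \<in> carrier R" "s \<in> carrier R" for r s
    using that v_closed by (simp add: c_add rng_m_closed rng_r_distr)
  have zero: "P = c (v \<otimes> \<zero>)" using v_closed by (simp add: m_zero c_zero)
  have "abelian_group M"
  proof (rule abelian_groupI)
    show "\<zero>\<^bsub>M\<^esub> \<in> carrier M" unfolding sel by (subst zero) blast
    fix X assume "X \<in> carrier M"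
    then obtain r where r: "r \<in> carrier R" "X = c (v \<otimes> r)" unfolding sel by blast
    show "\<zero>\<^bsub>M\<^esub> \<oplus>\<^bsub>M\<^esub> X = X" using r unfolding sel by (subst zero) (simp add: add)
    show "\<exists>Y\<in>carrier M. Y \<oplus>\<^bsub>M\<^esub> X = \<zero>\<^bsub>M\<^esub>"
      using r v_closed unfolding sel by (intro bexI[of _ "c (v \<otimes> (\<ominus> r))"]) (simp_all add: add l_neg m_zero c_zero)
  qed (auto simp: sel add a_ac)
  then interpret M: abelian_group M .
  have module: "right_rng_module R M act"
    by unfold_locales (auto simp: sel act add rng_m_closed rng_m_assoc rng_l_distr rng_r_distr)
  have gen: "c (v \<otimes> x) \<in> N"
    if N: "\<And>n a. n \<in> N \<Longrightarrow> a \<in> carrier R \<Longrightarrow> act n a \<in> N"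
      and y: "y \<in> carrier R" "c (v \<otimes> y) \<in> N" "v \<otimes> y \<notin> P" and x: "x \<in> carrier R" for N x y
  proof -
    obtain s where s: "s \<in> carrier R" "v \<otimes> y \<otimes> s \<otimes> v \<notin> P"
      using P'(5)[of "v \<otimes> y" v] P'(4) y v_closed by (auto simp: rng_m_closed)
    have "v \<otimes> (y \<otimes> s) \<otimes> v \<notin> P"
      using s y(1) v_closed by (simp add: rng_m_assoc rng_m_closed)
    then obtain r where r: "r \<in> carrier R" "cong_mod P v (v \<otimes> (y \<otimes> s) \<otimes> v \<otimes> r)"
      using corner_field[OF P max, of "y \<otimes> s"] s(1) y(1) rng_m_closed by blast
    have "c (v \<otimes> x) = c ((v \<otimes> (y \<otimes> s) \<otimes> v \<otimes> r) \<otimes> x)"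
      by (rule c_cong[OF P.cong_mult[OF r(2) P.cong_refl[OF x]]])
    also have "(v \<otimes> (y \<otimes> s) \<otimes> v \<otimes> r) \<otimes> x = v \<otimes> (y \<otimes> (s \<otimes> (v \<otimes> (r \<otimes> x))))"
      using s(1) y(1) r(1) x v_closed by (simp add: rng_m_assoc rng_m_closed)
    also have "c \<dots> = act (c (v \<otimes> y)) (s \<otimes> (v \<otimes> (r \<otimes> x)))"
      using s(1) y(1) r(1) x v_closed by (simp add: act rng_m_closed)
    finally show ?thesis using N[OF y(2), of "s \<otimes> (v \<otimes> (r \<otimes> x))"] s(1) r(1) x v_closed by (simp add: rng_m_closed)
  qed
  have c_mem: "c x = P \<longleftrightarrow> x \<in> P" if "x \<in> carrier R" for x
    using c_eq[OF that zero_closed] that minus_equality[of \<zero> \<zero>] by (simp add: c_zero a_minus_def)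
  have "simple_right_module R M act"
    unfolding simple_right_module_def
  proof (intro conjI allI impI)
    show "right_rng_module R M act" by (rule module)
    have "act (c (v \<otimes> v)) v \<noteq> P" using act[of v v] c_mem[of v] P'(4) v_closed v_idem by simp
    then show "\<exists>m\<in>carrier M. \<exists>a\<in>carrier R. act m a \<noteq> \<zero>\<^bsub>M\<^esub>"
      unfolding sel using v_closed by blast
    fix N assume N: "additive_subgroup N M \<and> (\<forall>n\<in>N. \<forall>a\<in>carrier R. act n a \<in> N)"
    then interpret N: additive_subgroup N M by simp
    show "N = {\<zero>\<^bsub>M\<^esub>} \<or> N = carrier M"
    proof (rule disjCI)
      assume "N \<noteq> carrier M"
      then obtain x where x: "x \<in> carrier R" "c (v \<otimes> x) \<notin> N"
        using N.a_subset unfolding sel by blast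
      have "n = \<zero>\<^bsub>M\<^esub>" if n: "n \<in> N" for n
      proof -
        obtain y where y: "y \<in> carrier R" "n = c (v \<otimes> y)" using n N.a_subset unfolding sel by blast
        have "v \<otimes> y \<in> P" using gen[of N y x] N n x y by blast
        then show ?thesis using c_mem[of "v \<otimes> y"] y v_closed by (simp add: sel rng_m_closed)
      qed
      then show "N = {\<zero>\<^bsub>M\<^esub>}" using N.zero_closed by blast
    qed
  qed
  moreover have "module_annihilator R M act = P"
  proof -
    have "(\<forall>m\<in>carrier M. act m a = P) \<longleftrightarrow> a \<in> P" if a: "a \<in> carrier R" for a
    proof -
      have "(\<forall>m\<in>carrier M. act m a = P) \<longleftrightarrow> (\<forall>r\<in>carrier R. v \<otimes> r \<otimes> a \<in> P)"
        using a v_closed by (simp add: sel act c_mem rng_m_closed rng_m_assoc)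
      also have "\<dots> \<longleftrightarrow> a \<in> P"
      proof
        show "a \<in> P" if "\<forall>r\<in>carrier R. v \<otimes> r \<otimes> a \<in> P"
          using P'(5)[OF v_closed a] P'(4) that by blast
        show "\<forall>r\<in>carrier R. v \<otimes> r \<otimes> a \<in> P" if "a \<in> P"
          using P.rng_I_l_closed[OF that] v_closed by (simp add: rng_m_closed)
      qed
      finally show ?thesis .
    qed
    then show ?thesis using P.a_subset by (auto simp: module_annihilator_def sel)
  qed
  ultimately show ?thesis using primitive_idealI by metis
qed

end

section \<open>Calculus in Leavitt path algebras\<close>

lemma poly_mapping_sum_single:
  "f = (\<Sum>w\<in>Poly_Mapping.keys f. Poly_Mapping.single w (Poly_Mapping.lookup f w))"
proof (rule poly_mapping_eqI)
  fix k
  have "(\<Sum>w\<in>Poly_Mapping.keys f. Poly_Mapping.lookup (Poly_Mapping.single w (Poly_Mapping.lookup f w)) k)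
    = (\<Sum>w\<in>Poly_Mapping.keys f. if k = w then Poly_Mapping.lookup f k else 0)"
    by (intro sum.cong) (auto simp: lookup_single when_def)
  also have "\<dots> = Poly_Mapping.lookup f k"
    by (simp add: sum.delta' in_keys_iff)
  finally show "Poly_Mapping.lookup f k =
    Poly_Mapping.lookup (\<Sum>w\<in>Poly_Mapping.keys f. Poly_Mapping.single w (Poly_Mapping.lookup f w)) k"
    by (simp add: lookup_sum)
qed

lemma poly_mapping_sum_induct:
  fixes f :: "'a \<Rightarrow>\<^sub>0 'b::comm_monoid_add"
  assumes "\<And>w c. w \<in> Poly_Mapping.keys f \<Longrightarrow> Q (Poly_Mapping.single w c)"
    and "\<And>a b. Q a \<Longrightarrow> Q b \<Longrightarrow> Q (a + b)" and "Q 0"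
  shows "Q f"
proof -
  have "Q (\<Sum>w\<in>S. Poly_Mapping.single w (Poly_Mapping.lookup f w))" if "finite S" "S \<subseteq> Poly_Mapping.keys f" for S
    using that by induction (auto intro: assms)
  from this[OF _ order_refl] show ?thesis using poly_mapping_sum_single[of f] by simp
qed

lemma single_0_commute:
  "Poly_Mapping.single 0 c * (f :: 'a::monoid_add \<Rightarrow>\<^sub>0 'k::comm_semiring_1) = f * Poly_Mapping.single 0 c"
  by (rule poly_mapping_sum_induct[of f]) (simp_all add: mult_single algebra_simps)

type_synonym ('v, 'e, 'k) words = "('v, 'e) lpa_gen free_word \<Rightarrow>\<^sub>0 'k"

locale leavitt = wf_digraph E for E :: "('v, 'e) pre_digraph" +
  fixes K :: "'k::field itself"
  assumes row_finite: "row_finite E"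
begin

text \<open>The unital hull of \<open>FA\<close>: the empty word is allowed.\<close>

definition words_ring :: "('v, 'e, 'k) words set" where
  "words_ring = {f. \<forall>w\<in>Poly_Mapping.keys f. set (letters w) \<subseteq> lpa_gens E}"

definition FA :: "('v, 'e, 'k) words set" where
  "FA = carrier (free_algebra (lpa_gens E))"

definition V :: "'v \<Rightarrow> ('v, 'e, 'k) words" where "V v = gen (Vertex v)"
definition ed :: "'e \<Rightarrow> ('v, 'e, 'k) words" where "ed e = gen (Edge e)"
definition gh :: "'e \<Rightarrow> ('v, 'e, 'k) words" where "gh e = gen (Ghost e)"
definition cst :: "'k \<Rightarrow> ('v, 'e, 'k) words" where "cst c = Poly_Mapping.single 0 c"

lemma FA_iff: "f \<in> FA \<longleftrightarrow> (\<forall>w\<in>Poly_Mapping.keys f. letters w \<noteq> [] \<and> set (letters w) \<subseteq> lpa_gens E)"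
  by (simp add: FA_def free_algebra_carrier)

lemma FA_words: "f \<in> FA \<Longrightarrow> f \<in> words_ring"
  by (simp add: FA_iff words_ring_def)

lemma words_mult [simp]: "f \<in> words_ring \<Longrightarrow> g \<in> words_ring \<Longrightarrow> f * g \<in> words_ring"
proof -
  assume *: "f \<in> words_ring" "g \<in> words_ring"
  have "set (letters w) \<subseteq> lpa_gens E" if w: "w \<in> Poly_Mapping.keys (f * g)" for w
  proof -
    obtain u v where "w = u + v" "u \<in> Poly_Mapping.keys f" "v \<in> Poly_Mapping.keys g"
      using w Poly_Mapping.keys_mult[of f g] by blast
    then show ?thesis using * by (simp add: words_ring_def plus_free_word_def)
  qed
  then show ?thesis by (simp add: words_ring_def)
qed

lemma FA_mult [simp]:
  assumes "f \<in> words_ring" "g \<in> FA"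
  shows "f * g \<in> FA" "g * f \<in> FA"
proof -
  have "letters w \<noteq> [] \<and> set (letters w) \<subseteq> lpa_gens E" if w: "w \<in> Poly_Mapping.keys (f * g)" for w
  proof -
    obtain u v where "w = u + v" "u \<in> Poly_Mapping.keys f" "v \<in> Poly_Mapping.keys g"
      using w Poly_Mapping.keys_mult[of f g] by blast
    then show ?thesis using assms by (simp add: words_ring_def FA_iff plus_free_word_def)
  qed
  then show "f * g \<in> FA" by (simp add: FA_iff)
  have "letters w \<noteq> [] \<and> set (letters w) \<subseteq> lpa_gens E" if w: "w \<in> Poly_Mapping.keys (g * f)" for w
  proof -
    obtain u v where "w = u + v" "u \<in> Poly_Mapping.keys g" "v \<in> Poly_Mapping.keys f"
      using w Poly_Mapping.keys_mult[of g f] by blast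
    then show ?thesis using assms by (simp add: words_ring_def FA_iff plus_free_word_def)
  qed
  then show "g * f \<in> FA" by (simp add: FA_iff)
qed

lemma words_add [simp]: "f \<in> words_ring \<Longrightarrow> g \<in> words_ring \<Longrightarrow> f + g \<in> words_ring"
  using Poly_Mapping.keys_add[of f g] unfolding words_ring_def by blast

lemma words_diff [simp]: "f \<in> words_ring \<Longrightarrow> g \<in> words_ring \<Longrightarrow> f - g \<in> words_ring"
  using keys_diff[of f g] unfolding words_ring_def by blast

lemma FA_add [simp]: "f \<in> FA \<Longrightarrow> g \<in> FA \<Longrightarrow> f + g \<in> FA"
  unfolding FA_def by (rule free_algebra_add)

lemma FA_diff [simp]: "f \<in> FA \<Longrightarrow> g \<in> FA \<Longrightarrow> f - g \<in> FA"
  unfolding FA_def by (rule free_algebra_diff)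

lemma FA_zero [simp]: "0 \<in> FA"
  by (simp add: FA_iff)

lemma FA_uminus [simp]: "f \<in> FA \<Longrightarrow> - f \<in> FA"
  using FA_diff[of 0 f] by simp

lemma words_basic [simp]: "0 \<in> words_ring" "1 \<in> words_ring" "cst c \<in> words_ring"
  by (auto simp: words_ring_def cst_def zero_free_word_def)

lemma V_FA [simp]: "v \<in> verts E \<Longrightarrow> V v \<in> FA"
  and ed_FA [simp]: "e \<in> arcs E \<Longrightarrow> ed e \<in> FA"
  and gh_FA [simp]: "e \<in> arcs E \<Longrightarrow> gh e \<in> FA"
  by (simp_all add: FA_def V_def ed_def gh_def gen_in_free_algebra lpa_gens_def)

lemmas gens_words [simp] = V_FA[THEN FA_words] ed_FA[THEN FA_words] gh_FA[THEN FA_words]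

lemma FA_sum [simp]: "(\<And>i. i \<in> A \<Longrightarrow> h i \<in> FA) \<Longrightarrow> sum h A \<in> FA"
  unfolding FA_def by (rule free_algebra_sum)

text \<open>The hull consists of scalars plus elements of the algebra without identity, so closure
  under both kinds of factors gives closure under factors from \<open>words_ring\<close>.\<close>

lemma words_decomp:
  assumes "a \<in> words_ring"
  obtains c b where "a = cst c + b" "b \<in> FA"
proof
  define c where "c = Poly_Mapping.lookup a 0"
  show "a = cst c + (a - cst c)" by simp
  have "letters w \<noteq> [] \<and> set (letters w) \<subseteq> lpa_gens E" if w: "w \<in> Poly_Mapping.keys (a - cst c)" for w
  proof -
    have "a - cst c \<in> words_ring" using assms by simp
    moreover have "w \<noteq> 0" using w by (auto simp: in_keys_iff lookup_minus c_def cst_def)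
    moreover from this have "letters w \<noteq> []" by (cases w) (simp add: zero_free_word_def)
    ultimately show ?thesis using w by (simp add: words_ring_def)
  qed
  then show "a - cst c \<in> FA" by (simp add: FA_iff)
qed

lemma cst_commute: "cst c * f = f * cst c"
  unfolding cst_def by (rule single_0_commute)

lemma cst_mult: "cst c * cst d = cst (c * d)" and cst_add: "cst c + cst d = cst (c + d)"
  and cst_one [simp]: "cst 1 = 1" and cst_zero [simp]: "cst 0 = 0"
  by (simp_all add: cst_def mult_single single_add)

lemma FA_induct [consumes 1, case_names word add zero]:
  assumes "f \<in> FA"
    and "\<And>gs c. gs \<noteq> [] \<Longrightarrow> set gs \<subseteq> lpa_gens E \<Longrightarrow> Q (cst c * prod_list (map gen gs))"
    and "\<And>a b. Q a \<Longrightarrow> Q b \<Longrightarrow> Q (a + b)" and "Q 0"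
  shows "Q f"
proof (rule poly_mapping_sum_induct[of f])
  have word: "Poly_Mapping.single (Word gs) 1 = (prod_list (map gen gs) :: ('v, 'e, 'k) words)" for gs
  proof (induction gs)
    case Nil
    then show ?case by (simp flip: zero_free_word_def)
  next
    case (Cons g gs)
    have "Poly_Mapping.single (Word (g # gs)) 1 =
      gen g * (Poly_Mapping.single (Word gs) 1 :: ('v, 'e, 'k) words)"
      by (simp add: gen_def mult_single plus_free_word_def)
    then show ?case by (simp add: Cons)
  qed
  fix w c assume w: "w \<in> Poly_Mapping.keys f"
  obtain gs where gs: "w = Word gs" by (cases w)
  have "Poly_Mapping.single w c = cst c * (Poly_Mapping.single (Word gs) 1 :: ('v, 'e, 'k) words)"
    by (simp add: cst_def mult_single gs)
  then have "Poly_Mapping.single w c = cst c * prod_list (map gen gs)" by (simp only: word)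
  then show "Q (Poly_Mapping.single w c)"
    using assms(1,2) w by (auto simp: FA_iff gs)
qed fact+

definition L :: "('v, 'e, 'k) words set" where "L = lpa_ideal E"

lemma relations_FA: "lpa_relations E \<subseteq> FA"
proof
  fix f :: "('v, 'e, 'k) words" assume "f \<in> lpa_relations E"
  then show "f \<in> FA"
    by induction (auto simp flip: V_def ed_def gh_def intro!: FA_diff FA_sum FA_mult FA_words)
qed

lemma L_ideal: "rng_ideal L (free_algebra (lpa_gens E))"
  unfolding L_def lpa_ideal_def
  by (rule rng_ideal_generated_algebra_ideal) (use relations_FA in \<open>simp add: FA_def\<close>)

lemma relations_L: "lpa_relations E \<subseteq> L"
  unfolding L_def lpa_ideal_def generated_algebra_ideal_def by blast

lemma L_cst: "f \<in> L \<Longrightarrow> cst c * f \<in> L"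
  unfolding L_def lpa_ideal_def generated_algebra_ideal_def cst_def by blast

lemma L_minimal:
  assumes "rng_ideal I (free_algebra (lpa_gens E))" "\<And>c f. f \<in> I \<Longrightarrow> cst c * f \<in> I" "lpa_relations E \<subseteq> I"
  shows "L \<subseteq> I"
  using assms unfolding L_def lpa_ideal_def generated_algebra_ideal_def cst_def by blast

text \<open>These are the preimages of the ideals of the Leavitt path algebra.\<close>

definition lid :: "('v, 'e, 'k) words set \<Rightarrow> bool" where
  "lid P \<longleftrightarrow> rng_ideal P (free_algebra (lpa_gens E)) \<and> L \<subseteq> P"

lemma ideal_basic:
  assumes "rng_ideal P (free_algebra (lpa_gens E))"
  shows "P \<subseteq> FA" "0 \<in> P" "\<And>x y. x \<in> P \<Longrightarrow> y \<in> P \<Longrightarrow> x + y \<in> P" "\<And>x. x \<in> P \<Longrightarrow> - x \<in> P"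
    "\<And>x y. x \<in> P \<Longrightarrow> y \<in> P \<Longrightarrow> x - y \<in> P"
    "\<And>a x. a \<in> P \<Longrightarrow> x \<in> FA \<Longrightarrow> x * a \<in> P" "\<And>a x. a \<in> P \<Longrightarrow> x \<in> FA \<Longrightarrow> a * x \<in> P"
proof -
  interpret P: rng_ideal P "free_algebra (lpa_gens E)" by fact
  show sub: "P \<subseteq> FA" using P.a_subset by (simp add: FA_def)
  show z: "0 \<in> P" using P.zero_closed by (simp add: free_algebra_simps)
  show add: "\<And>x y. x \<in> P \<Longrightarrow> y \<in> P \<Longrightarrow> x + y \<in> P" using P.a_closed by (simp add: free_algebra_simps)
  show inv: "\<And>x. x \<in> P \<Longrightarrow> - x \<in> P"
  proof -
    fix x assume x: "x \<in> P"
    have "\<ominus>\<^bsub>free_algebra (lpa_gens E)\<^esub> x = - x"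
    proof (rule P.minus_equality)
      show "x \<in> carrier (free_algebra (lpa_gens E))" "- x \<in> carrier (free_algebra (lpa_gens E))"
        using sub x FA_uminus by (auto simp: FA_def)
    qed (simp add: free_algebra_simps)
    then show "- x \<in> P" using P.a_inv_closed[OF x] by simp
  qed
  show "\<And>x y. x \<in> P \<Longrightarrow> y \<in> P \<Longrightarrow> x - y \<in> P" using add inv by fastforce
  show "\<And>a x. a \<in> P \<Longrightarrow> x \<in> FA \<Longrightarrow> x * a \<in> P" using P.rng_I_l_closed by (simp add: free_algebra_simps FA_def)
  show "\<And>a x. a \<in> P \<Longrightarrow> x \<in> FA \<Longrightarrow> a * x \<in> P" using P.rng_I_r_closed by (simp add: free_algebra_simps FA_def)
qed

lemmas L_basic = ideal_basic[OF L_ideal]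

lemma L_words:
  assumes "p \<in> L" "a \<in> words_ring"
  shows "a * p \<in> L" "p * a \<in> L"
proof -
  obtain c b where ab: "a = cst c + b" "b \<in> FA" using words_decomp assms by blast
  show "a * p \<in> L" "p * a \<in> L"
    using L_basic(3,6,7) L_cst[OF assms(1)] ab assms(1) by (simp_all add: algebra_simps cst_commute[symmetric])
qed

text \<open>The vertices that act as one-sided identities on a generator.\<close>

fun left_vertex right_vertex :: "('v, 'e) lpa_gen \<Rightarrow> 'v" where
  "left_vertex (Vertex v) = v" | "left_vertex (Edge e) = tail E e" | "left_vertex (Ghost e) = head E e"
| "right_vertex (Vertex v) = v" | "right_vertex (Edge e) = head E e" | "right_vertex (Ghost e) = tail E e"

lemma gen_words [simp]: "g \<in> lpa_gens E \<Longrightarrow> gen g \<in> words_ring" 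
  by (rule FA_words) (simp add: FA_def gen_in_free_algebra)

lemma side_vertices:
  assumes "g \<in> lpa_gens E"
  shows "left_vertex g \<in> verts E" "right_vertex g \<in> verts E"
    "V (left_vertex g) * gen g - gen g \<in> L" "gen g * V (right_vertex g) - gen g \<in> L"
proof -
  note rel = lpa_relations.intros(1,3-6)[THEN subsetD[OF relations_L]]
  consider v where "g = Vertex v" "v \<in> verts E" | e where "g = Edge e" "e \<in> arcs E"
    | e where "g = Ghost e" "e \<in> arcs E"
    using assms by (auto simp: lpa_gens_def)
  note c = this
  show "left_vertex g \<in> verts E" by (rule c) auto
  show "right_vertex g \<in> verts E" by (rule c) auto
  show "V (left_vertex g) * gen g - gen g \<in> L" by (rule c) (simp_all add: V_def rel)
  show "gen g * V (right_vertex g) - gen g \<in> L" by (rule c) (simp_all add: V_def rel)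
qed

lemma V_orth: "v \<in> verts E \<Longrightarrow> w \<in> verts E \<Longrightarrow> v \<noteq> w \<Longrightarrow> V v * V w \<in> L"
  using subsetD[OF relations_L lpa_relations.orth] by (simp add: V_def)

lemma side_vertices_neq:
  assumes g: "g \<in> lpa_gens E" and w: "w \<in> verts E"
  shows "w \<noteq> left_vertex g \<Longrightarrow> V w * gen g \<in> L" "w \<noteq> right_vertex g \<Longrightarrow> gen g * V w \<in> L"
proof -
  note s = side_vertices[OF g]
  show "V w * gen g \<in> L" if "w \<noteq> left_vertex g"
  proof -
    have "V w * gen g = (V w * V (left_vertex g)) * gen g - V w * (V (left_vertex g) * gen g - gen g)"
      by (simp add: algebra_simps)
    also have "\<dots> \<in> L"
      by (rule L_basic(5)[OF L_words(2)[OF V_orth[OF w s(1) that] gen_words[OF g]]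
            L_words(1)[OF s(3) FA_words[OF V_FA[OF w]]]])
    finally show ?thesis .
  qed
  show "gen g * V w \<in> L" if "w \<noteq> right_vertex g"
  proof -
    have "gen g * V w = gen g * (V (right_vertex g) * V w) - (gen g * V (right_vertex g) - gen g) * V w"
      by (simp add: algebra_simps)
    also have "\<dots> \<in> L"
      by (rule L_basic(5)[OF L_words(1)[OF V_orth[OF s(2) w that[symmetric]] gen_words[OF g]]
            L_words(2)[OF s(4) FA_words[OF V_FA[OF w]]]])
    finally show ?thesis .
  qed
qed

lemma L_sum: "(\<And>i. i \<in> A \<Longrightarrow> h i \<in> L) \<Longrightarrow> sum h A \<in> L"
  by (induction A rule: infinite_finite_induct) (auto intro: L_basic)

text \<open>A word is fixed by the vertex at each of its ends, and the other vertices annihilate it.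
  Claiming this for all larger finite sets \<open>W'\<close> is what allows the vertex sets of two
  summands to be united.\<close>

lemma local_units:
  assumes "f \<in> FA"
  shows "\<exists>W. finite W \<and> W \<subseteq> verts E \<and> (\<forall>W'. finite W' \<and> W \<subseteq> W' \<and> W' \<subseteq> verts E \<longrightarrow>
    sum V W' * f - f \<in> L \<and> f * sum V W' - f \<in> L)"
  using assms
proof (induction rule: FA_induct)
  case (word gs c)
  define g where "g = hd gs"
  define k where "k = last gs"
  have gk: "g \<in> lpa_gens E" "k \<in> lpa_gens E" using word by (auto simp: g_def k_def)
  define a :: "('v, 'e, 'k) words" where "a = prod_list (map gen (tl gs))"
  define b :: "('v, 'e, 'k) words" where "b = prod_list (map gen (butlast gs))"
  have pw: "set hs \<subseteq> lpa_gens E \<Longrightarrow> (prod_list (map gen hs) :: ('v, 'e, 'k) words) \<in> words_ring" for hs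
    by (induction hs) auto
  have ab: "a \<in> words_ring" "b \<in> words_ring"
    using word unfolding a_def b_def by (auto intro!: pw dest: list.set_sel(2) in_set_butlastD)
  have "gs = g # tl gs" "gs = butlast gs @ [k]" using word by (auto simp: g_def k_def)
  then have eq: "prod_list (map gen gs) = gen g * a" "prod_list (map gen gs) = b * gen k"
  proof -
    have "prod_list (map gen (g # tl gs)) = gen g * a" by (simp add: a_def)
    then show "prod_list (map gen gs) = gen g * a" using \<open>gs = g # tl gs\<close> by simp
    have "prod_list (map gen (butlast gs @ [k])) = b * gen k" by (simp add: b_def)
    then show "prod_list (map gen gs) = b * gen k" using \<open>gs = butlast gs @ [k]\<close> by simp
  qed
  have one: "sum V W' * gen g - gen g \<in> L"
    if "finite W'" "left_vertex g \<in> W'" "W' \<subseteq> verts E" for W'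
  proof -
    have "sum V W' * gen g - gen g =
      (V (left_vertex g) * gen g - gen g) + (\<Sum>w\<in>W' - {left_vertex g}. V w * gen g)"
      using that by (simp add: sum.remove[of W' "left_vertex g"] sum_distrib_right algebra_simps)
    also have "\<dots> \<in> L"
      using that side_vertices[OF gk(1)] side_vertices_neq[OF gk(1)]
      by (intro L_basic(3) L_sum) auto
    finally show ?thesis .
  qed
  have two: "gen k * sum V W' - gen k \<in> L"
    if "finite W'" "right_vertex k \<in> W'" "W' \<subseteq> verts E" for W'
  proof -
    have "gen k * sum V W' - gen k =
      (gen k * V (right_vertex k) - gen k) + (\<Sum>w\<in>W' - {right_vertex k}. gen k * V w)"
      using that by (simp add: sum.remove[of W' "right_vertex k"] sum_distrib_left algebra_simps)
    also have "\<dots> \<in> L"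
      using that side_vertices[OF gk(2)] side_vertices_neq[OF gk(2)]
      by (intro L_basic(3) L_sum) auto
    finally show ?thesis .
  qed
  show ?case
  proof (intro exI[of _ "{left_vertex g, right_vertex k}"] conjI allI impI)
    show "{left_vertex g, right_vertex k} \<subseteq> verts E" using side_vertices gk by simp
    fix W' assume W': "finite W' \<and> {left_vertex g, right_vertex k} \<subseteq> W' \<and> W' \<subseteq> verts E"
    have "cst c * ((sum V W' * gen g - gen g) * a) \<in> L"
      using L_words(1)[OF L_words(2)[OF one ab(1)] words_basic(3)] W' by simp
    also have "cst c * ((sum V W' * gen g - gen g) * a) =
      sum V W' * (cst c * prod_list (map gen gs)) - cst c * prod_list (map gen gs)"
      unfolding eq(1) by (simp add: cst_commute algebra_simps)
    finally show "sum V W' * (cst c * prod_list (map gen gs)) - cst c * prod_list (map gen gs) \<in> L" .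
    have "cst c * b * (gen k * sum V W' - gen k) \<in> L"
      using L_words(1)[OF two words_mult[OF words_basic(3) ab(2)]] W' by simp
    also have "cst c * b * (gen k * sum V W' - gen k) =
      (cst c * prod_list (map gen gs)) * sum V W' - cst c * prod_list (map gen gs)"
      unfolding eq(2) by (simp add: algebra_simps)
    finally show "(cst c * prod_list (map gen gs)) * sum V W' - cst c * prod_list (map gen gs) \<in> L" .
  qed simp
next
  case (add a b)
  from add(1) obtain Wa where Wa: "finite Wa" "Wa \<subseteq> verts E"
    "\<forall>W'. finite W' \<and> Wa \<subseteq> W' \<and> W' \<subseteq> verts E \<longrightarrow> sum V W' * a - a \<in> L \<and> a * sum V W' - a \<in> L"
    by (elim exE conjE)
  from add(2) obtain Wb where Wb: "finite Wb" "Wb \<subseteq> verts E"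
    "\<forall>W'. finite W' \<and> Wb \<subseteq> W' \<and> W' \<subseteq> verts E \<longrightarrow> sum V W' * b - b \<in> L \<and> b * sum V W' - b \<in> L"
    by (elim exE conjE)
  show ?case
  proof (intro exI[of _ "Wa \<union> Wb"] conjI allI impI)
    fix W' assume W': "finite W' \<and> Wa \<union> Wb \<subseteq> W' \<and> W' \<subseteq> verts E"
    then have "sum V W' * a - a \<in> L \<and> a * sum V W' - a \<in> L" "sum V W' * b - b \<in> L \<and> b * sum V W' - b \<in> L"
      using Wa(3) Wb(3) by simp_all
    then have "(sum V W' * a - a) + (sum V W' * b - b) \<in> L" "(a * sum V W' - a) + (b * sum V W' - b) \<in> L"
      by (simp_all only: L_basic(3))
    then show "sum V W' * (a + b) - (a + b) \<in> L" "(a + b) * sum V W' - (a + b) \<in> L"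
      by (simp_all add: algebra_simps)
  qed (use Wa(1,2) Wb(1,2) in auto)
next
  case zero
  then show ?case using L_basic(2) by auto
qed

end

section \<open>Congruence modulo an ideal that contains the relations\<close>

locale leavitt_ideal = leavitt E K for E :: "('v, 'e) pre_digraph" and K :: "'k::field itself" +
  fixes P :: "('v, 'e, 'k) words set"
  assumes lid: "lid P"
begin

lemmas P_basic = ideal_basic[OF lid[unfolded lid_def, THEN conjunct1]]

lemma L_P: "x \<in> L \<Longrightarrow> x \<in> P"
  using lid by (auto simp: lid_def)

text \<open>Scalar closure is not part of \<open>lid\<close>. It follows because, modulo
  \<open>L\<close>, the scalar can be moved into a local unit, and \<open>cst c * sum V W\<close>
  lies in \<open>FA\<close>.\<close>

lemma P_cst: "f \<in> P \<Longrightarrow> cst c * f \<in> P"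
proof -
  assume f: "f \<in> P"
  then have "f \<in> FA" using P_basic(1) by blast
  then obtain W where W: "finite W" "W \<subseteq> verts E" "sum V W * f - f \<in> L" using local_units by blast
  have "cst c * f = (cst c * sum V W) * f - cst c * (sum V W * f - f)" by (simp add: algebra_simps)
  also have "\<dots> \<in> P"
    using W(2) by (intro P_basic(5)[OF P_basic(6)[OF f FA_mult(1)[OF words_basic(3)]]
          L_P[OF L_words(1)[OF W(3) words_basic(3)]]] FA_sum V_FA) blast
  finally show ?thesis .
qed

lemma P_words:
  assumes "p \<in> P" "a \<in> words_ring"
  shows "a * p \<in> P" "p * a \<in> P"
proof -
  obtain c b where ab: "a = cst c + b" "b \<in> FA" using words_decomp assms by blast
  show "a * p \<in> P" "p * a \<in> P"
    using P_basic(3,6,7) P_cst[OF assms(1)] ab assms(1) by (simp_all add: algebra_simps cst_commute[symmetric])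
qed

lemma P_sum: "(\<And>i. i \<in> A \<Longrightarrow> h i \<in> P) \<Longrightarrow> sum h A \<in> P"
  by (induction A rule: infinite_finite_induct) (auto intro: P_basic)

definition cg :: "('v, 'e, 'k) words \<Rightarrow> ('v, 'e, 'k) words \<Rightarrow> bool"
  (infix "\<approx>" 50) where "a \<approx> b \<longleftrightarrow> a - b \<in> P"

lemma cg_refl [simp]: "a \<approx> a" using P_basic(2) by (simp add: cg_def)
lemma cg_sym: "a \<approx> b \<Longrightarrow> b \<approx> a" using P_basic(4)[of "a - b"] by (simp add: cg_def)
lemma cg_trans [trans]: "a \<approx> b \<Longrightarrow> b \<approx> c \<Longrightarrow> a \<approx> c"
  using P_basic(3)[of "a - b" "b - c"] by (simp add: cg_def)
lemma cg_mem: "a \<approx> b \<Longrightarrow> a \<in> P \<longleftrightarrow> b \<in> P"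
  using P_basic(3)[of "a - b" b] P_basic(5)[of a "a - b"] by (auto simp: cg_def)
lemma cg_zero: "a \<in> P \<longleftrightarrow> a \<approx> 0" by (simp add: cg_def)
lemma cg_add: "a \<approx> b \<Longrightarrow> c \<approx> d \<Longrightarrow> a + c \<approx> b + d"
  using P_basic(3)[of "a - b" "c - d"] by (simp add: cg_def algebra_simps)
lemma cg_l: "a \<approx> b \<Longrightarrow> x \<in> words_ring \<Longrightarrow> x * a \<approx> x * b"
  using P_words(1)[of "a - b" x] by (simp add: cg_def algebra_simps)
lemma cg_r: "a \<approx> b \<Longrightarrow> x \<in> words_ring \<Longrightarrow> a * x \<approx> b * x"
  using P_words(2)[of "a - b" x] by (simp add: cg_def algebra_simps)
lemma cg_lr: "a \<approx> b \<Longrightarrow> x \<in> words_ring \<Longrightarrow> y \<in> words_ring \<Longrightarrow> x * a * y \<approx> x * b * y"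
  by (intro cg_l cg_r)
lemma cg_mult: "a \<approx> b \<Longrightarrow> c \<approx> d \<Longrightarrow> b \<in> words_ring \<Longrightarrow> c \<in> words_ring \<Longrightarrow> a * c \<approx> b * d"
  by (rule cg_trans[OF cg_r cg_l])
end

section \<open>Real paths, ghost paths and their products\<close>

context leavitt
begin

definition rp :: "'e list \<Rightarrow> ('v, 'e, 'k) words" where
  "rp \<mu> = prod_list (map ed \<mu>)"

definition gp :: "'e list \<Rightarrow> ('v, 'e, 'k) words" where
  "gp \<mu> = prod_list (map gh (rev \<mu>))"

text \<open>
  The factor \<open>V u\<close> matters for the empty path: \<open>rp [] = 1\<close> does not lie in the algebra.
\<close>

definition pe :: "'v \<Rightarrow> 'e list \<Rightarrow> ('v, 'e, 'k) words" where
  "pe u \<mu> = V u * rp \<mu>"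

definition ge :: "'e list \<Rightarrow> 'v \<Rightarrow> ('v, 'e, 'k) words" where
  "ge \<mu> u = gp \<mu> * V u"

lemma rp_simps [simp]: "rp [] = 1" "rp (e # \<mu>) = ed e * rp \<mu>" "rp (\<mu> @ \<nu>) = rp \<mu> * rp \<nu>"
  by (simp_all add: rp_def)

lemma gp_simps [simp]: "gp [] = 1" "gp (e # \<mu>) = gp \<mu> * gh e" "gp (\<mu> @ \<nu>) = gp \<nu> * gp \<mu>"
  by (simp_all add: gp_def)

lemma rp_words [simp]: "set \<mu> \<subseteq> arcs E \<Longrightarrow> rp \<mu> \<in> words_ring"
  by (induction \<mu>) simp_all

lemma gp_words [simp]: "set \<mu> \<subseteq> arcs E \<Longrightarrow> gp \<mu> \<in> words_ring"
  by (induction \<mu>) simp_all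

lemma pe_FA [simp]: "u \<in> verts E \<Longrightarrow> set \<mu> \<subseteq> arcs E \<Longrightarrow> pe u \<mu> \<in> FA"
  and ge_FA [simp]: "u \<in> verts E \<Longrightarrow> set \<mu> \<subseteq> arcs E \<Longrightarrow> ge \<mu> u \<in> FA"
  by (simp_all add: pe_def ge_def)

lemma pe_words [simp]: "u \<in> verts E \<Longrightarrow> set \<mu> \<subseteq> arcs E \<Longrightarrow> pe u \<mu> \<in> words_ring"
  and ge_words [simp]: "u \<in> verts E \<Longrightarrow> set \<mu> \<subseteq> arcs E \<Longrightarrow> ge \<mu> u \<in> words_ring"
  by (simp_all add: FA_words)

lemma awalkD: "awalk u p w \<Longrightarrow> u \<in> verts E" "awalk u p w \<Longrightarrow> set p \<subseteq> arcs E" "awalk u p w \<Longrightarrow> w \<in> verts E"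
  by (auto simp: awalk_hd_in_verts awalk_last_in_verts)

end

context leavitt_ideal
begin

lemma vertex_edge:
  "v \<in> verts E \<Longrightarrow> V v * V v \<approx> V v"
  "e \<in> arcs E \<Longrightarrow> V (tail E e) * ed e \<approx> ed e"
  "e \<in> arcs E \<Longrightarrow> ed e * V (head E e) \<approx> ed e"
  "e \<in> arcs E \<Longrightarrow> V (head E e) * gh e \<approx> gh e"
  "e \<in> arcs E \<Longrightarrow> gh e * V (tail E e) \<approx> gh e"
  "e \<in> arcs E \<Longrightarrow> gh e * ed e \<approx> V (head E e)"
  using lpa_relations.intros(1,3-7)[THEN subsetD[OF relations_L], THEN L_P]
  unfolding cg_def V_def ed_def gh_def by blast+

lemma vertex_edge_neq:
  "v \<in> verts E \<Longrightarrow> w \<in> verts E \<Longrightarrow> v \<noteq> w \<Longrightarrow> V v * V w \<in> P"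
  "e \<in> arcs E \<Longrightarrow> w \<in> verts E \<Longrightarrow> w \<noteq> tail E e \<Longrightarrow> V w * ed e \<in> P"
  "e \<in> arcs E \<Longrightarrow> w \<in> verts E \<Longrightarrow> w \<noteq> head E e \<Longrightarrow> ed e * V w \<in> P"
  "e \<in> arcs E \<Longrightarrow> w \<in> verts E \<Longrightarrow> w \<noteq> head E e \<Longrightarrow> V w * gh e \<in> P"
  "e \<in> arcs E \<Longrightarrow> w \<in> verts E \<Longrightarrow> w \<noteq> tail E e \<Longrightarrow> gh e * V w \<in> P"
  "e \<in> arcs E \<Longrightarrow> f \<in> arcs E \<Longrightarrow> e \<noteq> f \<Longrightarrow> gh e * ed f \<in> P"
proof -
  have g: "e \<in> arcs E \<Longrightarrow> Edge e \<in> lpa_gens E" "e \<in> arcs E \<Longrightarrow> Ghost e \<in> lpa_gens E"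
    by (simp_all add: lpa_gens_def)
  show "v \<in> verts E \<Longrightarrow> w \<in> verts E \<Longrightarrow> v \<noteq> w \<Longrightarrow> V v * V w \<in> P" by (intro L_P V_orth)
  show "e \<in> arcs E \<Longrightarrow> w \<in> verts E \<Longrightarrow> w \<noteq> tail E e \<Longrightarrow> V w * ed e \<in> P"
    using side_vertices_neq(1)[OF g(1)] by (simp add: ed_def L_P)
  show "e \<in> arcs E \<Longrightarrow> w \<in> verts E \<Longrightarrow> w \<noteq> head E e \<Longrightarrow> ed e * V w \<in> P"
    using side_vertices_neq(2)[OF g(1)] by (simp add: ed_def L_P)
  show "e \<in> arcs E \<Longrightarrow> w \<in> verts E \<Longrightarrow> w \<noteq> head E e \<Longrightarrow> V w * gh e \<in> P"
    using side_vertices_neq(1)[OF g(2)] by (simp add: gh_def L_P)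
  show "e \<in> arcs E \<Longrightarrow> w \<in> verts E \<Longrightarrow> w \<noteq> tail E e \<Longrightarrow> gh e * V w \<in> P"
    using side_vertices_neq(2)[OF g(2)] by (simp add: gh_def L_P)
  show "e \<in> arcs E \<Longrightarrow> f \<in> arcs E \<Longrightarrow> e \<noteq> f \<Longrightarrow> gh e * ed f \<in> P"
    using lpa_relations.ghost_edge_neq[THEN subsetD[OF relations_L], THEN L_P]
    unfolding ed_def gh_def by blast
qed

lemma vertex_sum: "v \<in> verts E \<Longrightarrow> out_arcs E v \<noteq> {} \<Longrightarrow> V v \<approx> (\<Sum>e\<in>out_arcs E v. ed e * gh e)"
  using lpa_relations.vertex_sum[THEN subsetD[OF relations_L], THEN L_P]
  unfolding cg_def V_def ed_def gh_def by blast

lemma pe_Cons: "e \<in> arcs E \<Longrightarrow> set \<mu> \<subseteq> arcs E \<Longrightarrow> pe (tail E e) (e # \<mu>) \<approx> ed e * pe (head E e) \<mu>"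
proof -
  assume *: "e \<in> arcs E" "set \<mu> \<subseteq> arcs E"
  have "pe (tail E e) (e # \<mu>) = V (tail E e) * ed e * rp \<mu>" by (simp add: pe_def mult.assoc)
  also have "\<dots> \<approx> ed e * rp \<mu>" using * by (intro cg_r vertex_edge) simp_all
  also have "\<dots> \<approx> (ed e * V (head E e)) * rp \<mu>"
    using * by (intro cg_r cg_sym[OF vertex_edge(3)]) simp_all
  finally show ?thesis by (simp add: pe_def mult.assoc)
qed

lemma ge_Cons: "e \<in> arcs E \<Longrightarrow> set \<mu> \<subseteq> arcs E \<Longrightarrow> ge (e # \<mu>) (tail E e) \<approx> ge \<mu> (head E e) * gh e"
proof -
  assume *: "e \<in> arcs E" "set \<mu> \<subseteq> arcs E"
  have "ge (e # \<mu>) (tail E e) = gp \<mu> * (gh e * V (tail E e))" by (simp add: ge_def mult.assoc)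
  also have "\<dots> \<approx> gp \<mu> * gh e" using * by (intro cg_l vertex_edge) simp_all
  also have "\<dots> \<approx> gp \<mu> * (V (head E e) * gh e)"
    using * by (intro cg_l cg_sym[OF vertex_edge(4)]) simp_all
  finally show ?thesis by (simp add: ge_def mult.assoc)
qed

lemma V_pe:
  assumes "u \<in> verts E" "set \<mu> \<subseteq> arcs E"
  shows "V u * pe u \<mu> \<approx> pe u \<mu>" "w \<in> verts E \<Longrightarrow> w \<noteq> u \<Longrightarrow> V w * pe u \<mu> \<in> P"
  using cg_r[OF vertex_edge(1), of u "rp \<mu>"] P_words(2)[OF vertex_edge_neq(1), of w u "rp \<mu>"] assms
  by (simp_all add: pe_def mult.assoc)

lemma ge_V:
  assumes "u \<in> verts E" "set \<mu> \<subseteq> arcs E"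
  shows "ge \<mu> u * V u \<approx> ge \<mu> u" "w \<in> verts E \<Longrightarrow> w \<noteq> u \<Longrightarrow> ge \<mu> u * V w \<in> P"
  using cg_l[OF vertex_edge(1), of u "gp \<mu>"] P_words(1)[OF vertex_edge_neq(1), of u w "gp \<mu>"] assms
  by (auto simp: ge_def mult.assoc)

lemma pe_V:
  assumes "awalk u \<mu> w"
  shows "pe u \<mu> * V w \<approx> pe u \<mu>"
  using assms
proof (induction \<mu> arbitrary: u)
  case Nil
  then show ?case using vertex_edge(1) by (auto simp: pe_def awalk_Nil_iff)
next
  case (Cons e \<mu>)
  then have e: "e \<in> arcs E" "u = tail E e" "awalk (head E e) \<mu> w" by (auto simp: awalk_Cons_iff)
  note d = awalkD[OF e(3)]
  have "pe u (e # \<mu>) * V w \<approx> ed e * pe (head E e) \<mu> * V w"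
    using e d pe_Cons by (intro cg_r) auto
  also have "\<dots> = ed e * (pe (head E e) \<mu> * V w)" by (simp add: mult.assoc)
  also have "\<dots> \<approx> ed e * pe (head E e) \<mu>" using e Cons.IH by (intro cg_l) auto
  also have "\<dots> \<approx> pe u (e # \<mu>)" using e d pe_Cons cg_sym by auto
  finally show ?case .
qed

lemma V_ge:
  assumes "awalk u \<mu> w"
  shows "V w * ge \<mu> u \<approx> ge \<mu> u"
  using assms
proof (induction \<mu> arbitrary: u)
  case Nil
  then show ?case using vertex_edge(1) by (auto simp: ge_def awalk_Nil_iff)
next
  case (Cons e \<mu>)
  then have e: "e \<in> arcs E" "u = tail E e" "awalk (head E e) \<mu> w" by (auto simp: awalk_Cons_iff)
  note d = awalkD[OF e(3)]
  have "V w * ge (e # \<mu>) u \<approx> V w * (ge \<mu> (head E e) * gh e)"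
    using e d ge_Cons by (intro cg_l) auto
  also have "\<dots> = V w * ge \<mu> (head E e) * gh e" by (simp add: mult.assoc)
  also have "\<dots> \<approx> ge \<mu> (head E e) * gh e" using e Cons.IH by (intro cg_r) auto
  also have "\<dots> \<approx> ge (e # \<mu>) u" using e d ge_Cons cg_sym by auto
  finally show ?case .
qed

lemma pe_append:
  assumes "awalk u \<mu> w" "set \<nu> \<subseteq> arcs E"
  shows "pe u (\<mu> @ \<nu>) \<approx> pe u \<mu> * pe w \<nu>"
  using cg_r[OF cg_sym[OF pe_V[OF assms(1)]], of "rp \<nu>"] assms(2)
  by (simp add: pe_def mult.assoc)

lemma ge_append:
  assumes "awalk u \<mu> w" "set \<nu> \<subseteq> arcs E"
  shows "ge (\<mu> @ \<nu>) u \<approx> ge \<nu> w * ge \<mu> u"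
  using cg_l[OF cg_sym[OF V_ge[OF assms(1)]], of "gp \<nu>"] assms(2)
  by (simp add: ge_def mult.assoc)

lemma ge_pe:
  assumes "awalk u \<mu> w"
  shows "ge \<mu> u * pe u \<mu> \<approx> V w"
  using assms
proof (induction \<mu> arbitrary: u)
  case Nil
  then show ?case using vertex_edge(1) by (auto simp: pe_def ge_def awalk_Nil_iff)
next
  case (Cons e \<mu>)
  then have e: "e \<in> arcs E" "u = tail E e" "awalk (head E e) \<mu> w" by (auto simp: awalk_Cons_iff)
  note d = awalkD[OF e(3)]
  have "ge (e # \<mu>) u * pe u (e # \<mu>) \<approx> (ge \<mu> (head E e) * gh e) * (ed e * pe (head E e) \<mu>)"
    using e d ge_Cons pe_Cons by (intro cg_mult) auto
  also have "\<dots> = ge \<mu> (head E e) * (gh e * ed e) * pe (head E e) \<mu>" by (simp add: mult.assoc)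
  also have "\<dots> \<approx> ge \<mu> (head E e) * V (head E e) * pe (head E e) \<mu>"
    using e d by (intro cg_lr vertex_edge) auto
  also have "\<dots> \<approx> ge \<mu> (head E e) * pe (head E e) \<mu>"
    using e d by (intro cg_r ge_V) auto
  also have "\<dots> \<approx> V w" using e Cons.IH by auto
  finally show ?case .
qed

lemma ge_pe_append:
  assumes "awalk u \<mu> w" "set \<nu> \<subseteq> arcs E"
  shows "ge \<mu> u * pe u (\<mu> @ \<nu>) \<approx> pe w \<nu>" "ge (\<mu> @ \<nu>) u * pe u \<mu> \<approx> ge \<nu> w"
proof -
  note d = awalkD[OF assms(1)]
  have "ge \<mu> u * pe u (\<mu> @ \<nu>) \<approx> ge \<mu> u * (pe u \<mu> * pe w \<nu>)"
    using d by (intro cg_l pe_append assms) auto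
  also have "\<dots> = ge \<mu> u * pe u \<mu> * pe w \<nu>" by (simp add: mult.assoc)
  also have "\<dots> \<approx> V w * pe w \<nu>" using d assms by (intro cg_r ge_pe) auto
  also have "\<dots> \<approx> pe w \<nu>" using d assms by (intro V_pe) auto
  finally show "ge \<mu> u * pe u (\<mu> @ \<nu>) \<approx> pe w \<nu>" .
  have "ge (\<mu> @ \<nu>) u * pe u \<mu> \<approx> (ge \<nu> w * ge \<mu> u) * pe u \<mu>"
    using d by (intro cg_r ge_append assms) auto
  also have "\<dots> = ge \<nu> w * (ge \<mu> u * pe u \<mu>)" by (simp add: mult.assoc)
  also have "\<dots> \<approx> ge \<nu> w * V w" using d assms by (intro cg_l ge_pe) auto
  also have "\<dots> \<approx> ge \<nu> w" using d assms by (intro ge_V) auto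
  finally show "ge (\<mu> @ \<nu>) u * pe u \<mu> \<approx> ge \<nu> w" .
qed

text \<open>The common initial part cancels until a ghost edge meets a different edge with the same
  source.\<close>

lemma ge_pe_incomparable:
  assumes "awalk u \<mu> w" "awalk u \<nu> z" "\<not> prefix \<mu> \<nu>" "\<not> prefix \<nu> \<mu>"
  shows "ge \<mu> u * pe u \<nu> \<in> P"
  using assms
proof (induction \<mu> arbitrary: u \<nu>)
  case (Cons e \<mu>)
  then obtain f \<nu>' where \<nu>: "\<nu> = f # \<nu>'" by (cases \<nu>) auto
  have e: "e \<in> arcs E" "u = tail E e" "awalk (head E e) \<mu> w" using Cons.prems by (auto simp: awalk_Cons_iff)
  have f: "f \<in> arcs E" "u = tail E f" "awalk (head E f) \<nu>' z" using Cons.prems \<nu> by (auto simp: awalk_Cons_iff)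
  note d = awalkD[OF e(3)] and d' = awalkD[OF f(3)]
  have "ge (e # \<mu>) u * pe u (f # \<nu>') \<approx> (ge \<mu> (head E e) * gh e) * (ed f * pe (head E f) \<nu>')"
    using e f d d' ge_Cons[of e \<mu>] pe_Cons[of f \<nu>'] by (intro cg_mult) auto
  also have "\<dots> = ge \<mu> (head E e) * (gh e * ed f) * pe (head E f) \<nu>'" by (simp add: mult.assoc)
  finally have *: "ge (e # \<mu>) u * pe u (f # \<nu>') \<approx> \<dots>" .
  show ?case
  proof (cases "e = f")
    case False
    then have "ge \<mu> (head E e) * (gh e * ed f) * pe (head E f) \<nu>' \<in> P"
      using e f d d' by (intro P_words vertex_edge_neq) auto
    then show ?thesis using cg_mem[OF *] \<nu> by simp
  next
    case True
    have "ge \<mu> (head E e) * (gh e * ed f) * pe (head E f) \<nu>' \<approx>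
      ge \<mu> (head E e) * V (head E e) * pe (head E f) \<nu>'"
      unfolding True using f d d' True by (intro cg_lr vertex_edge) auto
    also have "\<dots> \<approx> ge \<mu> (head E e) * pe (head E f) \<nu>'"
      using True f d d' by (intro cg_r ge_V) auto
    finally have "ge (e # \<mu>) u * pe u (f # \<nu>') \<approx> ge \<mu> (head E e) * pe (head E f) \<nu>'"
      using * cg_trans by blast
    moreover have "ge \<mu> (head E e) * pe (head E f) \<nu>' \<in> P"
      using Cons.IH[OF e(3), of \<nu>'] f(3) Cons.prems(3,4) \<nu> True by simp
    ultimately show ?thesis using cg_mem \<nu> by blast
  qed
qed simp

lemma ge_pe_orth:
  assumes "set \<mu> \<subseteq> arcs E" "set \<nu> \<subseteq> arcs E" "u \<in> verts E" "w \<in> verts E" "u \<noteq> w"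
  shows "ge \<mu> u * pe w \<nu> \<in> P"
proof -
  have "gp \<mu> * (V u * V w) * rp \<nu> \<in> P"
    using assms by (intro P_words vertex_edge_neq) auto
  then show ?thesis by (simp add: ge_def pe_def mult.assoc)
qed

text \<open>Exposes the common range of both paths: the monomial lies in \<open>P\<close> whenever
  that vertex does.\<close>

lemma pe_ge_mid:
  assumes "awalk u \<mu> w" "awalk t \<nu> w"
  shows "pe u \<mu> * ge \<nu> t \<approx> pe u \<mu> * V w * ge \<nu> t"
  using awalkD[OF assms(1)] awalkD[OF assms(2)] by (intro cg_sym[OF cg_r[OF pe_V[OF assms(1)]]]) auto

text \<open>A generator on the left annihilates the monomial, leaves it alone, extends \<mu> or
  cancels its first edge. Only a ghost edge that meets an empty \<mu> changes the ghost part: it is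
  appended to \<nu>.\<close>

lemma gen_mono:
  assumes g: "g \<in> lpa_gens E" and \<mu>: "awalk u \<mu> w" and \<nu>: "awalk t \<nu> w"
  shows "gen g * (pe u \<mu> * ge \<nu> t) \<in> P \<or>
    (\<exists>u' \<mu>' \<nu>' w'. awalk u' \<mu>' w' \<and> awalk t \<nu>' w' \<and> gen g * (pe u \<mu> * ge \<nu> t) \<approx> pe u' \<mu>' * ge \<nu>' t)"
proof (cases "right_vertex g = u")
  case False
  note d = awalkD[OF \<mu>] and d' = awalkD[OF \<nu>]
  have "gen g * V u \<in> P" using side_vertices_neq(2)[OF g d(1)] False L_P by auto
  then have "gen g * V u * (rp \<mu> * ge \<nu> t) \<in> P" by (rule P_words(2)) (use d d' in simp)
  then show ?thesis by (simp add: pe_def mult.assoc)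
next
  case True
  note d = awalkD[OF \<mu>] and d' = awalkD[OF \<nu>]
  consider v where "g = Vertex v" "v \<in> verts E" | e where "g = Edge e" "e \<in> arcs E"
    | e where "g = Ghost e" "e \<in> arcs E"
    using g by (auto simp: lpa_gens_def)
  then show ?thesis
  proof cases
    case (1 v)
    then have "gen g = V u" using True by (simp add: V_def)
    then have "gen g * (pe u \<mu> * ge \<nu> t) \<approx> pe u \<mu> * ge \<nu> t"
      using cg_r[OF V_pe(1)[OF d(1,2)], of "ge \<nu> t"] d' by (simp add: mult.assoc)
    then show ?thesis using \<mu> \<nu> by blast
  next
    case (2 e)
    then have u: "u = head E e" "gen g = ed e" using True by (simp_all add: ed_def)
    have "gen g * (pe u \<mu> * ge \<nu> t) \<approx> pe (tail E e) (e # \<mu>) * ge \<nu> t"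
      using cg_r[OF cg_sym[OF pe_Cons[OF 2(2) d(2)]], of "ge \<nu> t"] d' by (simp add: mult.assoc u)
    moreover have "awalk (tail E e) (e # \<mu>) w" using \<mu> u 2 by (simp add: awalk_Cons_iff)
    ultimately show ?thesis using \<nu> by blast
  next
    case (3 e)
    then have u: "u = tail E e" "gen g = gh e" using True by (simp_all add: gh_def)
    show ?thesis
    proof (cases \<mu>)
      case Nil
      then have w: "w = u" using \<mu> by (simp add: awalk_Nil_iff)
      have "gen g * (pe u \<mu> * ge \<nu> t) = (gh e * V (tail E e)) * ge \<nu> t"
        by (simp add: Nil pe_def u mult.assoc)
      also have "\<dots> \<approx> gh e * ge \<nu> t" using d' 3 by (intro cg_r vertex_edge) auto
      also have "\<dots> \<approx> (V (head E e) * gh e) * ge \<nu> t"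
        using d' 3 by (intro cg_r cg_sym[OF vertex_edge(4)]) auto
      also have "\<dots> = pe (head E e) [] * ge (\<nu> @ [e]) t" by (simp add: pe_def ge_def mult.assoc)
      finally have "gen g * (pe u \<mu> * ge \<nu> t) \<approx> pe (head E e) [] * ge (\<nu> @ [e]) t" .
      moreover have "awalk t (\<nu> @ [e]) (head E e)" "awalk (head E e) [] (head E e)"
        using \<nu> w u 3 by (auto simp: awalk_Cons_iff awalk_Nil_iff)
      ultimately show ?thesis by blast
    next
      case (Cons f \<mu>')
      have f: "f \<in> arcs E" "u = tail E f" "awalk (head E f) \<mu>' w" using \<mu> Cons by (auto simp: awalk_Cons_iff)
      note df = awalkD[OF f(3)]
      have "gen g * (pe u \<mu> * ge \<nu> t) = gh e * pe u (f # \<mu>') * ge \<nu> t"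
        by (simp add: Cons u mult.assoc)
      also have "\<dots> \<approx> gh e * (ed f * pe (head E f) \<mu>') * ge \<nu> t"
        using pe_Cons[of f \<mu>'] f df d' 3 by (intro cg_lr) auto
      also have "\<dots> = (gh e * ed f) * (pe (head E f) \<mu>' * ge \<nu> t)" by (simp add: mult.assoc)
      finally have *: "gen g * (pe u \<mu> * ge \<nu> t) \<approx> (gh e * ed f) * (pe (head E f) \<mu>' * ge \<nu> t)" .
      show ?thesis
      proof (cases "e = f")
        case False
        then have "(gh e * ed f) * (pe (head E f) \<mu>' * ge \<nu> t) \<in> P"
          using f df d' 3 by (intro P_words vertex_edge_neq) auto
        then show ?thesis using cg_mem[OF *] by simp
      next
        case True
        note *
        also have "(gh e * ed f) * (pe (head E f) \<mu>' * ge \<nu> t) \<approx> V (head E f) * (pe (head E f) \<mu>' * ge \<nu> t)"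
          unfolding True using f df d' by (intro cg_r vertex_edge) auto
        also have "\<dots> = V (head E f) * pe (head E f) \<mu>' * ge \<nu> t" by (simp add: mult.assoc)
        also have "\<dots> \<approx> pe (head E f) \<mu>' * ge \<nu> t" using df d' by (intro cg_r V_pe) auto
        finally show ?thesis using f \<nu> by blast
      qed
    qed
  qed
qed

lemma gen_is_mono:
  assumes g: "g \<in> lpa_gens E"
  shows "\<exists>u \<mu> t \<nu> w. awalk u \<mu> w \<and> awalk t \<nu> w \<and> gen g \<approx> pe u \<mu> * ge \<nu> t"
proof -
  define r where "r = right_vertex g"
  have r: "r \<in> verts E" "gen g * V r \<approx> gen g"
    using side_vertices[OF g] L_P by (auto simp: r_def cg_def)
  have "gen g * V r * V r \<approx> gen g * V r" using r by (intro cg_r) auto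
  then have eq: "gen g * (pe r [] * ge [] r) \<approx> gen g"
    using r(2) cg_trans by (simp add: pe_def ge_def mult.assoc)
  have nil: "awalk r [] r" using r by (simp add: awalk_Nil_iff)
  consider "gen g * (pe r [] * ge [] r) \<in> P"
    | u' \<mu>' \<nu>' w' where "awalk u' \<mu>' w'" "awalk r \<nu>' w'" "gen g * (pe r [] * ge [] r) \<approx> pe u' \<mu>' * ge \<nu>' r"
    using gen_mono[OF g nil nil] by blast
  then show ?thesis
  proof cases
    case 2
    then show ?thesis using cg_trans[OF cg_sym[OF eq]] by blast
  next
    case 1
    consider v where "g = Vertex v" "v \<in> verts E" | e where "g = Edge e" "e \<in> arcs E"
      | e where "g = Ghost e" "e \<in> arcs E"
      using g by (auto simp: lpa_gens_def)
    then show ?thesis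
    proof cases
      case (1 v)
      then have "gen g \<approx> pe v [] * ge [] v" using cg_sym[OF vertex_edge(1)] by (simp add: V_def pe_def ge_def)
      then show ?thesis using 1 awalk_Nil_iff by blast
    next
      case (2 e)
      have "ed e \<approx> V (tail E e) * ed e" using 2 by (intro cg_sym[OF vertex_edge(2)])
      also have "\<dots> \<approx> V (tail E e) * (ed e * V (head E e))"
        using 2 by (intro cg_l cg_sym[OF vertex_edge(3)]) auto
      also have "\<dots> = pe (tail E e) [e] * ge [] (head E e)" by (simp add: pe_def ge_def mult.assoc)
      finally have "gen g \<approx> \<dots>" using 2 by (simp add: ed_def)
      moreover have "awalk (tail E e) [e] (head E e)" "awalk (head E e) [] (head E e)"
        using 2 by (auto simp: awalk_Cons_iff awalk_Nil_iff)
      ultimately show ?thesis by blast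
    next
      case (3 e)
      have "gh e \<approx> V (head E e) * gh e" using 3 by (intro cg_sym[OF vertex_edge(4)])
      also have "\<dots> \<approx> V (head E e) * (gh e * V (tail E e))"
        using 3 by (intro cg_l cg_sym[OF vertex_edge(5)]) auto
      also have "\<dots> = pe (head E e) [] * ge [e] (tail E e)" by (simp add: pe_def ge_def mult.assoc)
      finally have "gen g \<approx> \<dots>" using 3 by (simp add: gh_def)
      moreover have "awalk (tail E e) [e] (head E e)" "awalk (head E e) [] (head E e)"
        using 3 by (auto simp: awalk_Cons_iff awalk_Nil_iff)
      ultimately show ?thesis by blast
    qed
  qed
qed

lemma word_mono:
  assumes "gs \<noteq> []" "set gs \<subseteq> lpa_gens E"
  shows "(prod_list (map gen gs) :: ('v, 'e, 'k) words) \<in> P \<or>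
    (\<exists>u \<mu> t \<nu> w. awalk u \<mu> w \<and> awalk t \<nu> w \<and> prod_list (map gen gs) \<approx> pe u \<mu> * ge \<nu> t)"
  using assms
proof (induction gs rule: list_nonempty_induct)
  case (single g)
  then show ?case using gen_is_mono[of g] by simp
next
  case (cons g gs)
  then have g: "g \<in> lpa_gens E" by simp
  consider "(prod_list (map gen gs) :: ('v, 'e, 'k) words) \<in> P"
    | u \<mu> t \<nu> w where "awalk u \<mu> w" "awalk t \<nu> w" "prod_list (map gen gs) \<approx> pe u \<mu> * ge \<nu> t"
    using cons by auto
  then show ?case
  proof cases
    case 1
    then show ?thesis using P_words(1)[OF 1 gen_words[OF g]] by simp
  next
    case 2
    have eq: "prod_list (map gen (g # gs)) \<approx> gen g * (pe u \<mu> * ge \<nu> t)"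
      using cg_l[OF 2(3) gen_words[OF g]] by simp
    show ?thesis
      using gen_mono[OF g 2(1,2)] cg_mem[OF eq] cg_trans[OF eq] by blast
  qed
qed

text \<open>Induction along the spanning set of monomials. A word agrees with a scaled monomial only
  up to an element of \<open>P\<close>, so the property has to hold on \<open>P\<close> as
  well.\<close>

lemma FA_span [consumes 1, case_names mem mono add]:
  assumes "f \<in> FA"
    and mem: "\<And>x. x \<in> P \<Longrightarrow> Q x"
    and mono: "\<And>c u \<mu> t \<nu> w. awalk u \<mu> w \<Longrightarrow> awalk t \<nu> w \<Longrightarrow> Q (cst c * (pe u \<mu> * ge \<nu> t))"
    and add: "\<And>a b. Q a \<Longrightarrow> Q b \<Longrightarrow> Q (a + b)"
  shows "Q f"
  using assms(1)
proof (induction rule: FA_induct)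
  case (word gs c)
  consider "(prod_list (map gen gs) :: ('v, 'e, 'k) words) \<in> P"
    | u \<mu> t \<nu> w where "awalk u \<mu> w" "awalk t \<nu> w" "prod_list (map gen gs) \<approx> pe u \<mu> * ge \<nu> t"
    using word_mono[OF word] by blast
  then show ?case
  proof cases
    case 1
    then show ?thesis using mem P_words(1) by simp
  next
    case 2
    have "cst c * (prod_list (map gen gs) - pe u \<mu> * ge \<nu> t) \<in> P"
      using 2(3) by (intro P_words) (auto simp: cg_def)
    then have "Q (cst c * (prod_list (map gen gs) - pe u \<mu> * ge \<nu> t) + cst c * (pe u \<mu> * ge \<nu> t))"
      by (intro add mem mono[OF 2(1,2)])
    then show ?thesis by (simp add: algebra_simps)
  qed
qed (use mem P_basic add in auto)

end

section \<open>Prime ideals and maximal tails\<close>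

lemma (in leavitt) local_unit_sum:
  assumes "f \<in> FA"
  obtains W where "finite W" "W \<subseteq> verts E" "sum V W * f - f \<in> L" "f * sum V W - f \<in> L"
proof -
  obtain W where W: "finite W" "W \<subseteq> verts E" "\<forall>W'. finite W' \<and> W \<subseteq> W' \<and> W' \<subseteq> verts E \<longrightarrow>
    sum V W' * f - f \<in> L \<and> f * sum V W' - f \<in> L"
    using local_units[OF assms] by (elim exE conjE)
  show ?thesis using W(1,2) W(3)[rule_format, of W] by (intro that[of W]) simp_all
qed

lemma (in leavitt) awalk_append_awalk:
  "awalk u p x \<Longrightarrow> awalk u (p @ q) z \<longleftrightarrow> awalk x q z"
  by (auto simp: awalk_append_iff)

context leavitt_ideal
begin

text \<open>Sandwiching \<open>V v\<close> between the ghost of a path and the path itself gives the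
  vertex at its end.\<close>

lemma V_mem_connects:
  assumes "connects E v w" "V v \<in> P"
  shows "V w \<in> P"
proof -
  obtain p where p: "awalk v p w" using assms by (auto simp: connects_def)
  note d = awalkD[OF p]
  have "ge p v * pe v p \<in> P"
    using assms(2) d unfolding pe_def by (intro P_words) auto
  then show ?thesis using cg_mem[OF ge_pe[OF p]] by simp
qed

text \<open>Otherwise every term \<open>ed e * gh e\<close> of the vertex relation would lie in
  \<open>P\<close>, since it factors through \<open>V (head E e)\<close>.\<close>

lemma V_notin_step:
  assumes v: "v \<in> verts E" "out_arcs E v \<noteq> {}" "V v \<notin> P"
  shows "\<exists>e\<in>arcs E. tail E e = v \<and> V (head E e) \<notin> P"
proof (rule ccontr)
  assume n: "\<not> ?thesis"
  have "ed e * gh e \<in> P" if e: "e \<in> out_arcs E v" for e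
  proof -
    have e': "e \<in> arcs E" "tail E e = v" using e by auto
    then have "V (head E e) \<in> P" using n by blast
    then have "ed e * (V (head E e) * gh e) \<in> P" using e' by (intro P_words) auto
    moreover have "ed e * (V (head E e) * gh e) \<approx> ed e * gh e"
      using e' by (intro cg_l vertex_edge) auto
    ultimately show ?thesis using cg_mem by blast
  qed
  then have "(\<Sum>e\<in>out_arcs E v. ed e * gh e) \<in> P" by (rule P_sum)
  then show False using cg_mem[OF vertex_sum[OF v(1,2)]] v(3) by simp
qed

text \<open>If no such \<open>y\<close> existed, each monomial of \<open>x\<close> whose two paths
  start at \<open>v\<close> and \<open>w\<close> would have its middle vertex in \<open>P\<close>;
  all other monomials are killed by \<open>V v\<close> or \<open>V w\<close>.\<close>

lemma V_common:
  assumes v: "v \<in> verts E" and w: "w \<in> verts E" and x: "x \<in> FA" "V v * x * V w \<notin> P"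
  shows "\<exists>y\<in>verts E. V y \<notin> P \<and> connects E v y \<and> connects E w y"
proof (rule ccontr)
  assume n: "\<not> ?thesis"
  have "V v * x * V w \<in> P" using x(1)
  proof (induction rule: FA_span)
    case (mem x)
    then show ?case using v w by (intro P_words) auto
  next
    case (mono c u \<mu> t \<nu> y)
    note d = awalkD[OF mono(1)] and d' = awalkD[OF mono(2)]
    have eq: "V v * (cst c * (pe u \<mu> * ge \<nu> t)) * V w = cst c * (V v * pe u \<mu> * (ge \<nu> t * V w))"
      using cst_commute[of c "V v"] by (simp add: mult.assoc[symmetric])
    show ?case
    proof (cases "v = u \<and> w = t")
      case True
      then have "V y \<in> P" using n mono by (auto simp: connects_def d)
      then have "pe u \<mu> * V y * ge \<nu> t \<in> P" using d d' by (intro P_words) auto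
      then have "pe u \<mu> * ge \<nu> t \<in> P" using cg_mem[OF pe_ge_mid[OF mono]] by simp
      moreover have "V v * pe u \<mu> * (ge \<nu> t * V w) \<approx> pe u \<mu> * ge \<nu> t"
        using V_pe(1)[OF d(1,2)] ge_V(1)[OF d'(1,2)] True d d' w by (intro cg_mult) auto
      ultimately have "V v * pe u \<mu> * (ge \<nu> t * V w) \<in> P" using cg_mem by blast
      then show ?thesis unfolding eq by (rule P_words(1)) simp
    next
      case False
      then consider "v \<noteq> u" | "w \<noteq> t" by blast
      then have "V v * pe u \<mu> * (ge \<nu> t * V w) \<in> P"
      proof cases
        case 1
        then show ?thesis using d d' v w by (intro P_words(2)[OF V_pe(2)]) auto
      next
        case 2
        then show ?thesis using d d' v w by (intro P_words(1)[OF ge_V(2)]) auto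
      qed
      then show ?thesis unfolding eq by (rule P_words(1)) simp
    qed
  next
    case (add a b)
    then show ?case using P_basic(3) by (simp add: algebra_simps)
  qed
  then show False using x by simp
qed

text \<open>Finite sums of vertices are local units, so an ideal that contains all vertices is
  everything.\<close>

lemma proper_vertex:
  assumes "P \<noteq> FA"
  shows "\<exists>v\<in>verts E. V v \<notin> P"
proof (rule ccontr)
  assume n: "\<not> ?thesis"
  have "FA \<subseteq> P"
  proof
    fix f assume f: "f \<in> FA"
    obtain W where W: "finite W" "W \<subseteq> verts E" "sum V W * f - f \<in> L" by (rule local_unit_sum[OF f])
    have "sum V W \<in> P" using n W by (intro P_sum) auto
    then have "sum V W * f - (sum V W * f - f) \<in> P"
      by (rule P_basic(5)[OF P_words(2)[OF _ FA_words[OF f]] L_P[OF W(3)]])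
    then show "f \<in> P" by simp
  qed
  then show False using assms P_basic(1) by blast
qed

text \<open>Primeness is what gives directedness: it supplies an \<open>x\<close> with
  \<open>V v * x * V w\<close> outside \<open>P\<close>, to which \<open>V_common\<close>
  applies.\<close>

theorem prime_maximal_tail:
  assumes "P \<noteq> FA" and prime: "\<And>a b. a \<in> FA \<Longrightarrow> b \<in> FA \<Longrightarrow> (\<And>x. x \<in> FA \<Longrightarrow> a * x * b \<in> P) \<Longrightarrow> a \<in> P \<or> b \<in> P"
  shows "{v \<in> verts E. V v \<notin> P} \<in> maximal_tails E"
  unfolding maximal_tails_def
proof (rule CollectI, intro conjI ballI impI)
  show "{v \<in> verts E. V v \<notin> P} \<subseteq> verts E" by blast
  show "{v \<in> verts E. V v \<notin> P} \<noteq> {}" using proper_vertex assms(1) by blast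
next
  fix v w assume "v \<in> verts E" "w \<in> {v \<in> verts E. V v \<notin> P}" "connects E v w"
  then show "v \<in> {v \<in> verts E. V v \<notin> P}" using V_mem_connects by blast
next
  fix v assume "v \<in> {v \<in> verts E. V v \<notin> P}" "out_arcs E v \<noteq> {}"
  then obtain e where "e \<in> arcs E" "tail E e = v" "V (head E e) \<notin> P" using V_notin_step by blast
  then show "\<exists>e\<in>arcs E. tail E e = v \<and> head E e \<in> {v \<in> verts E. V v \<notin> P}" by auto
next
  fix v w assume vw: "v \<in> {v \<in> verts E. V v \<notin> P}" "w \<in> {v \<in> verts E. V v \<notin> P}"
  then obtain x where "x \<in> FA" "V v * x * V w \<notin> P" using prime[of "V v" "V w"] by auto
  then show "\<exists>y\<in>{v \<in> verts E. V v \<notin> P}. connects E v y \<and> connects E w y"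
    using V_common[of v w x] vw by auto
qed

end

section \<open>Reduction of an element to a combination of real paths\<close>

context leavitt
begin

text \<open>Lists rather than finitely supported functions: paths may repeat, so nothing has to be
  collected after an operation, and the length of the list serves as an induction measure.\<close>

definition lin :: "'v \<Rightarrow> ('k \<times> 'e list) list \<Rightarrow> ('v, 'e, 'k) words" where
  "lin t l = (\<Sum>(c, \<mu>)\<leftarrow>l. cst c * pe t \<mu>)"

lemma lin_simps [simp]: "lin t [] = 0" "lin t ((c, \<mu>) # l) = cst c * pe t \<mu> + lin t l"
  "lin t (l @ l') = lin t l + lin t l'"
  by (simp_all add: lin_def)

lemma lin_words [simp]: "t \<in> verts E \<Longrightarrow> (\<And>c \<mu>. (c, \<mu>) \<in> set l \<Longrightarrow> set \<mu> \<subseteq> arcs E) \<Longrightarrow> lin t l \<in> words_ring"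
proof (induction l)
  case (Cons x l)
  obtain c \<mu> where x: "x = (c, \<mu>)" by (cases x)
  then have "set \<mu> \<subseteq> arcs E" using Cons.prems(2)[of c \<mu>] by simp
  moreover have "lin t l \<in> words_ring" using Cons by auto
  ultimately show ?case using Cons.prems(1) by (simp add: x)
qed simp

end

context leavitt_ideal
begin

definition real_combination :: "'v \<Rightarrow> 'v \<Rightarrow> ('v, 'e, 'k) words \<Rightarrow> bool" where
  "real_combination t w x \<longleftrightarrow> (\<exists>l. (\<forall>(c, \<mu>)\<in>set l. awalk t \<mu> w) \<and> x \<approx> lin t l)"

lemma real_combinationI:
  "(\<And>c \<mu>. (c, \<mu>) \<in> set l \<Longrightarrow> awalk t \<mu> w) \<Longrightarrow> x \<approx> lin t l \<Longrightarrow> real_combination t w x"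
  unfolding real_combination_def by (intro exI[of _ l]) auto

lemma real_combination_add:
  assumes "real_combination t w x" "real_combination t w y"
  shows "real_combination t w (x + y)"
proof -
  obtain l where l: "\<forall>(c, \<mu>)\<in>set l. awalk t \<mu> w" "x \<approx> lin t l"
    using assms(1) unfolding real_combination_def by blast
  obtain l' where l': "\<forall>(c, \<mu>)\<in>set l'. awalk t \<mu> w" "y \<approx> lin t l'"
    using assms(2) unfolding real_combination_def by blast
  show ?thesis
    by (rule real_combinationI[of "l @ l'"]) (use l l' cg_add[OF l(2) l'(2)] in auto)
qed

text \<open>A ghost path \<rho> is cancelled by every \<nu> that is at least as long: either \<rho>
  is a prefix of \<nu> or the product vanishes. A shorter \<nu> that ends at a sink is not a proper
  prefix of \<rho>, since \<rho> could not continue there. So \<open>N\<close> bounds the lengths of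
  the ghost paths in \<open>a\<close>.\<close>

lemma real_span:
  assumes a: "a \<in> FA" and t: "t \<in> verts E"
  shows "\<exists>N. \<forall>u \<nu> w. awalk u \<nu> w \<longrightarrow> length \<nu> \<ge> N \<or> out_arcs E w = {} \<longrightarrow>
    real_combination t w (V t * a * pe u \<nu>)"
  using a
proof (induction rule: FA_span)
  case (mem x)
  have "real_combination t w (V t * x * pe u \<nu>)" if "awalk u \<nu> w" for u \<nu> w
  proof (rule real_combinationI[of "[]"])
    have "V t * x * pe u \<nu> \<in> P" using mem t awalkD[OF that] by (simp add: P_words)
    then show "V t * x * pe u \<nu> \<approx> lin t []" by (simp add: cg_zero)
  qed simp
  then show ?case by blast
next
  case (add a b)
  then obtain N1 N2 where
    N: "\<And>u \<nu> w. awalk u \<nu> w \<Longrightarrow> length \<nu> \<ge> N1 \<or> out_arcs E w = {} \<Longrightarrow> real_combination t w (V t * a * pe u \<nu>)"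
      "\<And>u \<nu> w. awalk u \<nu> w \<Longrightarrow> length \<nu> \<ge> N2 \<or> out_arcs E w = {} \<Longrightarrow> real_combination t w (V t * b * pe u \<nu>)"
    by blast
  have "real_combination t w (V t * (a + b) * pe u \<nu>)"
    if "awalk u \<nu> w" "max N1 N2 \<le> length \<nu> \<or> out_arcs E w = {}" for u \<nu> w
    using real_combination_add[OF N[OF that(1)]] that(2) by (auto simp: algebra_simps)
  then show ?case by blast
next
  case (mono c s \<mu> r \<rho> y)
  note d = awalkD[OF mono(1)] and d' = awalkD[OF mono(2)]
  have "real_combination t w (V t * (cst c * (pe s \<mu> * ge \<rho> r)) * pe u \<nu>)"
    if \<nu>: "awalk u \<nu> w" and len: "length \<rho> \<le> length \<nu> \<or> out_arcs E w = {}" for u \<nu> w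
  proof -
    note dn = awalkD[OF \<nu>]
    have eq: "V t * (cst c * (pe s \<mu> * ge \<rho> r)) * pe u \<nu> = cst c * ((V t * pe s \<mu>) * (ge \<rho> r * pe u \<nu>))"
      using cst_commute[of c "V t"] by (simp add: mult.assoc[symmetric])
    have zero: ?thesis if "(V t * pe s \<mu>) * (ge \<rho> r * pe u \<nu>) \<in> P"
      unfolding eq by (rule real_combinationI[of "[]"]) (use that in \<open>simp_all add: cg_zero[symmetric] P_words\<close>)
    show ?thesis
    proof (cases "t = s \<and> r = u")
      case False
      then consider "t \<noteq> s" | "r \<noteq> u" by blast
      then show ?thesis
      proof cases
        case 1
        then show ?thesis using d d' dn t by (intro zero P_words(2)[OF V_pe(2)]) auto
      next
        case 2
        then show ?thesis using d d' dn t by (intro zero P_words(1)[OF ge_pe_orth]) auto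
      qed
    next
      case True
      show ?thesis
      proof (cases "prefix \<rho> \<nu>")
        case True2: True
        then obtain \<delta> where \<delta>: "\<nu> = \<rho> @ \<delta>" by (auto simp: prefix_def)
        have r\<rho>: "awalk u \<rho> y" using mono True by simp
        have \<delta>w: "awalk y \<delta> w" using \<nu> awalk_append_awalk[OF r\<rho>] unfolding \<delta> by blast
        have "(V t * pe s \<mu>) * (ge \<rho> r * pe u \<nu>) \<approx> pe s \<mu> * pe y \<delta>"
          using V_pe(1)[OF d(1,2)] ge_pe_append(1)[OF r\<rho>, of \<delta>] True d d' dn t \<delta> by (intro cg_mult) auto
        also have "\<dots> \<approx> pe t (\<mu> @ \<delta>)" 
          using True cg_sym[OF pe_append[OF mono(1)]] awalkD[OF \<delta>w] by auto
        finally have "cst c * ((V t * pe s \<mu>) * (ge \<rho> r * pe u \<nu>)) \<approx> lin t [(c, \<mu> @ \<delta>)]"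
          using cg_l by simp
        moreover have "awalk t (\<mu> @ \<delta>) w" using awalk_append_awalk[OF mono(1)] \<delta>w True by simp
        ultimately show ?thesis unfolding eq by (intro real_combinationI[of "[(c, \<mu> @ \<delta>)]"]) auto
      next
        case False
        have "\<not> prefix \<nu> \<rho>"
        proof
          assume "prefix \<nu> \<rho>"
          then obtain \<delta> where \<delta>: "\<rho> = \<nu> @ \<delta>" by (auto simp: prefix_def)
          then have "\<delta> \<noteq> []" using False by auto
          then obtain e \<delta>' where e: "\<delta> = e # \<delta>'" by (cases \<delta>) auto
          have "awalk w \<delta> y" using mono(2) awalk_append_awalk[OF \<nu>] \<open>t = s \<and> r = u\<close> unfolding \<delta> by blast
          then have "e \<in> out_arcs E w" using e by (auto simp: awalk_Cons_iff)
          then show False using len \<delta> e by auto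
        qed
        then have "ge \<rho> r * pe u \<nu> \<in> P"
          using ge_pe_incomparable[of u \<rho> y \<nu> w] mono(2) \<nu> False True by simp
        then show ?thesis using t d by (intro zero P_words(1)[of "ge \<rho> r * pe u \<nu>"]) auto
      qed
    qed
  qed
  then show ?case by (intro exI[of _ "length \<rho>"]) blast
qed

lemma notin_left_vertex:
  assumes "f \<in> FA" "f \<notin> P"
  shows "\<exists>t\<in>verts E. V t * f \<notin> P"
proof (rule ccontr)
  assume n: "\<not> ?thesis"
  obtain W where W: "finite W" "W \<subseteq> verts E" "sum V W * f - f \<in> L" by (rule local_unit_sum[OF assms(1)])
  have "sum V W * f \<in> P" unfolding sum_distrib_right using n W by (intro P_sum) auto
  then have "sum V W * f - (sum V W * f - f) \<in> P" by (rule P_basic(5)[OF _ L_P[OF W(3)]])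
  then show False using assms by simp
qed

lemma notin_right_vertex:
  assumes "f \<in> FA" "f \<notin> P"
  shows "\<exists>t\<in>verts E. f * V t \<notin> P"
proof (rule ccontr)
  assume n: "\<not> ?thesis"
  obtain W where W: "finite W" "W \<subseteq> verts E" "f * sum V W - f \<in> L" by (rule local_unit_sum[OF assms(1)])
  have "f * sum V W \<in> P" unfolding sum_distrib_left using n W by (intro P_sum) auto
  then have "f * sum V W - (f * sum V W - f) \<in> P" by (rule P_basic(5)[OF _ L_P[OF W(3)]])
  then show False using assms by simp
qed

text \<open>Expanding the vertex at the end of \<nu> by the vertex relation shows that some
  extension of \<nu> by one edge survives, unless that vertex is a sink.\<close>

lemma notin_long_path:
  assumes "a \<in> FA" "a \<notin> P"
  shows "\<exists>u \<nu> w. awalk u \<nu> w \<and> (length \<nu> \<ge> n \<or> out_arcs E w = {}) \<and> a * pe u \<nu> \<notin> P"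
proof (induction n)
  case 0
  obtain u where "u \<in> verts E" "a * V u \<notin> P" using notin_right_vertex assms by blast
  then show ?case by (intro exI[of _ u] exI[of _ "[]"]) (simp add: awalk_Nil_iff pe_def)
next
  case (Suc n)
  then obtain u \<nu> w where \<nu>: "awalk u \<nu> w" "length \<nu> \<ge> n \<or> out_arcs E w = {}" "a * pe u \<nu> \<notin> P" by blast
  note d = awalkD[OF \<nu>(1)]
  show ?case
  proof (cases "out_arcs E w = {}")
    case True
    then show ?thesis using \<nu> by blast
  next
    case False
    have "\<exists>e\<in>out_arcs E w. a * pe u (\<nu> @ [e]) \<notin> P"
    proof (rule ccontr)
      assume n: "\<not> ?thesis"
      have "a * pe u \<nu> \<approx> a * (pe u \<nu> * V w)"
        using assms d by (intro cg_l cg_sym[OF pe_V[OF \<nu>(1)]]) (auto simp: FA_words)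
      also have "\<dots> \<approx> a * (pe u \<nu> * (\<Sum>e\<in>out_arcs E w. ed e * gh e))"
        using assms d False by (intro cg_l vertex_sum) (auto simp: FA_words)
      also have "\<dots> = (\<Sum>e\<in>out_arcs E w. a * pe u (\<nu> @ [e]) * gh e)"
        by (simp add: pe_def sum_distrib_left mult.assoc)
      finally have "a * pe u \<nu> \<approx> \<dots>" .
      moreover have "(\<Sum>e\<in>out_arcs E w. a * pe u (\<nu> @ [e]) * gh e) \<in> P"
        using n by (intro P_sum) (rule P_words(2), auto)
      ultimately show False using cg_mem \<nu>(3) by blast
    qed
    then obtain e where e: "e \<in> out_arcs E w" "a * pe u (\<nu> @ [e]) \<notin> P" by blast
    then have "awalk u (\<nu> @ [e]) (head E e)"
      using \<nu>(1) by (auto simp: awlast_if_cas awalk_Cons_iff awalk_Nil_iff)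
    moreover have "length (\<nu> @ [e]) \<ge> Suc n" using \<nu>(2) False by simp
    ultimately show ?thesis using e(2) by blast
  qed
qed

lemma gh_lin:
  assumes "\<And>c \<mu>. (c, \<mu>) \<in> set l \<Longrightarrow> \<mu> \<noteq> [] \<and> awalk t \<mu> w" and e: "e \<in> arcs E"
  shows "gh e * lin t l \<approx> lin (head E e) [(c, tl \<mu>). (c, \<mu>) \<leftarrow> l, hd \<mu> = e]"
  using assms(1)
proof (induction l)
  case (Cons x l)
  obtain c \<mu> where x: "x = (c, \<mu>)" by (cases x)
  then obtain f \<mu>' where f: "\<mu> = f # \<mu>'" "awalk t \<mu> w" using Cons.prems by (cases \<mu>) auto
  then have f': "f \<in> arcs E" "t = tail E f" "awalk (head E f) \<mu>' w" by (auto simp: awalk_Cons_iff)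
  note d = awalkD[OF f'(3)]
  have IH: "gh e * lin t l \<approx> lin (head E e) [(c, tl \<mu>). (c, \<mu>) \<leftarrow> l, hd \<mu> = e]"
    by (rule Cons.IH) (use Cons.prems in auto)
  have "gh e * (cst c * pe t \<mu>) = cst c * (gh e * pe t \<mu>)"
    using cst_commute[of c "gh e"] by (simp add: mult.assoc[symmetric])
  also have "\<dots> \<approx> cst c * (gh e * (ed f * pe (head E f) \<mu>'))"
    using f f' d e pe_Cons[of f \<mu>'] by (intro cg_l) auto
  also have "\<dots> \<approx> (if e = f then cst c * pe (head E e) \<mu>' else 0)"
  proof (cases "e = f")
    case True
    have "gh e * (ed f * pe (head E f) \<mu>') \<approx> V (head E e) * pe (head E e) \<mu>'"
      using True f' d by (auto simp: mult.assoc[symmetric] intro!: cg_r vertex_edge)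
    also have "\<dots> \<approx> pe (head E e) \<mu>'" using True d by (intro V_pe) auto
    finally show ?thesis using True cg_l by simp
  next
    case False
    have "gh e * ed f * pe (head E f) \<mu>' \<in> P"
      using False f' d e by (intro P_words(2) vertex_edge_neq) auto
    then show ?thesis using False P_words(1) by (simp add: cg_zero[symmetric] mult.assoc)
  qed
  finally have "gh e * (cst c * pe t \<mu>) \<approx> \<dots>" .
  from cg_add[OF this IH] show ?case by (auto simp: x f(1) algebra_simps)
qed simp

text \<open>Since \<gamma> is nonempty, \<open>\<gamma> @ \<alpha>\<close> is longer than \<alpha>.
  Hence the ghost of \<alpha> either cancels an initial part of it or annihilates it.\<close>

lemma conj_lin:
  assumes \<alpha>: "awalk w \<alpha> y" and "\<And>c \<gamma>. (c, \<gamma>) \<in> set l \<Longrightarrow> \<gamma> \<noteq> [] \<and> awalk w \<gamma> w"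
  shows "ge \<alpha> w * lin w l * pe w \<alpha> \<approx>
    lin y [(c, drop (length \<alpha>) (\<gamma> @ \<alpha>)). (c, \<gamma>) \<leftarrow> l, prefix \<alpha> (\<gamma> @ \<alpha>)]"
  using assms(2)
proof (induction l)
  case (Cons x l)
  note d = awalkD[OF \<alpha>]
  obtain c \<gamma> where x: "x = (c, \<gamma>)" by (cases x)
  then have \<gamma>: "\<gamma> \<noteq> []" "awalk w \<gamma> w" using Cons.prems by auto
  note d' = awalkD[OF \<gamma>(2)]
  have IH: "ge \<alpha> w * lin w l * pe w \<alpha> \<approx>
    lin y [(c, drop (length \<alpha>) (\<gamma> @ \<alpha>)). (c, \<gamma>) \<leftarrow> l, prefix \<alpha> (\<gamma> @ \<alpha>)]"
    by (rule Cons.IH) (use Cons.prems in auto)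
  have \<gamma>\<alpha>: "awalk w (\<gamma> @ \<alpha>) y" using \<gamma>(2) \<alpha> by (auto simp: awlast_if_cas)
  have "ge \<alpha> w * (cst c * pe w \<gamma>) * pe w \<alpha> = cst c * (ge \<alpha> w * (pe w \<gamma> * pe w \<alpha>))"
    using cst_commute[of c "ge \<alpha> w"] by (simp add: mult.assoc[symmetric])
  also have "\<dots> \<approx> cst c * (ge \<alpha> w * pe w (\<gamma> @ \<alpha>))"
    using d d' by (intro cg_l cg_sym[OF pe_append[OF \<gamma>(2)]]) auto
  also have "\<dots> \<approx> (if prefix \<alpha> (\<gamma> @ \<alpha>) then cst c * pe y (drop (length \<alpha>) (\<gamma> @ \<alpha>)) else 0)"
  proof (cases "prefix \<alpha> (\<gamma> @ \<alpha>)")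
    case True
    then obtain \<delta> where \<delta>: "\<gamma> @ \<alpha> = \<alpha> @ \<delta>" by (auto simp: prefix_def)
    have s: "set \<delta> \<subseteq> arcs E" using d d' \<delta> by (metis set_append Un_subset_iff)
    have "drop (length \<alpha>) (\<gamma> @ \<alpha>) = \<delta>" using \<delta> by (metis append_eq_conv_conj)
    then show ?thesis using True cg_l[OF ge_pe_append(1)[OF \<alpha> s]] \<delta> by simp
  next
    case False
    have "\<not> prefix (\<gamma> @ \<alpha>) \<alpha>" using \<gamma>(1) prefix_length_le by fastforce
    then have "ge \<alpha> w * pe w (\<gamma> @ \<alpha>) \<in> P" using ge_pe_incomparable[OF \<alpha> \<gamma>\<alpha>] False by blast
    then show ?thesis using False P_words(1) by (simp add: cg_zero[symmetric])
  qed
  finally have "ge \<alpha> w * (cst c * pe w \<gamma>) * pe w \<alpha> \<approx> \<dots>" .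
  from cg_add[OF this IH] show ?case by (auto simp: x algebra_simps)
qed simp

text \<open>
  Conjugating by \<open>\<alpha>\<close> fixes the vertex term and kills the closed paths \<open>\<gamma>\<close> for which \<open>\<alpha>\<close> is not a
  prefix of \<open>\<gamma> @ \<alpha>\<close>, so that the number of closed paths can be decreased.
\<close>

lemma vertex_from_closed_paths:
  assumes exit: "\<And>w \<gamma>. w \<in> M \<Longrightarrow> awalk w \<gamma> w \<Longrightarrow> \<gamma> \<noteq> [] \<Longrightarrow>
      \<exists>\<alpha> y. awalk w \<alpha> y \<and> y \<in> M \<and> \<not> prefix \<alpha> (\<gamma> @ \<alpha>)"
    and "w \<in> M" "w \<in> verts E" "k \<noteq> 0"
    and "\<And>c \<gamma>. (c, \<gamma>) \<in> set l \<Longrightarrow> \<gamma> \<noteq> [] \<and> awalk w \<gamma> w"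
    and "cst k * V w + lin w l \<in> P"
  shows "\<exists>u\<in>M. V u \<in> P"
  using assms(2-)
proof (induction "length l" arbitrary: l w rule: less_induct)
  case less
  show ?case
  proof (cases l)
    case Nil
    then have "cst (1 / k) * (cst k * V w) \<in> P" using less.prems by (intro P_words(1)[of "cst k * V w"]) auto
    then show ?thesis using less.prems by (auto simp: mult.assoc[symmetric] cst_mult)
  next
    case (Cons x l')
    obtain c \<gamma> where x: "x = (c, \<gamma>)" by (cases x)
    then have \<gamma>: "\<gamma> \<noteq> []" "awalk w \<gamma> w" using less.prems(4) Cons by auto
    obtain \<alpha> y where \<alpha>: "awalk w \<alpha> y" "y \<in> M" "\<not> prefix \<alpha> (\<gamma> @ \<alpha>)"
      using exit[OF less.prems(1) \<gamma>(2,1)] by blast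
    note d = awalkD[OF \<alpha>(1)]
    define l2 where "l2 = [(c, drop (length \<alpha>) (\<gamma> @ \<alpha>)). (c, \<gamma>) \<leftarrow> l, prefix \<alpha> (\<gamma> @ \<alpha>)]"
    have "length [(c, drop (length \<alpha>) (\<gamma> @ \<alpha>)). (c, \<gamma>) \<leftarrow> l', prefix \<alpha> (\<gamma> @ \<alpha>)] \<le> length l'"
      by (induction l') auto
    then have len: "length l2 < length l" using \<alpha>(3) by (simp add: l2_def Cons x)
    have "ge \<alpha> w * (cst k * V w + lin w l) * pe w \<alpha> \<in> P"
      using d less.prems(5) by (intro P_words) auto
    moreover have "ge \<alpha> w * (cst k * V w + lin w l) * pe w \<alpha> \<approx> cst k * V y + lin y l2"
    proof -
      have "ge \<alpha> w * (cst k * V w) * pe w \<alpha> = cst k * (ge \<alpha> w * (V w * pe w \<alpha>))"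
        using cst_commute[of k "ge \<alpha> w"] by (simp add: mult.assoc[symmetric])
      also have "\<dots> \<approx> cst k * (ge \<alpha> w * pe w \<alpha>)" using d by (intro cg_l V_pe) auto
      also have "\<dots> \<approx> cst k * V y" by (intro cg_l ge_pe \<alpha>) auto
      finally have "ge \<alpha> w * (cst k * V w) * pe w \<alpha> \<approx> cst k * V y" .
      from cg_add[OF this conj_lin[OF \<alpha>(1) less.prems(4)]]
      show ?thesis by (simp add: l2_def algebra_simps)
    qed
    ultimately have mem: "cst k * V y + lin y l2 \<in> P" using cg_mem by blast
    have cl: "\<gamma> \<noteq> [] \<and> awalk y \<gamma> y" if mem: "(c, \<gamma>) \<in> set l2" for c \<gamma>
    proof -
      obtain \<beta> where \<beta>: "(c, \<beta>) \<in> set l" "prefix \<alpha> (\<beta> @ \<alpha>)" "\<gamma> = drop (length \<alpha>) (\<beta> @ \<alpha>)"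
        using mem by (auto simp: l2_def)
      then have eq: "\<beta> @ \<alpha> = \<alpha> @ \<gamma>" by (metis append_eq_conv_conj prefix_def)
      have "awalk w \<beta> w" "\<beta> \<noteq> []" using less.prems(4) \<beta> by auto
      then have "awalk w (\<alpha> @ \<gamma>) y" unfolding eq[symmetric] by (simp only: awalk_append_awalk \<alpha>(1))
      then have "awalk y \<gamma> y" by (simp only: awalk_append_awalk[OF \<alpha>(1)])
      \<comment> \<open>A surviving closed path keeps its length under conjugation, so it stays
        nonempty, as the induction requires.\<close>
      moreover have "length \<gamma> = length \<beta>" using arg_cong[OF eq, of length] by simp
      ultimately show ?thesis using \<open>\<beta> \<noteq> []\<close> by auto
    qed
    show ?thesis using less.hyps[OF len \<alpha>(2) d(3) less.prems(3) cl mem] .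
  qed
qed

text \<open>Two ideals are played against each other: the combination stays in \<open>P\<close> and
  outside \<open>I\<close>. If the empty path has total coefficient \<open>k \<noteq> 0\<close>,
  then \<open>t = w\<close> and all paths are closed, which is the case of
  \<open>vertex_from_closed_paths\<close>. Otherwise the vertex relation at \<open>t\<close> yields
  an edge \<open>e\<close> such that \<open>gh e\<close> keeps the combination outside
  \<open>I\<close>, and this shortens all paths.\<close>

lemma vertex_from_real_paths:
  assumes I: "leavitt_ideal E I" and M: "\<And>u. u \<in> verts E \<Longrightarrow> V u \<in> I \<longleftrightarrow> u \<notin> M"
    and exit: "\<And>w \<gamma>. w \<in> M \<Longrightarrow> awalk w \<gamma> w \<Longrightarrow> \<gamma> \<noteq> [] \<Longrightarrow>
      \<exists>\<alpha> y. awalk w \<alpha> y \<and> y \<in> M \<and> \<not> prefix \<alpha> (\<gamma> @ \<alpha>)"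
    and l: "\<And>c \<mu>. (c, \<mu>) \<in> set l \<Longrightarrow> awalk t \<mu> w \<and> length \<mu> \<le> N"
    and t: "t \<in> verts E" "w \<in> verts E" and mem: "lin t l \<notin> I" "lin t l \<in> P"
  shows "\<exists>u\<in>M. V u \<in> P"
  using l t mem
proof (induction N arbitrary: t l rule: less_induct)
  case (less N t l)
  interpret I: leavitt_ideal E K I by (rule I)
  define k where "k = (\<Sum>(c, \<mu>)\<leftarrow>l. if \<mu> = [] then c else 0)"
  define l' where "l' = filter (\<lambda>(c, \<mu>). \<mu> \<noteq> []) l"
  have split: "lin t l = cst k * V t + lin t l'"
    unfolding k_def l'_def
    by (induction l) (auto simp: pe_def cst_add[symmetric] algebra_simps)
  have l': "\<mu> \<noteq> [] \<and> awalk t \<mu> w \<and> length \<mu> \<le> N" if "(c, \<mu>) \<in> set l'" for c \<mu>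
    using that less.prems(1) by (auto simp: l'_def)
  \<comment> \<open>For \<open>t\<close> outside \<open>M\<close>, the vertex \<open>V t\<close>
    lies in \<open>I\<close> and would pull the whole combination into \<open>I\<close>.\<close>
  have tM: "t \<in> M"
  proof (rule ccontr)
    assume "t \<notin> M"
    then have Vt: "V t \<in> I" using M less.prems(2) by blast
    have "lin t l \<in> I" using less.prems(1)
    proof (induction l)
      case Nil
      then show ?case using I.P_basic(2) by simp
    next
      case (Cons x l)
      obtain c \<mu> where x: "x = (c, \<mu>)" by (cases x)
      then have "set \<mu> \<subseteq> arcs E" using Cons.prems[of c \<mu>] awalkD(2)[of t \<mu> w] by simp
      then have "pe t \<mu> \<in> I" unfolding pe_def using I.P_words(2)[OF Vt] by simp
      then have "cst c * pe t \<mu> \<in> I" using I.P_words(1) by simp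
      moreover have "lin t l \<in> I" by (rule Cons.IH) (use Cons.prems in auto)
      ultimately show ?case using I.P_basic(3) by (simp add: x)
    qed
    then show False using less.prems(4) by simp
  qed
  show ?case
  proof (cases "k = 0")
    case False
    then have "\<exists>c. (c, []) \<in> set l"
    proof (rule contrapos_np)
      assume "\<nexists>c. (c, []) \<in> set l"
      then show "k = 0" unfolding k_def by (induction l) auto
    qed
    then obtain c where "(c, []) \<in> set l" by blast
    then have "t = w" using less.prems(1)[of c "[]"] by (simp add: awalk_Nil_iff)
    then show ?thesis
      using vertex_from_closed_paths[OF exit tM less.prems(2) False, of l'] l' less.prems(5) split
      by simp
  next
    case True
    then have eq: "lin t l = lin t l'" using split by simp
    have "l' \<noteq> []" using less.prems(4) I.P_basic(2) eq by auto
    then obtain c0 \<mu>0 where "(c0, \<mu>0) \<in> set l'" by (metis list.set_intros(1) neq_Nil_conv prod.exhaust)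
    then obtain e0 and \<mu>1 :: "'e list" where e0: "e0 \<in> out_arcs E t" "Suc (length \<mu>1) \<le> N"
    proof -
      have *: "\<mu>0 \<noteq> []" "awalk t \<mu>0 w" "length \<mu>0 \<le> N" using l'[OF \<open>(c0, \<mu>0) \<in> set l'\<close>] by simp_all
      then obtain e \<mu>' where "\<mu>0 = e # \<mu>'" by (cases \<mu>0) auto
      then show ?thesis using * that[of e \<mu>'] by (simp add: awalk_Cons_iff in_out_arcs_conv)
    qed
    have "set \<mu> \<subseteq> arcs E" if "(c, \<mu>) \<in> set l'" for c \<mu>
      using l'[OF that] awalkD(2)[of t \<mu> w] by simp
    then have lw: "lin t l' \<in> words_ring" by (rule lin_words[OF less.prems(2)])
    have V_lin: "I.cg (V t * lin t l') (lin t l')" using l'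
    proof (induction l')
      case (Cons x l')
      obtain c \<mu> where x: "x = (c, \<mu>)" by (cases x)
      then have "set \<mu> \<subseteq> arcs E" using Cons.prems[of c \<mu>] awalkD(2)[of t \<mu> w] by simp
      then have "I.cg (cst c * (V t * pe t \<mu>)) (cst c * pe t \<mu>)"
        using less.prems(2) by (intro I.cg_l I.V_pe(1)) auto
      moreover have "V t * (cst c * pe t \<mu>) = cst c * (V t * pe t \<mu>)"
        using cst_commute[of c "V t"] by (simp add: mult.assoc[symmetric])
      moreover have "I.cg (V t * lin t l') (lin t l')" by (rule Cons.IH) (use Cons.prems in auto)
      ultimately show ?case using I.cg_add by (simp add: x algebra_simps)
    qed simp
    have "\<exists>e\<in>out_arcs E t. gh e * lin t l' \<notin> I"
    proof (rule ccontr)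
      assume n: "\<not> ?thesis"
      have "I.cg (V t * lin t l') ((\<Sum>e\<in>out_arcs E t. ed e * gh e) * lin t l')"
        using e0(1) less.prems(2) lw by (intro I.cg_r I.vertex_sum) auto
      then have "I.cg (lin t l') (\<Sum>e\<in>out_arcs E t. ed e * (gh e * lin t l'))"
        using I.cg_trans[OF I.cg_sym[OF V_lin]] by (simp add: sum_distrib_right mult.assoc)
      moreover have "(\<Sum>e\<in>out_arcs E t. ed e * (gh e * lin t l')) \<in> I"
        using n by (intro I.P_sum) (rule I.P_words(1), auto)
      ultimately show False using I.cg_mem less.prems(4) eq by auto
    qed
    then obtain e where e: "e \<in> out_arcs E t" "gh e * lin t l' \<notin> I" by blast
    then have e': "e \<in> arcs E" "tail E e = t" by auto
    define l2 where "l2 = [(c, tl \<mu>). (c, \<mu>) \<leftarrow> l', hd \<mu> = e]"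
    have l2: "awalk (head E e) \<mu> w \<and> length \<mu> \<le> N - 1" if mem: "(c, \<mu>) \<in> set l2" for c \<mu>
    proof -
      obtain \<mu>' where \<mu>': "(c, \<mu>') \<in> set l'" "hd \<mu>' = e" "\<mu> = tl \<mu>'" using mem by (auto simp: l2_def)
      then have "\<mu>' = e # \<mu>" using l' by (metis list.collapse)
      then show ?thesis using l'[OF \<mu>'(1)] by (auto simp: awalk_Cons_iff)
    qed
    have "I.cg (gh e * lin t l') (lin (head E e) l2)"
      unfolding l2_def using l' by (intro I.gh_lin e') blast
    then have 1: "lin (head E e) l2 \<notin> I" using e(2) I.cg_mem by blast
    have "cg (gh e * lin t l') (lin (head E e) l2)"
      unfolding l2_def using l' by (intro gh_lin e') blast
    moreover have "gh e * lin t l' \<in> P" using less.prems(5) eq e' by (intro P_words(1)) auto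
    ultimately have 2: "lin (head E e) l2 \<in> P" using cg_mem by blast
    have "N - 1 < N" using e0 by simp
    then show ?thesis
      using less.IH[of "N - 1" l2 "head E e"] l2 1 2 e' less.prems(3) by auto
  qed
qed

text \<open>Multiplication by a vertex and a long path turns \<open>a\<close> into a combination of
  real paths. Both factors are chosen so that the product is still outside \<open>I\<close>.\<close>

theorem ideal_contains_vertex:
  assumes I: "leavitt_ideal E I" and M: "\<And>u. u \<in> verts E \<Longrightarrow> V u \<in> I \<longleftrightarrow> u \<notin> M"
    and exit: "\<And>w \<gamma>. w \<in> M \<Longrightarrow> awalk w \<gamma> w \<Longrightarrow> \<gamma> \<noteq> [] \<Longrightarrow>
      \<exists>\<alpha> y. awalk w \<alpha> y \<and> y \<in> M \<and> \<not> prefix \<alpha> (\<gamma> @ \<alpha>)"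
    and a: "a \<in> P" "a \<notin> I"
  shows "\<exists>u\<in>M. V u \<in> P"
proof -
  interpret I: leavitt_ideal E K I by (rule I)
  have aFA: "a \<in> FA" using a(1) P_basic(1) by blast
  obtain t where t: "t \<in> verts E" "V t * a \<notin> I" using I.notin_left_vertex[OF aFA a(2)] by blast
  have VtaFA: "V t * a \<in> FA" using t aFA by simp
  \<comment> \<open>The combination is computed modulo \<open>L\<close>, which lies in both ideals,
    so that the same list represents the element modulo \<open>P\<close> and modulo
    \<open>I\<close>.\<close>
  interpret L: leavitt_ideal E K L by unfold_locales (simp add: lid_def L_ideal)
  obtain N where N: "\<And>u \<nu> w. awalk u \<nu> w \<Longrightarrow> length \<nu> \<ge> N \<or> out_arcs E w = {} \<Longrightarrow>
    L.real_combination t w (V t * a * pe u \<nu>)"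
    using L.real_span[OF aFA t(1)] by blast
  obtain u \<nu> w where \<nu>: "awalk u \<nu> w" "length \<nu> \<ge> N \<or> out_arcs E w = {}" "V t * a * pe u \<nu> \<notin> I"
    using I.notin_long_path[OF VtaFA t(2), of N] by blast
  obtain l where l: "\<forall>(c, \<mu>)\<in>set l. awalk t \<mu> w" "L.cg (V t * a * pe u \<nu>) (lin t l)"
    using N[OF \<nu>(1,2)] unfolding L.real_combination_def by blast
  have "V t * a * pe u \<nu> \<approx> lin t l" "I.cg (V t * a * pe u \<nu>) (lin t l)"
    using l(2) by (simp_all add: L.cg_def cg_def I.cg_def L_P I.L_P)
  moreover have "V t * a * pe u \<nu> \<in> P"
    using a(1) t(1) awalkD[OF \<nu>(1)] by (simp add: P_words)
  ultimately have mem: "lin t l \<notin> I" "lin t l \<in> P" using cg_mem I.cg_mem \<nu>(3) by blast+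
  have "awalk t \<mu> w \<and> length \<mu> \<le> Max (insert 0 ((\<lambda>(c, \<mu>). length \<mu>) ` set l))"
    if "(c, \<mu>) \<in> set l" for c \<mu>
    using l(1) that by (auto intro!: Max_ge disjI2 rev_image_eqI)
  then show ?thesis
    using vertex_from_real_paths[OF I M exit _ t(1) awalkD(3)[OF \<nu>(1)] mem] by blast
qed

end

section \<open>Cycles and exits\<close>

definition cycle_power :: "'b list \<Rightarrow> nat \<Rightarrow> 'b list" where
  "cycle_power c k = concat (replicate k c)"

lemma cycle_power_simps [simp]: "cycle_power c 0 = []" "cycle_power c (Suc k) = c @ cycle_power c k"
  by (simp_all add: cycle_power_def)

lemma cycle_power_add: "cycle_power c (k + l) = cycle_power c k @ cycle_power c l"
  by (simp add: cycle_power_def replicate_add)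

context wf_digraph
begin

text \<open>A repeated source cuts out a shorter closed subwalk.\<close>

lemma closed_awalk_cycle:
  assumes "awalk u p u" "p \<noteq> []"
  shows "\<exists>c. cycle c \<and> set c \<subseteq> set p"
  using assms
proof (induction "length p" arbitrary: u p rule: less_induct)
  case less
  show ?case
  proof (cases "distinct (map (tail G) p)")
    case True
    then show ?thesis using less.prems by (auto simp: cycle_iff_distinct_tails)
  next
    case False
    then obtain xs y ys zs where dec: "map (tail G) p = xs @ [y] @ ys @ [y] @ zs"
      using not_distinct_decomp by blast
    have "map (tail G) p = xs @ ((y # ys) @ (y # zs))" using dec by simp
    from iffD1[OF map_eq_append_conv this]
    obtain p1 p2 where p: "p = p1 @ p2" "(y # ys) @ (y # zs) = map (tail G) p2"
      by (elim exE conjE)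
    from iffD1[OF map_eq_append_conv p(2)[symmetric]]
    obtain q1 q2 where q: "p2 = q1 @ q2" "y # ys = map (tail G) q1" "y # zs = map (tail G) q2"
      by (elim exE conjE)
    obtain e q1' where e: "q1 = e # q1'" using q(2) by (cases q1) simp_all
    obtain f q2' where f: "q2 = f # q2'" using q(3) by (cases q2) simp_all
    have ef: "tail G e = y" "tail G f = y" using q(2,3) e f by simp_all
    have "awalk (tail G e) (e # q1') (tail G f)"
      using less.prems(1) unfolding p(1) q(1) e f by (auto simp: awalk_Cons_iff)
    then have "\<exists>c. cycle c \<and> set c \<subseteq> set q1"
      using less.hyps[of q1 y] e f ef p(1) q(1) by simp
    then show ?thesis using p q by auto
  qed
qed

lemma closed_awalk_head:
  assumes "awalk v c v" "e \<in> set c"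
  shows "head G e \<in> tail G ` set c" "\<exists>q. awalk (tail G e) q v"
proof -
  obtain xs ys where c: "c = xs @ e # ys" using assms(2) by (auto simp: in_set_conv_decomp)
  then have a: "awalk (tail G e) (e # ys) v" using assms(1) by (auto simp: awalk_Cons_iff)
  then show "\<exists>q. awalk (tail G e) q v" by blast
  have h: "awalk (head G e) ys v" using a by (simp add: awalk_Cons_iff)
  have "v \<in> tail G ` set c"
  proof (cases c)
    case (Cons a l)
    then have "v = tail G a" using assms(1) by (simp add: awalk_Cons_iff)
    then show ?thesis using Cons by simp
  qed (use c in simp)
  then show "head G e \<in> tail G ` set c"
    using h c by (cases ys) (auto simp: awalk_Cons_iff awalk_Nil_iff)
qed

lemma connects_trans:
  assumes "connects G u v" "connects G v w"
  shows "connects G u w"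
proof -
  obtain p q where "awalk u p v" "awalk v q w" using assms by (auto simp: connects_def)
  then have "awalk u (p @ q) w" by auto
  then show ?thesis unfolding connects_def by blast
qed

lemma maximal_tailsD:
  assumes "M \<in> maximal_tails G"
  shows "M \<subseteq> verts G" "M \<noteq> {}" "v \<in> verts G \<Longrightarrow> w \<in> M \<Longrightarrow> connects G v w \<Longrightarrow> v \<in> M"
    "v \<in> M \<Longrightarrow> out_arcs G v \<noteq> {} \<Longrightarrow> \<exists>e\<in>arcs G. tail G e = v \<and> head G e \<in> M"
    "v \<in> M \<Longrightarrow> w \<in> M \<Longrightarrow> \<exists>y\<in>M. connects G v y \<and> connects G w y"
  using assms unfolding maximal_tails_def by blast+

lemma maximal_tail_arc:
  assumes "M \<in> maximal_tails G" "e \<in> arcs G" "head G e \<in> M"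
  shows "tail G e \<in> M"
proof -
  have "awalk (tail G e) [e] (head G e)" using assms(2) by (simp add: awalk_Cons_iff awalk_Nil_iff)
  then have "connects G (tail G e) (head G e)" unfolding connects_def by blast
  then show ?thesis using maximal_tailsD(3)[OF assms(1) _ assms(3)] assms(2) by simp
qed

lemma maximal_tail_awalk:
  assumes "M \<in> maximal_tails G" "awalk u p z" "z \<in> M"
  shows "u \<in> M" "\<And>e. e \<in> set p \<Longrightarrow> head G e \<in> M"
proof -
  have "u \<in> M \<and> (\<forall>e\<in>set p. head G e \<in> M)" using assms(2)
  proof (induction p arbitrary: u)
    case Nil
    then show ?case using assms(3) by (simp add: awalk_Nil_iff)
  next
    case (Cons e p)
    then have "e \<in> arcs G" "u = tail G e" "awalk (head G e) p z" by (auto simp: awalk_Cons_iff)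
    then show ?case using Cons.IH maximal_tail_arc[OF assms(1)] by auto
  qed
  then show "u \<in> M" "\<And>e. e \<in> set p \<Longrightarrow> head G e \<in> M" by blast+
qed

lemma tail_graph_simps:
  "verts (tail_graph G M) = M" "arcs (tail_graph G M) = {e \<in> arcs G. head G e \<in> M}"
  "tail (tail_graph G M) = tail G" "head (tail_graph G M) = head G"
  by (simp_all add: tail_graph_def)

lemma wf_tail_graph: "M \<in> maximal_tails G \<Longrightarrow> wf_digraph (tail_graph G M)"
  by unfold_locales (auto simp: tail_graph_simps intro: maximal_tail_arc)

text \<open>Testing the last vertex is enough, because a maximal tail contains all predecessors of
  its vertices.\<close>

lemma awalk_tail_graph_iff:
  assumes M: "M \<in> maximal_tails G"
  shows "pre_digraph.awalk (tail_graph G M) u p z \<longleftrightarrow> awalk u p z \<and> z \<in> M"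
proof -
  interpret T: wf_digraph "tail_graph G M" by (rule wf_tail_graph[OF M])
  have cas: "T.cas u p z \<longleftrightarrow> cas u p z" for u
    by (induction p arbitrary: u) (auto simp: tail_graph_simps)
  show ?thesis
  proof
    assume a: "T.awalk u p z"
    then show "awalk u p z \<and> z \<in> M"
      using T.awalk_last_in_verts[OF a] cas maximal_tailsD(1)[OF M]
      unfolding T.awalk_def awalk_def tail_graph_simps by auto
  next
    assume a: "awalk u p z \<and> z \<in> M"
    then show "T.awalk u p z"
      using cas maximal_tail_awalk[OF M, of u p z]
      unfolding T.awalk_def awalk_def tail_graph_simps by auto
  qed
qed

text \<open>The edges of \<gamma> contain those of a cycle. The path \<alpha> follows \<gamma> up to
  an edge \<open>e\<close> of this cycle and then leaves by an exit \<open>f\<close>, so it differs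
  from \<gamma> in its last edge.\<close>

lemma gamma_exit:
  assumes M: "M \<in> maximal_tails_gamma G" and w: "w \<in> M" "awalk w \<gamma> w" "\<gamma> \<noteq> []"
  shows "\<exists>\<alpha> y. awalk w \<alpha> y \<and> y \<in> M \<and> \<not> prefix \<alpha> (\<gamma> @ \<alpha>)"
proof -
  have M': "M \<in> maximal_tails G" using M by (simp add: maximal_tails_gamma_def)
  interpret T: wf_digraph "tail_graph G M" by (rule wf_tail_graph[OF M'])
  have "T.awalk w \<gamma> w" using w awalk_tail_graph_iff[OF M'] by blast
  then obtain c where c: "T.cycle c" "set c \<subseteq> set \<gamma>" using T.closed_awalk_cycle w by blast
  then have "has_exit (tail_graph G M) c" using M by (simp add: maximal_tails_gamma_def)
  then obtain f e where f: "f \<in> arcs G" "head G f \<in> M" "e \<in> set \<gamma>" "tail G f = tail G e" "f \<noteq> e"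
    using c(2) by (auto simp: has_exit_def tail_graph_simps)
  obtain \<gamma>1 \<gamma>2 where \<gamma>: "\<gamma> = \<gamma>1 @ e # \<gamma>2" using f(3) by (auto simp: in_set_conv_decomp)
  have "awalk w (\<gamma>1 @ [f]) (head G f)"
    using w(2) f unfolding \<gamma> by (auto simp: awalk_Cons_iff awalk_Nil_iff)
  moreover have "\<not> prefix (\<gamma>1 @ [f]) (\<gamma> @ (\<gamma>1 @ [f]))" using f(5) by (simp add: \<gamma>)
  ultimately show ?thesis using f(2) by blast
qed

definition no_exit_cycle :: "'a set \<Rightarrow> 'a \<Rightarrow> 'b list \<Rightarrow> bool" where
  "no_exit_cycle M v c \<longleftrightarrow> M \<in> maximal_tails G \<and> awalk v c v \<and> c \<noteq> [] \<and> v \<in> M \<and>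
    distinct (map (tail G) c) \<and>
    (\<forall>e\<in>set c. \<forall>f\<in>arcs G. tail G f = tail G e \<and> head G f \<in> M \<longrightarrow> f = e)"

lemma tau_no_exit_cycle:
  assumes "M \<in> maximal_tails_tau G"
  shows "\<exists>v c. no_exit_cycle M v c"
proof -
  have M: "M \<in> maximal_tails G" using assms by (simp add: maximal_tails_tau_def)
  interpret T: wf_digraph "tail_graph G M" by (rule wf_tail_graph[OF M])
  obtain c where c: "T.cycle c" "\<not> has_exit (tail_graph G M) c"
    using assms M by (auto simp: maximal_tails_tau_def maximal_tails_gamma_def)
  then obtain v where v: "T.awalk v c v" "c \<noteq> []" "distinct (map (tail G) c)"
    using T.cycle_iff_distinct_tails by (auto simp: tail_graph_simps)
  have "f = e" if "e \<in> set c" "f \<in> arcs G" "tail G f = tail G e" "head G f \<in> M" for e f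
    using c(2) that by (auto simp: has_exit_def tail_graph_simps)
  then show ?thesis
    using v M awalk_tail_graph_iff[OF M] unfolding no_exit_cycle_def by blast
qed

lemma cycle_edge_unique:
  assumes "no_exit_cycle M v c" "e \<in> arcs G" "head G e \<in> M" "tail G e \<in> tail G ` set c"
  shows "e \<in> set c"
  using assms unfolding no_exit_cycle_def by force

text \<open>A walk that ends in \<open>M\<close> stays in \<open>M\<close> throughout, and at a
  vertex of the cycle the only edge that stays in \<open>M\<close> is the cycle edge.\<close>

lemma awalk_in_cycle:
  assumes c: "no_exit_cycle M v c" and "y \<in> tail G ` set c" "awalk y p z" "z \<in> M"
  shows "set p \<subseteq> set c \<and> z \<in> tail G ` set c"
  using assms(2,3)
proof (induction p arbitrary: y)
  case Nil
  then show ?case by (simp add: awalk_Nil_iff)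
next
  case (Cons e p)
  have M: "M \<in> maximal_tails G" "awalk v c v" using c by (auto simp: no_exit_cycle_def)
  have e: "e \<in> arcs G" "y = tail G e" "awalk (head G e) p z" using Cons.prems by (auto simp: awalk_Cons_iff)
  have "head G e \<in> M" using maximal_tail_awalk(1)[OF M(1) e(3) assms(4)] .
  then have ec: "e \<in> set c" using cycle_edge_unique[OF c e(1)] Cons.prems(1) e(2) by simp
  then show ?case using Cons.IH[OF closed_awalk_head(1)[OF M(2) ec] e(3)] by simp
qed

lemma no_exit_cycle_base: "no_exit_cycle M v c \<Longrightarrow> v \<in> tail G ` set c"
  by (cases c) (auto simp: no_exit_cycle_def awalk_Cons_iff)

text \<open>A common successor of \<open>w\<close> and \<open>v\<close> in \<open>M\<close> lies on
  the cycle, from where \<open>v\<close> can be reached.\<close>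

lemma connects_to_cycle:
  assumes c: "no_exit_cycle M v c" and w: "w \<in> M"
  shows "connects G w v"
proof -
  have M: "M \<in> maximal_tails G" "awalk v c v" "v \<in> M" using c by (auto simp: no_exit_cycle_def)
  obtain y where y: "y \<in> M" "connects G w y" "connects G v y" using maximal_tailsD(5)[OF M(1) w M(3)] by blast
  then obtain p where "awalk v p y" by (auto simp: connects_def)
  then have "y \<in> tail G ` set c" using awalk_in_cycle[OF c no_exit_cycle_base[OF c] _ y(1)] by blast
  then obtain q where "awalk y q v" using closed_awalk_head(2)[OF M(2)] by blast
  then show ?thesis using connects_trans[OF y(2)] by (auto simp: connects_def)
qed

text \<open>Distinct sources make the next edge a function of the current vertex.\<close>

lemma walks_in_cycle_comparable:
  assumes "distinct (map (tail G) c)" "awalk y p z" "awalk y q z'" "set p \<subseteq> set c" "set q \<subseteq> set c"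
  shows "prefix p q \<or> prefix q p"
  using assms(2-)
proof (induction p arbitrary: y q)
  case (Cons e p)
  show ?case
  proof (cases q)
    case (Cons f q')
    have "e = f"
      using assms(1) Cons.prems Cons by (auto simp: awalk_Cons_iff distinct_map dest: inj_onD)
    then show ?thesis using Cons.IH[of "head G e" q'] Cons.prems Cons by (auto simp: awalk_Cons_iff)
  qed simp
qed simp

lemma awalk_cycle_power: "awalk v c v \<Longrightarrow> awalk v (cycle_power c k) v"
  by (induction k) (auto simp: awalk_Nil_iff)

text \<open>Walks in the cycle are comparable, so \<open>c\<close> is a prefix of a nonempty
  \<open>p\<close> unless \<open>p\<close> is a proper prefix of \<open>c\<close>. The latter would
  make the source \<open>v\<close> occur twice in \<open>c\<close>. Hence a copy of \<open>c\<close>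
  can be split off.\<close>

lemma closed_awalk_is_power:
  assumes c: "no_exit_cycle M v c" and "awalk v p v"
  shows "\<exists>k. p = cycle_power c k"
  using assms(2)
proof (induction "length p" arbitrary: p rule: less_induct)
  case less
  have c': "M \<in> maximal_tails G" "awalk v c v" "c \<noteq> []" "v \<in> M" "distinct (map (tail G) c)"
    using c by (auto simp: no_exit_cycle_def)
  show ?case
  proof (cases "p = []")
    case True
    then show ?thesis by (intro exI[of _ 0]) simp
  next
    case False
    have sp: "set p \<subseteq> set c" using awalk_in_cycle[OF c no_exit_cycle_base[OF c] less.prems c'(4)] by blast
    have "prefix c p"
    proof (rule ccontr)
      assume n: "\<not> prefix c p"
      then obtain q where q: "c = p @ q"
        using walks_in_cycle_comparable[OF c'(5) less.prems c'(2) sp order_refl] by (auto simp: prefix_def)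
      then have "q \<noteq> []" using n by auto
      have "awalk v q v" using c'(2) less.prems unfolding q by auto
      then have "tail G (hd p) = tail G (hd q)"
        using less.prems False \<open>q \<noteq> []\<close> by (cases p; cases q) (auto simp: awalk_Cons_iff)
      then show False using c'(5) False \<open>q \<noteq> []\<close> unfolding q by (cases p; cases q) auto
    qed
    then obtain q where q: "p = c @ q" by (auto simp: prefix_def)
    then have "awalk v q v" using c'(2) less.prems by auto
    then obtain k where "q = cycle_power c k" using less.hyps[of q] c'(3) q by auto
    then show ?thesis using q by (intro exI[of _ "Suc k"]) simp
  qed
qed

end

section \<open>The corner at a cycle without exit\<close>

lemma sum_keys_superset:
  assumes "finite S" "Poly_Mapping.keys f \<subseteq> S" "\<And>n. g n 0 = 0"
  shows "(\<Sum>n\<in>Poly_Mapping.keys f. g n (Poly_Mapping.lookup f n)) = (\<Sum>n\<in>S. g n (Poly_Mapping.lookup f n))"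
  by (rule sum.mono_neutral_left) (use assms in \<open>auto simp: in_keys_iff\<close>)

text \<open>Coefficients may cancel, so the key sets differ; all three sums are compared over the
  union of the keys of \<open>f\<close> and \<open>f'\<close>.\<close>

lemma sum_keys_add:
  assumes "\<And>n. g n 0 = 0" "\<And>n a b. g n (a + b) = g n a + g n b"
  shows "(\<Sum>n\<in>Poly_Mapping.keys (f + f'). g n (Poly_Mapping.lookup (f + f') n)) =
    (\<Sum>n\<in>Poly_Mapping.keys f. g n (Poly_Mapping.lookup f n)) +
    (\<Sum>n\<in>Poly_Mapping.keys f'. g n (Poly_Mapping.lookup f' n))"
proof -
  let ?S = "Poly_Mapping.keys f \<union> Poly_Mapping.keys f'"
  have "Poly_Mapping.keys (f + f') \<subseteq> ?S" by (rule Poly_Mapping.keys_add)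
  then show ?thesis
    using sum_keys_superset[of ?S f g] sum_keys_superset[of ?S f' g] sum_keys_superset[of ?S "f + f'" g] assms
    by (simp add: lookup_add sum.distrib)
qed

section \<open>Powers of the cycle and Laurent polynomials\<close>

context leavitt
begin

text \<open>Exponent \<open>0\<close> gives the empty path at \<open>v\<close>, that is
  \<open>V v\<close>, the identity of the corner.\<close>

definition cpow :: "'v \<Rightarrow> 'e list \<Rightarrow> int \<Rightarrow> ('v, 'e, 'k) words" where
  "cpow v c n = (if n \<ge> 0 then pe v (cycle_power c (nat n)) else ge (cycle_power c (nat (- n))) v)"

definition laurent_eval :: "'v \<Rightarrow> 'e list \<Rightarrow> (int \<Rightarrow>\<^sub>0 'k) \<Rightarrow> ('v, 'e, 'k) words" where
  "laurent_eval v c f = (\<Sum>n\<in>Poly_Mapping.keys f. cst (Poly_Mapping.lookup f n) * cpow v c n)"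

lemma laurent_eval_add: "laurent_eval v c (f + g) = laurent_eval v c f + laurent_eval v c g"
  unfolding laurent_eval_def
  by (rule sum_keys_add[of "\<lambda>n a. cst a * cpow v c n"]) (simp_all add: cst_add[symmetric] algebra_simps)

lemma laurent_eval_single: "laurent_eval v c (Poly_Mapping.single n a) = cst a * cpow v c n"
  by (cases "a = 0") (simp_all add: laurent_eval_def)

lemma laurent_eval_one: "laurent_eval v c 1 = V v"
  using laurent_eval_single[of v c 0 1] by (simp add: cpow_def pe_def)

lemma cpow_FA: "awalk v c v \<Longrightarrow> cpow v c n \<in> FA"
  using awalkD[OF awalk_cycle_power[of v c]] by (simp add: cpow_def)

lemma laurent_eval_FA: "awalk v c v \<Longrightarrow> laurent_eval v c f \<in> FA"
  unfolding laurent_eval_def by (intro FA_sum FA_mult cpow_FA) simp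

end

context leavitt_ideal
begin

text \<open>At a vertex of the cycle all edges but one lead out of \<open>M\<close> and contribute
  nothing modulo \<open>P\<close>, so the vertex relation shrinks to
  \<open>ed e * gh e \<approx> V y\<close>. This is what makes the cycle invertible in the corner,
  with the ghost path as inverse.\<close>

lemma pe_ge_no_exit:
  assumes c: "no_exit_cycle M v c" and P: "\<And>u. u \<in> verts E \<Longrightarrow> u \<notin> M \<Longrightarrow> V u \<in> P"
    and "y \<in> tail E ` set c" "awalk y d z" "z \<in> M"
  shows "pe y d * ge d y \<approx> V y"
  using assms(3,4)
proof (induction d arbitrary: y)
  case Nil
  then show ?case using vertex_edge(1) by (auto simp: pe_def ge_def awalk_Nil_iff)
next
  case (Cons e d)
  have M: "M \<in> maximal_tails E" "awalk v c v" using c by (auto simp: no_exit_cycle_def)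
  have e: "e \<in> arcs E" "y = tail E e" "awalk (head E e) d z" using Cons.prems by (auto simp: awalk_Cons_iff)
  note w = awalkD[OF e(3)]
  have hM: "head E e \<in> M" using maximal_tail_awalk(1)[OF M(1) e(3) assms(5)] .
  then have ec: "e \<in> set c" using cycle_edge_unique[OF c e(1)] Cons.prems(1) e(2) by simp
  have IH: "pe (head E e) d * ge d (head E e) \<approx> V (head E e)"
    using Cons.IH[OF closed_awalk_head(1)[OF M(2) ec] e(3)] .
  have "ed f * gh f \<in> P" if f: "f \<in> out_arcs E y - {e}" for f
  proof -
    have f': "f \<in> arcs E" "tail E f = y" "f \<noteq> e" using f by auto
    then have "head E f \<notin> M" using c ec e(2) unfolding no_exit_cycle_def by metis
    then have "V (head E f) \<in> P" using P f' by simp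
    then have "ed f * (V (head E f) * gh f) \<in> P" using f' by (simp add: P_words)
    moreover have "ed f * (V (head E f) * gh f) \<approx> ed f * gh f" using f' by (intro cg_l vertex_edge) simp_all
    ultimately show ?thesis using cg_mem by blast
  qed
  then have "(\<Sum>f\<in>out_arcs E y - {e}. ed f * gh f) \<in> P" by (rule P_sum)
  then have rest: "(\<Sum>f\<in>out_arcs E y - {e}. ed f * gh f) \<approx> 0" by (simp add: cg_zero)
  have y: "finite (out_arcs E y)" "e \<in> out_arcs E y" "y \<in> verts E"
    using row_finite e by (auto simp: row_finite_def)
  have "V y \<approx> ed e * gh e + (\<Sum>f\<in>out_arcs E y - {e}. ed f * gh f)"
  proof -
    have "out_arcs E y \<noteq> {}" using y(2) by blast
    from vertex_sum[OF y(3) this] show ?thesis by (simp only: sum.remove[OF y(1,2)])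
  qed
  also have "\<dots> \<approx> ed e * gh e + 0" by (intro cg_add rest cg_refl)
  finally have Vy: "ed e * gh e \<approx> V y" by (simp add: cg_sym)
  have "pe y (e # d) * ge (e # d) y \<approx> (ed e * pe (head E e) d) * (ge d (head E e) * gh e)"
    using pe_Cons[of e d] ge_Cons[of e d] e w by (intro cg_mult) auto
  also have "\<dots> = ed e * (pe (head E e) d * ge d (head E e)) * gh e" by (simp add: mult.assoc)
  also have "\<dots> \<approx> ed e * V (head E e) * gh e" using e by (intro cg_lr IH) simp_all
  also have "\<dots> \<approx> ed e * gh e" using e by (intro cg_r vertex_edge) simp_all
  also note Vy
  finally show ?case .
qed

text \<open>The common part of a power and a ghost power cancels, in one order by
  \<open>pe_ge_no_exit\<close> and in the other by \<open>ge_pe_append\<close>. The four sign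
  patterns of the exponents then give the law.\<close>

lemma cpow_mult:
  assumes c: "no_exit_cycle M v c" and P: "\<And>u. u \<in> verts E \<Longrightarrow> u \<notin> M \<Longrightarrow> V u \<in> P"
  shows "pe v (cycle_power c k) * ge (cycle_power c l) v \<approx> cpow v c (int k - int l)"
    "cpow v c m * cpow v c n \<approx> cpow v c (m + n)"
proof -
  have c': "awalk v c v" "v \<in> M" using c by (auto simp: no_exit_cycle_def)
  have aw: "awalk v (cycle_power c k) v" for k using awalk_cycle_power[OF c'(1)] .
  note w = awalkD[OF aw]
  have add: "cycle_power c (k + l) = cycle_power c k @ cycle_power c l" for k l
    by (rule cycle_power_add)
  have cancel: "pe v (cycle_power c k) * ge (cycle_power c k) v \<approx> V v" for k
    using pe_ge_no_exit[OF c P no_exit_cycle_base[OF c] aw c'(2)] .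
  have pe_ge: "pe v (cycle_power c k) * ge (cycle_power c l) v \<approx> cpow v c (int k - int l)" for k l
  proof (cases "l \<le> k")
    case True
    then obtain j where j: "k = j + l" using le_Suc_ex add.commute by metis
    have "pe v (cycle_power c k) * ge (cycle_power c l) v \<approx>
      pe v (cycle_power c j) * pe v (cycle_power c l) * ge (cycle_power c l) v"
      unfolding j add using w by (intro cg_r pe_append aw) simp_all
    also have "\<dots> = pe v (cycle_power c j) * (pe v (cycle_power c l) * ge (cycle_power c l) v)"
      by (simp add: mult.assoc)
    also have "\<dots> \<approx> pe v (cycle_power c j) * V v" using w by (intro cg_l cancel) simp_all
    also have "\<dots> \<approx> pe v (cycle_power c j)" by (intro pe_V aw)
    finally show ?thesis by (simp add: cpow_def j)
  next
    case False
    then obtain j where j: "l = j + k" "j > 0" using less_imp_add_positive add.commute by (metis not_le)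
    have "pe v (cycle_power c k) * ge (cycle_power c l) v \<approx>
      pe v (cycle_power c k) * (ge (cycle_power c k) v * ge (cycle_power c j) v)"
      unfolding j add using w by (intro cg_l ge_append aw) simp_all
    also have "\<dots> = pe v (cycle_power c k) * ge (cycle_power c k) v * ge (cycle_power c j) v"
      by (simp add: mult.assoc)
    also have "\<dots> \<approx> V v * ge (cycle_power c j) v" using w by (intro cg_r cancel) simp_all
    also have "\<dots> \<approx> ge (cycle_power c j) v" by (intro V_ge aw)
    finally show ?thesis using j by (simp add: cpow_def)
  qed
  then show "pe v (cycle_power c k) * ge (cycle_power c l) v \<approx> cpow v c (int k - int l)" .
  have ge_pe': "ge (cycle_power c l) v * pe v (cycle_power c k) \<approx> cpow v c (int k - int l)" for k l
  proof (cases "l \<le> k")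
    case True
    then obtain j where j: "k = l + j" using le_Suc_ex by blast
    show ?thesis using ge_pe_append(1)[OF aw, of "cycle_power c j" l] w by (simp add: cpow_def j add)
  next
    case False
    then obtain j where j: "l = k + j" "j > 0" using less_imp_add_positive by (metis not_le)
    show ?thesis using ge_pe_append(2)[OF aw, of "cycle_power c j" k] w j by (simp add: cpow_def add)
  qed
  have *: "(\<exists>k. x = int k) \<or> (\<exists>k>0. x = - int k)" for x
    by (cases "x \<ge> 0") (metis nonneg_int_cases, metis neg_int_cases not_le)
  from *[of m] *[of n] consider k l where "m = int k" "n = int l" | k l where "m = int k" "n = - int l" "l > 0"
    | k l where "m = - int k" "k > 0" "n = int l" | k l where "m = - int k" "n = - int l" "k > 0" "l > 0"
    by blast
  then show "cpow v c m * cpow v c n \<approx> cpow v c (m + n)"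
  proof cases
    case (1 k l)
    have "pe v (cycle_power c (k + l)) \<approx> pe v (cycle_power c k) * pe v (cycle_power c l)"
      unfolding add using w by (intro pe_append aw)
    then show ?thesis using 1 cg_sym by (simp add: cpow_def nat_add_distrib)
  next
    case (2 k l)
    then show ?thesis using pe_ge[of k l] by (simp add: cpow_def)
  next
    case (3 k l)
    then show ?thesis using ge_pe'[of k l] by (simp add: cpow_def)
  next
    case (4 k l)
    have "ge (cycle_power c (l + k)) v \<approx> ge (cycle_power c k) v * ge (cycle_power c l) v"
      unfolding add using w by (intro ge_append aw)
    moreover have "nat (int k + int l) = l + k" "nat (int l + int k) = l + k" by simp_all
    ultimately show ?thesis using 4 cg_sym by (simp add: cpow_def)
  qed
qed

lemma laurent_eval_mult:
  assumes c: "no_exit_cycle M v c" and P: "\<And>u. u \<in> verts E \<Longrightarrow> u \<notin> M \<Longrightarrow> V u \<in> P"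
  shows "laurent_eval v c (f * g) \<approx> laurent_eval v c f * laurent_eval v c g"
proof -
  have "awalk v c v" using c by (auto simp: no_exit_cycle_def)
  note FA = cpow_FA[OF this, THEN FA_words]
  have single: "laurent_eval v c (Poly_Mapping.single m a * Poly_Mapping.single n b) \<approx>
    laurent_eval v c (Poly_Mapping.single m a) * laurent_eval v c (Poly_Mapping.single n b)" for m n a b
  proof -
    have "cst (a * b) * cpow v c (m + n) \<approx> cst (a * b) * (cpow v c m * cpow v c n)"
      by (intro cg_l cg_sym[OF cpow_mult(2)[OF c P]]) simp_all
    also have "\<dots> = cst a * (cst b * cpow v c m) * cpow v c n" by (simp add: cst_mult[symmetric] mult.assoc)
    also have "\<dots> = (cst a * cpow v c m) * (cst b * cpow v c n)"
      by (simp add: cst_commute[of b] mult.assoc)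
    finally show ?thesis by (simp add: laurent_eval_single mult_single)
  qed
  show ?thesis
  proof (rule poly_mapping_sum_induct[of f])
    fix m a
    show "laurent_eval v c (Poly_Mapping.single m a * g) \<approx> laurent_eval v c (Poly_Mapping.single m a) * laurent_eval v c g"
    proof (rule poly_mapping_sum_induct[of g])
      fix x y assume "laurent_eval v c (Poly_Mapping.single m a * x) \<approx> laurent_eval v c (Poly_Mapping.single m a) * laurent_eval v c x"
        "laurent_eval v c (Poly_Mapping.single m a * y) \<approx> laurent_eval v c (Poly_Mapping.single m a) * laurent_eval v c y"
      from cg_add[OF this] show "laurent_eval v c (Poly_Mapping.single m a * (x + y)) \<approx>
        laurent_eval v c (Poly_Mapping.single m a) * laurent_eval v c (x + y)"
        by (simp add: laurent_eval_add algebra_simps)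
    qed (simp_all add: single, simp add: laurent_eval_def)
  next
    fix x y assume "laurent_eval v c (x * g) \<approx> laurent_eval v c x * laurent_eval v c g"
      "laurent_eval v c (y * g) \<approx> laurent_eval v c y * laurent_eval v c g"
    from cg_add[OF this] show "laurent_eval v c ((x + y) * g) \<approx> laurent_eval v c (x + y) * laurent_eval v c g"
      by (simp add: laurent_eval_add algebra_simps)
  qed (simp add: laurent_eval_def)
qed

text \<open>A monomial at \<open>v\<close> whose middle vertex \<open>y\<close> lies in
  \<open>M\<close> does not change modulo \<open>P\<close> when a path \<open>p\<close> from
  \<open>y\<close> to \<open>v\<close> and its ghost are inserted. Both of its paths become closed
  at \<open>v\<close>, hence powers of \<open>c\<close>. If \<open>y\<close> lies outside
  \<open>M\<close>, the monomial vanishes.\<close>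

lemma laurent_eval_surj:
  assumes c: "no_exit_cycle M v c" and P: "\<And>u. u \<in> verts E \<Longrightarrow> u \<notin> M \<Longrightarrow> V u \<in> P" and x: "x \<in> FA"
  shows "\<exists>f. V v * x * V v \<approx> laurent_eval v c f"
  using x
proof (induction rule: FA_span)
  case (mem x)
  have "v \<in> verts E" using c by (auto simp: no_exit_cycle_def)
  then have "V v * x * V v \<approx> laurent_eval v c 0"
    using mem by (simp add: laurent_eval_def cg_zero[symmetric] P_words)
  then show ?case by blast
next
  case (add a b)
  then obtain f g where "V v * a * V v \<approx> laurent_eval v c f" "V v * b * V v \<approx> laurent_eval v c g" by blast
  from cg_add[OF this] show ?case
    by (intro exI[of _ "f + g"]) (simp add: laurent_eval_add algebra_simps)
next
  case (mono a u \<mu> t \<nu> y)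
  note d = awalkD[OF mono(1)] and d' = awalkD[OF mono(2)]
  have c': "M \<in> maximal_tails E" "awalk v c v" "v \<in> M" using c by (auto simp: no_exit_cycle_def)
  have v: "v \<in> verts E" using awalkD[OF c'(2)] by simp
  have eq: "V v * (cst a * (pe u \<mu> * ge \<nu> t)) * V v = cst a * ((V v * pe u \<mu>) * (ge \<nu> t * V v))"
    using cst_commute[of a "V v"] by (simp add: mult.assoc[symmetric])
  have zero: ?case if "(V v * pe u \<mu>) * (ge \<nu> t * V v) \<in> P"
    using that unfolding eq by (intro exI[of _ 0]) (simp add: laurent_eval_def cg_zero[symmetric] P_words)
  show ?case
  proof (cases "v = u \<and> v = t")
    case False
    then consider "v \<noteq> u" | "v \<noteq> t" by blast
    then show ?thesis
    proof cases
      case 1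
      then have "V v * pe u \<mu> \<in> P" using V_pe(2) d v by blast
      then show ?thesis using d' v by (intro zero) (rule P_words(2), simp_all)
    next
      case 2
      then have "ge \<nu> t * V v \<in> P" using ge_V(2) d' v by blast
      then show ?thesis using d v by (intro zero) (rule P_words(1), simp_all)
    qed
  next
    case True
    have *: "(V v * pe u \<mu>) * (ge \<nu> t * V v) \<approx> pe u \<mu> * ge \<nu> t"
      using V_pe(1)[OF d(1,2)] ge_V(1)[OF d'(1,2)] True d d' v by (intro cg_mult) auto
    show ?thesis
    proof (cases "y \<in> M")
      case False
      then have "V y \<in> P" using P d by blast
      then have "pe u \<mu> * V y * ge \<nu> t \<in> P" using d d' by (simp add: P_words)
      then show ?thesis using zero cg_mem[OF *] cg_mem[OF pe_ge_mid[OF mono]] by blast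
    next
      case yM: True
      have yc: "y \<in> tail E ` set c"
        using awalk_in_cycle[OF c no_exit_cycle_base[OF c], of \<mu> y] mono(1) True yM by simp
      obtain p where p: "awalk y p v" using connects_to_cycle[OF c yM] by (auto simp: connects_def)
      note dp = awalkD[OF p]
      have "awalk v (\<mu> @ p) v" "awalk v (\<nu> @ p) v"
        using iffD2[OF awalk_append_awalk[OF mono(1)] p] iffD2[OF awalk_append_awalk[OF mono(2)] p]
        by (simp_all only: conjunct1[OF True] conjunct2[OF True, symmetric])
      then obtain k l where kl: "\<mu> @ p = cycle_power c k" "\<nu> @ p = cycle_power c l"
        using closed_awalk_is_power[OF c] by metis
      have "pe u \<mu> * ge \<nu> t \<approx> pe u \<mu> * V y * ge \<nu> t" by (rule pe_ge_mid[OF mono])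
      also have "\<dots> \<approx> pe u \<mu> * (pe y p * ge p y) * ge \<nu> t"
        using d d' by (intro cg_lr cg_sym[OF pe_ge_no_exit[OF c P yc p c'(3)]]) simp_all
      also have "\<dots> = (pe u \<mu> * pe y p) * (ge p y * ge \<nu> t)" by (simp add: mult.assoc)
      also have "\<dots> \<approx> pe u (\<mu> @ p) * ge (\<nu> @ p) t"
        using d d' dp by (intro cg_mult cg_sym[OF pe_append[OF mono(1)]] cg_sym[OF ge_append[OF mono(2)]]) simp_all
      also have "\<dots> = pe v (cycle_power c k) * ge (cycle_power c l) v" using True kl by auto
      also have "\<dots> \<approx> cpow v c (int k - int l)" by (rule cpow_mult(1)[OF c P])
      finally have "(V v * pe u \<mu>) * (ge \<nu> t * V v) \<approx> cpow v c (int k - int l)"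
        using * cg_trans by blast
      then have "V v * (cst a * (pe u \<mu> * ge \<nu> t)) * V v \<approx> laurent_eval v c (Poly_Mapping.single (int k - int l) a)"
        unfolding eq laurent_eval_single by (intro cg_l) simp_all
      then show ?thesis by blast
    qed
  qed
qed

end

section \<open>Representations on boundary paths\<close>

context leavitt
begin

lemma free_algebra_uminus:
  assumes "x \<in> FA"
  shows "\<ominus>\<^bsub>free_algebra (lpa_gens E)\<^esub> x = - x"
proof -
  interpret rng "free_algebra (lpa_gens E) :: ('v, 'e, 'k) words ring"
    by (rule rng_free_algebra)
  show ?thesis
    using assms FA_uminus[OF assms] by (intro minus_equality) (simp_all add: free_algebra_simps FA_def)
qed

lemma FA_idealI:
  assumes "I \<subseteq> FA" "0 \<in> I" "\<And>x y. x \<in> I \<Longrightarrow> y \<in> I \<Longrightarrow> x + y \<in> I" "\<And>x. x \<in> I \<Longrightarrow> - x \<in> I"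
    "\<And>a x. a \<in> I \<Longrightarrow> x \<in> FA \<Longrightarrow> x * a \<in> I" "\<And>a x. a \<in> I \<Longrightarrow> x \<in> FA \<Longrightarrow> a * x \<in> I"
  shows "rng_ideal I (free_algebra (lpa_gens E))"
proof (rule rng.rng_idealI[OF rng_free_algebra])
  show "\<ominus>\<^bsub>free_algebra (lpa_gens E)\<^esub> x \<in> I" if "x \<in> I" for x
    using that assms(1,4) free_algebra_uminus by auto
qed (use assms in \<open>auto simp: free_algebra_simps FA_def[symmetric]\<close>)

end

text \<open>
  States \<open>Y\<close> behave like boundary paths: \<open>nxt\<close> is the first edge, \<open>drp\<close> removes it and \<open>cns\<close>
  prepends an edge.  Functions on the states form a right module.
\<close>

locale branching = leavitt E K for E :: "('v, 'e) pre_digraph" and K :: "'k::field itself" +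
  fixes Y :: "'s set" and src :: "'s \<Rightarrow> 'v" and nxt :: "'s \<Rightarrow> 'e option"
    and drp :: "'s \<Rightarrow> 's" and cns :: "'e \<Rightarrow> 's \<Rightarrow> 's"
  assumes src: "y \<in> Y \<Longrightarrow> src y \<in> verts E"
    and nxt_None: "y \<in> Y \<Longrightarrow> nxt y = None \<Longrightarrow> out_arcs E (src y) = {}"
    and nxt_Some: "y \<in> Y \<Longrightarrow> nxt y = Some e \<Longrightarrow>
      e \<in> arcs E \<and> tail E e = src y \<and> drp y \<in> Y \<and> src (drp y) = head E e \<and> cns e (drp y) = y"
    and cns: "e \<in> arcs E \<Longrightarrow> y \<in> Y \<Longrightarrow> src y = head E e \<Longrightarrow>
      cns e y \<in> Y \<and> nxt (cns e y) = Some e \<and> drp (cns e y) = y"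
begin

lemma src_cns: "e \<in> arcs E \<Longrightarrow> y \<in> Y \<Longrightarrow> src y = head E e \<Longrightarrow> src (cns e y) = tail E e"
  using cns[of e y] nxt_Some[of "cns e y" e] by simp

text \<open>Functions are pulled back along the moves of the states. On point masses this is the
  natural action, see \<open>act_\<delta>\<close>: \<open>Edge e\<close> removes a first edge
  \<open>e\<close> and \<open>Ghost e\<close> prepends one.\<close>

fun gact :: "('v, 'e) lpa_gen \<Rightarrow> ('s \<Rightarrow> 'k) \<Rightarrow> 's \<Rightarrow> 'k" where
  "gact (Vertex v) f y = (if y \<in> Y \<and> src y = v then f y else 0)"
| "gact (Edge e) f y = (if y \<in> Y \<and> e \<in> arcs E \<and> src y = head E e then f (cns e y) else 0)"
| "gact (Ghost e) f y = (if y \<in> Y \<and> nxt y = Some e then f (drp y) else 0)"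

text \<open>\<open>fold\<close> lets the leftmost letter act first, as a right action
  requires.\<close>

definition act :: "('s \<Rightarrow> 'k) \<Rightarrow> ('v, 'e, 'k) words \<Rightarrow> 's \<Rightarrow> 'k" where
  "act f a y = (\<Sum>w\<in>Poly_Mapping.keys a. Poly_Mapping.lookup a w * fold gact (letters w) f y)"

lemma gact_linear: "gact g (\<lambda>y. a * f y + b * f' y) = (\<lambda>y. a * gact g f y + b * gact g f' y)"
  by (cases g) auto

lemma fold_gact_linear:
  "fold gact gs (\<lambda>y. a * f y + b * f' y) = (\<lambda>y. a * fold gact gs f y + b * fold gact gs f' y)"
  by (induction gs arbitrary: f f') (simp_all add: gact_linear)

lemma act_linear: "act (\<lambda>y. a * f y + b * f' y) x = (\<lambda>y. a * act f x y + b * act f' x y)"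
  by (rule ext) (simp add: act_def fold_gact_linear sum.distrib sum_distrib_left algebra_simps)

lemma act_scale: "act (\<lambda>y. a * f y) x = (\<lambda>y. a * act f x y)"
  using act_linear[of a f 0 f x] by simp

lemma act_add_fun: "act (\<lambda>y. f y + f' y) x = (\<lambda>y. act f x y + act f' x y)"
  using act_linear[of 1 f 1 f' x] by simp

lemma act_zero_fun: "act (\<lambda>_. 0) x = (\<lambda>_. 0)"
  using act_linear[of 0 "\<lambda>_. 0" 0 "\<lambda>_. 0" x] by simp

lemma act_add: "act f (x + y) = (\<lambda>s. act f x s + act f y s)"
  unfolding act_def
  by (rule ext, rule sum_keys_add[of "\<lambda>w c. c * fold gact (letters w) f _"]) (simp_all add: algebra_simps)

lemma act_single: "act f (Poly_Mapping.single w c) = (\<lambda>y. c * fold gact (letters w) f y)"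
  by (rule ext, cases "c = 0") (simp_all add: act_def)

lemma act_zero: "act f 0 = (\<lambda>_. 0)"
  by (rule ext) (simp add: act_def)

lemma act_cst: "act f (cst c) = (\<lambda>y. c * f y)"
  by (simp add: cst_def act_single zero_free_word_def)

lemma act_gen: "act f (gen g) = gact g f"
  by (simp add: gen_def act_single)

lemma act_uminus: "act f (- x) = (\<lambda>s. - act f x s)"
  by (rule ext) (simp add: act_def sum_negf)

lemma act_diff: "act f (x - y) = (\<lambda>s. act f x s - act f y s)"
  using act_add[of f x "- y"] act_uminus[of f y] by simp

lemma act_sum: "act f (sum h A) s = (\<Sum>i\<in>A. act f (h i) s)"
  by (induction A rule: infinite_finite_induct) (simp_all add: act_zero act_add)

lemma act_mult: "act f (x * y) = act (act f x) y"
proof (rule poly_mapping_sum_induct[of x])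
  fix u c
  show "act f (Poly_Mapping.single u c * y) = act (act f (Poly_Mapping.single u c)) y"
  proof (rule poly_mapping_sum_induct[of y])
    fix w d
    show "act f (Poly_Mapping.single u c * Poly_Mapping.single w d) =
      act (act f (Poly_Mapping.single u c)) (Poly_Mapping.single w d)"
      using fold_gact_linear[of "letters w" c "fold gact (letters u) f" 0 "\<lambda>_. 0"]
      by (simp add: mult_single act_single plus_free_word_def mult_ac)
  qed (simp_all add: act_add act_zero distrib_left)
qed (simp_all add: act_add act_zero act_add_fun act_zero_fun distrib_right)

definition ker :: "('v, 'e, 'k) words set" where
  "ker = {a \<in> FA. \<forall>f. act f a = (\<lambda>_. 0)}"

text \<open>In the vertex relation only the term of the first edge of \<open>y\<close> survives, and
  a state without a first edge sits at a sink, where the relation is not imposed.\<close>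

lemma act_relations:
  assumes "r \<in> lpa_relations E"
  shows "act f r = (\<lambda>_. 0)"
  using assms
proof cases
  case (vertex_sum v)
  show ?thesis
  proof
    fix y
    have fin: "finite (out_arcs E v)" using row_finite vertex_sum by (simp add: row_finite_def)
    have "act f r y = gact (Vertex v) f y - (\<Sum>e\<in>out_arcs E v. gact (Ghost e) (gact (Edge e) f) y)"
      by (simp add: vertex_sum act_diff act_sum act_mult act_gen)
    also have "\<dots> = 0"
    proof (cases "y \<in> Y")
      case True
      show ?thesis
      proof (cases "nxt y")
        case None
        then show ?thesis using nxt_None[OF True] vertex_sum by auto
      next
        case (Some e0)
        note s = nxt_Some[OF True Some]
        have "(\<Sum>e\<in>out_arcs E v. gact (Ghost e) (gact (Edge e) f) y) =
          (\<Sum>e\<in>out_arcs E v. if e = e0 then f y else 0)"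
          by (intro sum.cong refl) (use s Some True in auto)
        also have "\<dots> = (if src y = v then f y else 0)"
          using s fin by (auto simp: sum.delta)
        finally show ?thesis using True by simp
      qed
    qed simp
    finally show "act f r y = 0" .
  qed
qed (auto simp: fun_eq_iff act_diff act_mult act_gen src_cns dest: cns nxt_Some)

lemma lid_ker: "lid ker"
proof -
  have "rng_ideal ker (free_algebra (lpa_gens E))"
    by (rule FA_idealI)
      (auto simp: ker_def act_zero act_add act_uminus act_mult act_zero_fun dest: FA_words)
  moreover from this have "L \<subseteq> ker"
    by (rule L_minimal) (use relations_FA act_relations in \<open>auto simp: ker_def act_mult\<close>)
  ultimately show ?thesis by (simp add: lid_def)
qed

definition \<delta> :: "'s \<Rightarrow> 's \<Rightarrow> 'k" where "\<delta> y = (\<lambda>z. if z = y then 1 else 0)"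

lemma act_\<delta>:
  assumes "y \<in> Y"
  shows "act (\<delta> y) (V (src y)) = \<delta> y"
    "nxt y = Some e \<Longrightarrow> act (\<delta> y) (ed e) = \<delta> (drp y)"
    "e \<in> arcs E \<Longrightarrow> src y = head E e \<Longrightarrow> act (\<delta> y) (gh e) = \<delta> (cns e y)"
proof -
  show "act (\<delta> y) (V (src y)) = \<delta> y" using assms by (auto simp: V_def act_gen \<delta>_def)
  show "act (\<delta> y) (ed e) = \<delta> (drp y)" if "nxt y = Some e"
    using assms nxt_Some[OF assms that] cns by (auto simp: ed_def act_gen \<delta>_def fun_eq_iff)
  show "act (\<delta> y) (gh e) = \<delta> (cns e y)" if "e \<in> arcs E" "src y = head E e"
    using cns[OF that(1) assms that(2)] nxt_Some by (fastforce simp: gh_def act_gen \<delta>_def fun_eq_iff)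
qed

lemma V_ker_iff:
  assumes "v \<in> verts E"
  shows "V v \<in> ker \<longleftrightarrow> v \<notin> src ` Y"
proof
  assume "V v \<in> ker"
  then have "act (\<delta> y) (V v) = (\<lambda>_. 0)" for y by (simp add: ker_def)
  moreover have "\<delta> y \<noteq> (\<lambda>_. 0)" for y by (auto simp: \<delta>_def fun_eq_iff)
  ultimately show "v \<notin> src ` Y" using act_\<delta>(1) by force
next
  assume "v \<notin> src ` Y"
  then have "act f (V v) = (\<lambda>_. 0)" for f by (auto simp: V_def act_gen fun_eq_iff)
  then show "V v \<in> ker" using assms by (simp add: ker_def)
qed

fun follows :: "'s \<Rightarrow> 'e list \<Rightarrow> bool" where
  "follows y [] = True"
| "follows y (e # \<mu>) = (nxt y = Some e \<and> follows (drp y) \<mu>)"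

lemma follows_append: "follows y (\<mu> @ \<nu>) \<longleftrightarrow> follows y \<mu> \<and> follows ((drp ^^ length \<mu>) y) \<nu>"
  by (induction \<mu> arbitrary: y) (simp_all add: funpow_swap1)

lemma act_\<delta>_path:
  assumes "y \<in> Y" "follows y \<mu>"
  shows "act (\<delta> y) (pe (src y) \<mu>) = \<delta> ((drp ^^ length \<mu>) y)"
    "act (\<delta> ((drp ^^ length \<mu>) y)) (ge \<mu> (src y)) = \<delta> y"
proof -
  have one: "act f 1 = f" for f using act_cst[of f 1] by simp
  have "act (\<delta> y) (rp \<mu>) = \<delta> ((drp ^^ length \<mu>) y)"
    using assms
  proof (induction \<mu> arbitrary: y)
    case (Cons e \<mu>)
    then show ?case using act_\<delta>(2)[of y e] nxt_Some[of y e] by (simp add: act_mult funpow_swap1)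
  qed (simp add: one)
  then show "act (\<delta> y) (pe (src y) \<mu>) = \<delta> ((drp ^^ length \<mu>) y)"
    using act_\<delta>(1)[OF assms(1)] by (simp add: pe_def act_mult)
  have "act (\<delta> ((drp ^^ length \<mu>) y)) (gp \<mu>) = \<delta> y"
    using assms
  proof (induction \<mu> arbitrary: y)
    case (Cons e \<mu>)
    then have n: "y \<in> Y" "nxt y = Some e" "follows (drp y) \<mu>" by simp_all
    note s = nxt_Some[OF n(1,2)]
    have "act (\<delta> (drp y)) (gh e) = \<delta> y" using act_\<delta>(3)[of "drp y" e] s by simp
    then show ?case using Cons.IH[of "drp y"] s n by (simp add: act_mult funpow_swap1)
  qed (simp add: one)
  then show "act (\<delta> ((drp ^^ length \<mu>) y)) (ge \<mu> (src y)) = \<delta> y"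
    using act_\<delta>(1)[OF assms(1)] by (simp add: ge_def act_mult)
qed

text \<open>The power \<open>cpow v c n\<close> moves the point mass at \<open>z 0\<close> to
  \<open>z n\<close>. These points are distinct, so the value at \<open>z m\<close> is the
  coefficient at exponent \<open>m\<close>.\<close>

lemma laurent_eval_ker:
  assumes z: "\<And>n. z n \<in> Y" "\<And>n. src (z n) = v" "inj z"
    and step: "\<And>n k. follows (z n) (cycle_power c k) \<and> (drp ^^ length (cycle_power c k)) (z n) = z (n + int k)"
    and mem: "laurent_eval v c f \<in> ker"
  shows "f = 0"
proof (rule poly_mapping_eqI)
  have cp: "act (\<delta> (z 0)) (cpow v c n) = \<delta> (z n)" for n
  proof (cases "n \<ge> 0")
    case True
    then show ?thesis
      using act_\<delta>_path(1)[OF z(1), of 0 "cycle_power c (nat n)"] step[of 0 "nat n"] z(2) by (simp add: cpow_def)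
  next
    case False
    then show ?thesis
      using act_\<delta>_path(2)[OF z(1), of n "cycle_power c (nat (- n))"] step[of n "nat (- n)"] z(2)
      by (simp add: cpow_def)
  qed
  fix m
  have "act (\<delta> (z 0)) (laurent_eval v c f) (z m) =
    (\<Sum>n\<in>Poly_Mapping.keys f. Poly_Mapping.lookup f n * \<delta> (z n) (z m))"
    unfolding laurent_eval_def act_sum
    by (intro sum.cong refl) (simp add: act_mult act_cst act_scale cp)
  also have "\<dots> = (\<Sum>n\<in>Poly_Mapping.keys f. if n = m then Poly_Mapping.lookup f m else 0)"
    using inj_eq[OF z(3)] by (intro sum.cong refl) (auto simp: \<delta>_def)
  also have "\<dots> = Poly_Mapping.lookup f m" by (simp add: in_keys_iff)
  finally show "Poly_Mapping.lookup f m = Poly_Mapping.lookup 0 m" using mem by (simp add: ker_def)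
qed

end

section \<open>Boundary paths inside a maximal tail\<close>

context leavitt
begin

text \<open>
  A boundary path is an infinite path or a path that ends at a sink; the latter stays at the sink,
  with no edge, forever.
\<close>

definition boundary_path :: "(nat \<Rightarrow> 'v \<times> 'e option) \<Rightarrow> bool" where
  "boundary_path x \<longleftrightarrow> (\<forall>i. fst (x i) \<in> verts E \<and>
     (snd (x i) = None \<longrightarrow> out_arcs E (fst (x i)) = {} \<and> x (Suc i) = x i) \<and>
     (\<forall>e. snd (x i) = Some e \<longrightarrow> e \<in> arcs E \<and> tail E e = fst (x i) \<and> fst (x (Suc i)) = head E e))"

definition shift :: "(nat \<Rightarrow> 'v \<times> 'e option) \<Rightarrow> nat \<Rightarrow> 'v \<times> 'e option" where
  "shift x i = x (Suc i)"

definition extend :: "'e \<Rightarrow> (nat \<Rightarrow> 'v \<times> 'e option) \<Rightarrow> nat \<Rightarrow> 'v \<times> 'e option" where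
  "extend e x = case_nat (tail E e, Some e) x"

lemma shift_extend [simp]: "shift (extend e x) = x" "extend e x 0 = (tail E e, Some e)"
  "extend e x (Suc i) = x i"
  by (simp_all add: shift_def extend_def fun_eq_iff)

lemma boundary_pathD:
  assumes "boundary_path x"
  shows "fst (x i) \<in> verts E" "snd (x i) = None \<Longrightarrow> out_arcs E (fst (x i)) = {} \<and> x (Suc i) = x i"
    "snd (x i) = Some e \<Longrightarrow> e \<in> arcs E \<and> tail E e = fst (x i) \<and> fst (x (Suc i)) = head E e"
  using assms unfolding boundary_path_def by blast+

lemma boundary_path_shift: "boundary_path x \<Longrightarrow> boundary_path (shift x)"
  by (simp add: boundary_path_def shift_def)

lemma boundary_path_extend:
  assumes "boundary_path x" "e \<in> arcs E" "fst (x 0) = head E e"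
  shows "boundary_path (extend e x)"
  unfolding boundary_path_def
proof
  fix i
  show "fst (extend e x i) \<in> verts E \<and>
     (snd (extend e x i) = None \<longrightarrow> out_arcs E (fst (extend e x i)) = {} \<and> extend e x (Suc i) = extend e x i) \<and>
     (\<forall>f. snd (extend e x i) = Some f \<longrightarrow>
       f \<in> arcs E \<and> tail E f = fst (extend e x i) \<and> fst (extend e x (Suc i)) = head E f)"
    using assms by (cases i) (auto simp: boundary_path_def)
qed

lemma extend_shift:
  assumes "boundary_path x" "snd (x 0) = Some e"
  shows "extend e (shift x) = x"
proof
  fix i
  show "extend e (shift x) i = x i"
    using boundary_pathD(3)[OF assms] assms(2) by (cases i) (auto simp: shift_def prod_eq_iff)
qed

definition tail_paths :: "'v set \<Rightarrow> (nat \<Rightarrow> 'v \<times> 'e option) set" where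
  "tail_paths M = {x. boundary_path x \<and> range (fst \<circ> x) \<subseteq> M}"

text \<open>The second axiom of maximal tails provides a next edge inside \<open>M\<close> at every
  vertex that is not a sink; at a sink the path becomes constant.\<close>

lemma tail_paths_exist:
  assumes M: "M \<in> maximal_tails E" and v: "v \<in> M"
  shows "\<exists>x\<in>tail_paths M. fst (x 0) = v"
proof -
  define g where "g w = (if out_arcs E w = {} then None
    else Some (SOME e. e \<in> arcs E \<and> tail E e = w \<and> head E e \<in> M))" for w
  define vs where "vs = rec_nat v (\<lambda>_ w. case g w of None \<Rightarrow> w | Some e \<Rightarrow> head E e)"
  define x where "x i = (vs i, g (vs i))" for i
  have g: "g w = Some e \<Longrightarrow> e \<in> arcs E \<and> tail E e = w \<and> head E e \<in> M" if "w \<in> M" for w e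
    using someI_ex[of "\<lambda>e. e \<in> arcs E \<and> tail E e = w \<and> head E e \<in> M"] maximal_tailsD(4)[OF M that]
    by (auto simp: g_def split: if_splits)
  have vs: "vs i \<in> M" for i
    by (induction i) (use v g in \<open>auto simp: vs_def split: option.splits\<close>)
  have suc: "vs (Suc i) = (case g (vs i) of None \<Rightarrow> vs i | Some e \<Rightarrow> head E e)" for i
    unfolding vs_def by simp
  have "boundary_path x"
    unfolding boundary_path_def
  proof
    fix i
    have "out_arcs E (vs i) = {}" if "g (vs i) = None" using that by (auto simp: g_def split: if_splits)
    then show "fst (x i) \<in> verts E \<and>
      (snd (x i) = None \<longrightarrow> out_arcs E (fst (x i)) = {} \<and> x (Suc i) = x i) \<and>
      (\<forall>e. snd (x i) = Some e \<longrightarrow> e \<in> arcs E \<and> tail E e = fst (x i) \<and> fst (x (Suc i)) = head E e)"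
      using vs[of i] g[OF vs[of i]] suc[of i] maximal_tailsD(1)[OF M]
      by (auto simp: x_def)
  qed
  moreover have "fst (x 0) = v" by (simp add: x_def vs_def)
  ultimately show ?thesis using vs by (intro bexI[of _ x]) (auto simp: tail_paths_def x_def)
qed

text \<open>
  The integer counts edges.  It keeps the powers of a cycle apart, even on the periodic path that
  follows the cycle forever.
\<close>

lemma branching_tail_paths:
  assumes M: "M \<in> maximal_tails E"
  shows "branching E (tail_paths M \<times> (UNIV :: int set)) (\<lambda>(x, m). fst (x 0)) (\<lambda>(x, m). snd (x 0))
    (\<lambda>(x, m). (shift x, m - 1)) (\<lambda>e (x, m). (extend e x, m + 1))"
proof (intro branching.intro branching_axioms.intro leavitt_axioms, goal_cases)
  case (1 y)
  then show ?case using boundary_pathD(1) by (auto simp: tail_paths_def)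
next
  case (2 y)
  then show ?case using boundary_pathD(2) by (fastforce simp: tail_paths_def)
next
  case (3 y e)
  then obtain x m where y: "y = (x, m)" "boundary_path x" "range (fst \<circ> x) \<subseteq> M" "snd (x 0) = Some e"
    by (auto simp: tail_paths_def)
  have "range (fst \<circ> shift x) \<subseteq> M" using y(3) by (auto simp: shift_def)
  then show ?case
    using boundary_pathD(3)[OF y(2,4)] boundary_path_shift[OF y(2)] extend_shift[OF y(2,4)]
    by (auto simp: y(1) tail_paths_def shift_def)
next
  case (4 e y)
  then obtain x m where y: "y = (x, m)" "boundary_path x" "range (fst \<circ> x) \<subseteq> M" "fst (x 0) = head E e"
    by (auto simp: tail_paths_def)
  have "head E e \<in> M" using y(3,4) by (metis comp_apply rangeI subsetD)
  then have "tail E e \<in> M" using maximal_tail_arc[OF M 4(1)] by blast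
  then have "fst (extend e x i) \<in> M" for i using y(3) by (cases i) auto
  then show ?case using boundary_path_extend[OF y(2) 4(1) y(4)] by (auto simp: y(1) tail_paths_def)
qed

text \<open>The ideal generated by the vertices outside \<open>M\<close>, pulled back to the free
  algebra.\<close>

definition tail_ideal :: "'v set \<Rightarrow> ('v, 'e, 'k) words set" where
  "tail_ideal M = \<Inter>{P. lid P \<and> V ` (verts E - M) \<subseteq> P}"

lemma lid_FA: "lid FA"
  unfolding lid_def using L_basic(1) rng.rng_ideal_carrier[OF rng_free_algebra] by (simp add: FA_def)

lemma lid_tail_ideal: "lid (tail_ideal M)"
proof -
  have "FA \<in> {P. lid P \<and> V ` (verts E - M) \<subseteq> P}" using lid_FA by auto
  then have "rng_ideal (tail_ideal M) (free_algebra (lpa_gens E))"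
    unfolding tail_ideal_def by (intro rng.rng_ideal_Inter[OF rng_free_algebra]) (auto simp: lid_def)
  moreover have "L \<subseteq> tail_ideal M" by (auto simp: tail_ideal_def lid_def)
  ultimately show ?thesis by (simp add: lid_def)
qed

lemma leavitt_idealI: "lid P \<Longrightarrow> leavitt_ideal E P"
  by (intro leavitt_ideal.intro leavitt_axioms leavitt_ideal_axioms.intro)

lemma tail_ideal_least: "lid P \<Longrightarrow> (\<And>u. u \<in> verts E \<Longrightarrow> u \<notin> M \<Longrightarrow> V u \<in> P) \<Longrightarrow> tail_ideal M \<subseteq> P"
  by (auto simp: tail_ideal_def)

text \<open>That the vertices of \<open>M\<close> are omitted is seen in the representation on
  \<open>tail_paths M\<close>: its kernel contains the tail ideal, and each vertex of
  \<open>M\<close> is the source of one of these paths.\<close>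

lemma V_tail_ideal:
  assumes M: "M \<in> maximal_tails E" and u: "u \<in> verts E"
  shows "V u \<in> tail_ideal M \<longleftrightarrow> u \<notin> M"
proof
  interpret B: branching E K "tail_paths M \<times> (UNIV :: int set)" "\<lambda>(x, m). fst (x 0)" "\<lambda>(x, m). snd (x 0)"
    "\<lambda>(x, m). (shift x, m - 1)" "\<lambda>e (x, m). (extend e x, m + 1)"
    by (rule branching_tail_paths[OF M])
  have "tail_ideal M \<subseteq> B.ker"
  proof (rule tail_ideal_least[OF B.lid_ker])
    fix u assume "u \<in> verts E" "u \<notin> M"
    then show "V u \<in> B.ker" unfolding B.V_ker_iff[OF \<open>u \<in> verts E\<close>] by (auto simp: tail_paths_def)
  qed
  moreover assume "V u \<in> tail_ideal M"
  ultimately have "V u \<in> B.ker" by blast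
  then show "u \<notin> M" using tail_paths_exist[OF M, of u] unfolding B.V_ker_iff[OF u] by force
next
  show "u \<notin> M \<Longrightarrow> V u \<in> tail_ideal M" using u by (auto simp: tail_ideal_def)
qed

lemma awalk_nth: "awalk u p z \<Longrightarrow> Suc i < length p \<Longrightarrow> head E (p ! i) = tail E (p ! Suc i)"
proof (induction p arbitrary: u i)
  case (Cons e p)
  show ?case
  proof (cases i)
    case 0
    then show ?thesis using Cons.prems by (cases p) (auto simp: awalk_Cons_iff)
  next
    case (Suc j)
    then show ?thesis using Cons by (auto simp: awalk_Cons_iff)
  qed
qed simp

lemma awalk_ends: "awalk u p z \<Longrightarrow> p \<noteq> [] \<Longrightarrow> tail E (hd p) = u \<and> head E (last p) = z"
  by (induction p arbitrary: u) (auto simp: awalk_Cons_iff awalk_Nil_iff)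

text \<open>The representation is evaluated on the periodic path that runs around \<open>c\<close>
  forever; its copies with different counters are the states required by
  \<open>laurent_eval_ker\<close>.\<close>

lemma laurent_eval_tail_ideal:
  assumes c: "no_exit_cycle M v c" and f: "laurent_eval v c f \<in> tail_ideal M"
  shows "f = 0"
proof -
  have M: "M \<in> maximal_tails E" and c': "awalk v c v" "c \<noteq> []" "v \<in> M" using c by (auto simp: no_exit_cycle_def)
  interpret B: branching E K "tail_paths M \<times> (UNIV :: int set)" "\<lambda>(x, m). fst (x 0)" "\<lambda>(x, m). snd (x 0)"
    "\<lambda>(x, m). (shift x, m - 1)" "\<lambda>e (x, m). (extend e x, m + 1)"
    by (rule branching_tail_paths[OF M])
  have "tail_ideal M \<subseteq> B.ker"
  proof (rule tail_ideal_least[OF B.lid_ker])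
    fix u assume "u \<in> verts E" "u \<notin> M"
    then show "V u \<in> B.ker" unfolding B.V_ker_iff[OF \<open>u \<in> verts E\<close>] by (auto simp: tail_paths_def)
  qed
  then have mem: "laurent_eval v c f \<in> B.ker" using f by blast
  define l where "l = length c"
  have l: "l > 0" using c'(2) by (simp add: l_def)
  define x where "x i = (tail E (c ! (i mod l)), Some (c ! (i mod l)))" for i
  have nth: "c ! (i mod l) \<in> set c" for i using l by (simp add: l_def)
  have step: "head E (c ! (i mod l)) = tail E (c ! (Suc i mod l))" for i
  proof (cases "Suc (i mod l) = l")
    case True
    then have "i mod l = l - 1" "Suc i mod l = 0" by (simp_all add: mod_Suc)
    then have "c ! (i mod l) = last c" "c ! (Suc i mod l) = hd c"
      using c'(2) by (simp_all add: last_conv_nth hd_conv_nth l_def)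
    then show ?thesis using awalk_ends[OF c'(1,2)] by simp
  next
    case False
    then have "Suc i mod l = Suc (i mod l)" "Suc (i mod l) < l" using l mod_less_divisor[OF l, of i] by (auto simp: mod_Suc)
    then show ?thesis using awalk_nth[OF c'(1), of "i mod l"] by (simp add: l_def)
  qed
  have arc: "c ! (i mod l) \<in> arcs E" "head E (c ! (i mod l)) \<in> M" for i
    using nth[of i] awalkD(2)[OF c'(1)] maximal_tail_awalk(2)[OF M c'(1,3)] by auto
  then have tl: "tail E (c ! (i mod l)) \<in> M" for i using maximal_tail_arc[OF M] by blast
  have bp: "boundary_path x"
    using arc step by (simp add: boundary_path_def x_def)
  have xt: "x \<in> tail_paths M" using bp tl by (auto simp: tail_paths_def x_def)
  have drp: "((\<lambda>(x, m). (shift x, m - 1)) ^^ k) (y, m) = (\<lambda>i. y (i + k), m - int k)" for k y m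
    by (induction k) (auto simp: shift_def fun_eq_iff)
  have fol: "B.follows (y, m) \<mu> \<longleftrightarrow> (\<forall>i<length \<mu>. snd (y i) = Some (\<mu> ! i))" for y m \<mu>
  proof (induction \<mu> arbitrary: y m)
    case (Cons e \<mu>)
    have "B.follows (y, m) (e # \<mu>) \<longleftrightarrow> snd (y 0) = Some e \<and> (\<forall>i<length \<mu>. snd (shift y i) = Some (\<mu> ! i))"
      using Cons[of "shift y" "m - 1"] by simp
    also have "\<dots> \<longleftrightarrow> (\<forall>i<length (e # \<mu>). snd (y i) = Some ((e # \<mu>) ! i))"
      by (auto simp: shift_def less_Suc_eq_0_disj)
    finally show ?case .
  qed simp
  have per: "(\<lambda>i. x (i + k * l)) = x" for k by (simp add: x_def fun_eq_iff)
  have len: "length (cycle_power c k) = k * l" for k by (induction k) (simp_all add: l_def)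
  have folc: "B.follows (x, m) (cycle_power c k)" for m k
  proof (induction k arbitrary: m)
    case (Suc k)
    have "B.follows (x, m) c" unfolding fol by (simp add: x_def l_def)
    moreover have "((\<lambda>(x, m). (shift x, m - 1)) ^^ length c) (x, m) = (x, m - int l)"
      using per[of 1] by (simp add: drp l_def)
    ultimately show ?case using Suc by (simp add: B.follows_append)
  qed simp
  \<comment> \<open>Removing an edge lowers the counter by one, so one turn around \<open>c\<close>
    lowers it by \<open>l\<close>; hence the sign in \<open>- n * int l\<close>.\<close>
  show "f = 0"
  proof (rule B.laurent_eval_ker[of "\<lambda>n. (x, - n * int l)" v c f])
    show "(case (x, - n * int l) of (x, m) \<Rightarrow> fst (x 0)) = v" for n
      using awalk_ends[OF c'(1,2)] c'(2) by (simp add: x_def hd_conv_nth)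
    show "inj (\<lambda>n. (x, - n * int l))" using l by (auto simp: inj_def)
    show "B.follows (x, - n * int l) (cycle_power c k) \<and>
      ((\<lambda>(x, m). (shift x, m - 1)) ^^ length (cycle_power c k)) (x, - n * int l) = (x, - (n + int k) * int l)" for n k
      using folc per by (simp add: drp len algebra_simps)
  qed (use xt mem in auto)
qed

end

section \<open>Passing to the quotient\<close>

context leavitt
begin

definition proj :: "('v, 'e, 'k) words \<Rightarrow> ('v, 'e, 'k) words set" where
  "proj f = L +>\<^bsub>free_algebra (lpa_gens E)\<^esub> f"

lemma lpa_vertex_proj: "lpa_vertex K E v = proj (V v)"
  by (simp add: lpa_vertex_def proj_def L_def V_def)

lemma rng_LPA': "rng (LPA K E)"
  by (rule rng_LPA[OF wf_digraph_axioms])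

lemma LPA_eq: "LPA K E = free_algebra (lpa_gens E) Quot L"
  by (simp add: LPA_def L_def)

lemma proj_simps:
  shows carrier_LPA: "carrier (LPA K E) = proj ` FA"
    and proj_add: "f \<in> FA \<Longrightarrow> g \<in> FA \<Longrightarrow> proj f \<oplus>\<^bsub>LPA K E\<^esub> proj g = proj (f + g)"
    and proj_mult: "f \<in> FA \<Longrightarrow> g \<in> FA \<Longrightarrow> proj f \<otimes>\<^bsub>LPA K E\<^esub> proj g = proj (f * g)"
    and proj_zero: "\<zero>\<^bsub>LPA K E\<^esub> = proj 0"
    and proj_eq_iff: "f \<in> FA \<Longrightarrow> g \<in> FA \<Longrightarrow> proj f = proj g \<longleftrightarrow> f - g \<in> L"
proof -
  let ?F = "free_algebra (lpa_gens E) :: ('v, 'e, 'k) words ring"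
  interpret I: rng_ideal L ?F by (rule L_ideal)
  interpret A: abelian_subgroup L ?F
    by (intro abelian_subgroupI3 I.additive_subgroup_axioms I.abelian_group_axioms)
  show "carrier (LPA K E) = proj ` FA"
    by (auto simp: LPA_eq FactRing_def A_RCOSETS_def' proj_def FA_def)
  show "f \<in> FA \<Longrightarrow> g \<in> FA \<Longrightarrow> proj f \<oplus>\<^bsub>LPA K E\<^esub> proj g = proj (f + g)"
    using A.a_rcos_sum[of f g] by (simp add: LPA_eq FactRing_simps proj_def FA_def free_algebra_simps)
  show "f \<in> FA \<Longrightarrow> g \<in> FA \<Longrightarrow> proj f \<otimes>\<^bsub>LPA K E\<^esub> proj g = proj (f * g)"
    using I.rcoset_mult_add[of f g] by (simp add: LPA_eq FactRing_simps proj_def FA_def free_algebra_simps)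
  show "\<zero>\<^bsub>LPA K E\<^esub> = proj 0"
    using I.a_coset_add_zero[OF I.a_subset] by (simp add: LPA_eq FactRing_simps proj_def free_algebra_simps)
  assume fg: "f \<in> FA" "g \<in> FA"
  then have c: "f \<in> carrier ?F" "g \<in> carrier ?F" by (simp_all add: FA_def)
  have "f \<in> proj g \<longleftrightarrow> f - g \<in> L"
    using A.a_rcos_module[OF c(2,1)] free_algebra_uminus[OF fg(2)]
    by (simp add: proj_def a_minus_def free_algebra_simps)
  moreover have "f \<in> proj f" using A.a_rcos_self[OF c(1)] by (simp add: proj_def)
  moreover have "proj g = proj f" if "f \<in> proj g"
    using A.a_repr_independence'[of f g] that c by (simp add: proj_def)
  ultimately show "proj f = proj g \<longleftrightarrow> f - g \<in> L" by blast
qed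

lemma proj_closed: "f \<in> FA \<Longrightarrow> proj f \<in> carrier (LPA K E)"
  by (simp add: carrier_LPA)

lemma proj_uminus: "f \<in> FA \<Longrightarrow> \<ominus>\<^bsub>LPA K E\<^esub> proj f = proj (- f)"
proof -
  assume f: "f \<in> FA"
  interpret rng "LPA K E" by (rule rng_LPA')
  show ?thesis
    using f by (intro minus_equality) (simp_all add: proj_closed proj_add proj_zero)
qed

lemma proj_minus: "f \<in> FA \<Longrightarrow> g \<in> FA \<Longrightarrow> proj f \<ominus>\<^bsub>LPA K E\<^esub> proj g = proj (f - g)"
  by (simp add: a_minus_def proj_uminus proj_add)

lemma locally_unital_LPA: "locally_unital_rng (LPA K E)"
proof (intro locally_unital_rng.intro rng_LPA' locally_unital_rng_axioms.intro)
  fix a assume "a \<in> carrier (LPA K E)"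
  then obtain f where f: "f \<in> FA" "a = proj f" by (auto simp: carrier_LPA)
  obtain W where W: "finite W" "W \<subseteq> verts E" "sum V W * f - f \<in> L" "f * sum V W - f \<in> L"
    by (rule local_unit_sum[OF f(1)])
  have u: "sum V W \<in> FA" using W by (intro FA_sum) auto
  show "\<exists>u\<in>carrier (LPA K E). u \<otimes>\<^bsub>LPA K E\<^esub> a = a \<and> a \<otimes>\<^bsub>LPA K E\<^esub> u = a"
    using W(3,4) f u by (intro bexI[of _ "proj (sum V W)"]) (simp_all add: proj_mult proj_eq_iff FA_words proj_closed)
qed

definition pre :: "('v, 'e, 'k) words set set \<Rightarrow> ('v, 'e, 'k) words set" where
  "pre P = {f \<in> FA. proj f \<in> P}"

lemma proj_L: "f \<in> L \<Longrightarrow> proj f = proj 0"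
  using L_basic(1) by (subst proj_eq_iff) auto

lemma lid_pre:
  assumes "rng_ideal P (LPA K E)"
  shows "lid (pre P)" "P = proj ` pre P"
proof -
  interpret P: rng_ideal P "LPA K E" by fact
  have "rng_ideal (pre P) (free_algebra (lpa_gens E))"
  proof (rule FA_idealI)
    show "pre P \<subseteq> FA" by (auto simp: pre_def)
    show "0 \<in> pre P" using P.zero_closed by (simp add: pre_def proj_zero)
    show "x + y \<in> pre P" if "x \<in> pre P" "y \<in> pre P" for x y
      using that P.a_closed[of "proj x" "proj y"] by (simp add: pre_def proj_add)
    show "- x \<in> pre P" if "x \<in> pre P" for x
      using that P.a_inv_closed[of "proj x"] by (simp add: pre_def proj_uminus)
    show "x * a \<in> pre P" "a * x \<in> pre P" if "a \<in> pre P" "x \<in> FA" for a x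
      using that P.rng_I_l_closed[of "proj a" "proj x"] P.rng_I_r_closed[of "proj a" "proj x"]
      by (simp_all add: pre_def proj_mult proj_closed FA_words)
  qed
  moreover have "L \<subseteq> pre P"
  proof
    fix f assume f: "f \<in> L"
    then show "f \<in> pre P"
      using P.zero_closed proj_L[OF f] L_basic(1) by (auto simp: pre_def proj_zero)
  qed
  ultimately show "lid (pre P)" by (simp add: lid_def)
  show "P = proj ` pre P"
    using P.a_subset by (auto simp: pre_def carrier_LPA)
qed

lemma proj_mem_iff:
  assumes "lid J" "f \<in> FA"
  shows "proj f \<in> proj ` J \<longleftrightarrow> f \<in> J"
proof
  interpret J: leavitt_ideal E K J by (rule leavitt_idealI[OF assms(1)])
  assume "proj f \<in> proj ` J"
  then obtain g where g: "g \<in> J" "proj f = proj g" by blast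
  then have "f - g \<in> J" using J.P_basic(1) assms(2) J.L_P proj_eq_iff by blast
  then show "f \<in> J" using J.P_basic(3)[OF _ g(1), of "f - g"] by simp
qed simp

text \<open>Together with \<open>lid_pre\<close> this is the correspondence between ideals of the
  quotient and ideals of the free algebra above \<open>L\<close>.\<close>

lemma ideal_proj:
  assumes "lid J"
  shows "rng_ideal (proj ` J) (LPA K E)" "pre (proj ` J) = J"
proof -
  interpret J: leavitt_ideal E K J by (rule leavitt_idealI[OF assms(1)])
  interpret R: rng "LPA K E" by (rule rng_LPA')
  note J = subsetD[OF J.P_basic(1)]
  show "rng_ideal (proj ` J) (LPA K E)"
  proof (rule R.rng_idealI)
    show "proj ` J \<subseteq> carrier (LPA K E)" using J proj_closed by blast
    show "\<zero>\<^bsub>LPA K E\<^esub> \<in> proj ` J" using J.P_basic(2) by (simp add: proj_zero)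
  next
    fix x y assume "x \<in> proj ` J" "y \<in> proj ` J"
    then obtain f g where fg: "f \<in> J" "g \<in> J" "x = proj f" "y = proj g" by blast
    then show "x \<oplus>\<^bsub>LPA K E\<^esub> y \<in> proj ` J" using J J.P_basic(3)[of f g] by (simp add: proj_add)
  next
    fix x assume "x \<in> proj ` J"
    then obtain f where f: "f \<in> J" "x = proj f" by blast
    then show "\<ominus>\<^bsub>LPA K E\<^esub> x \<in> proj ` J" using J J.P_basic(4)[of f] by (simp add: proj_uminus)
  next
    fix a x assume "a \<in> proj ` J" "x \<in> carrier (LPA K E)"
    then obtain f g where fg: "f \<in> J" "g \<in> FA" "a = proj f" "x = proj g" by (auto simp: carrier_LPA)
    then show "x \<otimes>\<^bsub>LPA K E\<^esub> a \<in> proj ` J" "a \<otimes>\<^bsub>LPA K E\<^esub> x \<in> proj ` J"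
      using J J.P_basic(6,7)[of f g] by (simp_all add: proj_mult)
  qed
  show "pre (proj ` J) = J" using proj_mem_iff[OF assms] J by (auto simp: pre_def)
qed

lemma SpecD:
  assumes "P \<in> Spec (LPA K E)"
  shows "rng_ideal P (LPA K E)" "lid (pre P)" "pre P \<noteq> FA" "P = proj ` pre P"
    "\<lbrakk>a \<in> FA; b \<in> FA; \<And>x. x \<in> FA \<Longrightarrow> a * x * b \<in> pre P\<rbrakk> \<Longrightarrow> a \<in> pre P \<or> b \<in> pre P"
proof -
  interpret R: locally_unital_rng "LPA K E" by (rule locally_unital_LPA)
  have P: "rng_prime_ideal P (LPA K E)" using assms by (simp add: Spec_def)
  then show idl: "rng_ideal P (LPA K E)" by (simp add: rng_prime_ideal_def)
  show "lid (pre P)" "P = proj ` pre P" using lid_pre[OF idl] by blast+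
  show "pre P \<noteq> FA"
  proof
    assume "pre P = FA"
    then have "P = carrier (LPA K E)" using lid_pre(2)[OF idl] carrier_LPA by simp
    then show False using P by (simp add: rng_prime_ideal_def)
  qed
  assume ab: "a \<in> FA" "b \<in> FA" "\<And>x. x \<in> FA \<Longrightarrow> a * x * b \<in> pre P"
  have "proj a \<otimes>\<^bsub>LPA K E\<^esub> x \<otimes>\<^bsub>LPA K E\<^esub> proj b \<in> P" if x: "x \<in> carrier (LPA K E)" for x
  proof -
    obtain y where y: "y \<in> FA" "x = proj y" using x by (auto simp: carrier_LPA)
    then show ?thesis using ab(1,2) ab(3)[OF y(1)] by (simp add: proj_mult FA_words pre_def)
  qed
  then have "proj a \<in> P \<or> proj b \<in> P"
    using P[unfolded R.prime_elementwise] proj_closed[OF ab(1)] proj_closed[OF ab(2)] by blast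
  then show "a \<in> pre P \<or> b \<in> pre P" using ab(1,2) by (simp add: pre_def)
qed

lemma stratum_iff:
  assumes "M \<in> maximal_tails E"
  shows "P \<in> stratum K E M \<longleftrightarrow> P \<in> Spec (LPA K E) \<and> (\<forall>v\<in>verts E. V v \<in> pre P \<longleftrightarrow> v \<notin> M)"
  using maximal_tailsD(1)[OF assms]
  by (auto simp: stratum_def lpa_vertex_proj pre_def)

end

section \<open>Simple modules of boundary paths\<close>

context branching
begin

definition supp :: "('s \<Rightarrow> 'k) \<Rightarrow> 's set" where "supp f = {y. f y \<noteq> 0}"

definition Fin :: "('s \<Rightarrow> 'k) set" where "Fin = {f. finite (supp f) \<and> supp f \<subseteq> Y}"

lemma Fin_add: "f \<in> Fin \<Longrightarrow> g \<in> Fin \<Longrightarrow> (\<lambda>y. f y + g y) \<in> Fin"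
proof -
  assume "f \<in> Fin" "g \<in> Fin"
  moreover have "supp (\<lambda>y. f y + g y) \<subseteq> supp f \<union> supp g" by (auto simp: supp_def)
  ultimately show ?thesis by (auto simp: Fin_def intro: finite_subset)
qed

lemma Fin_scale: "f \<in> Fin \<Longrightarrow> (\<lambda>y. c * f y) \<in> Fin"
proof -
  assume "f \<in> Fin"
  moreover have "supp (\<lambda>y. c * f y) \<subseteq> supp f" by (auto simp: supp_def)
  ultimately show ?thesis by (auto simp: Fin_def intro: finite_subset)
qed

lemma Fin_zero: "(\<lambda>_. 0) \<in> Fin" by (simp add: Fin_def supp_def)

lemma inj_cns: "e \<in> arcs E \<Longrightarrow> inj_on (cns e) {y \<in> Y. src y = head E e}"
  by (rule inj_onI) (metis (mono_tags, lifting) cns mem_Collect_eq)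

lemma supp_edge: "e \<in> arcs E \<Longrightarrow> supp (gact (Edge e) f) = {y \<in> Y. src y = head E e \<and> cns e y \<in> supp f}"
  by (auto simp: supp_def)

text \<open>Prepending \<open>e\<close> maps the new support injectively into the old one, so acting
  by an edge never enlarges a support.\<close>

lemma card_supp_edge:
  assumes e: "e \<in> arcs E" and f: "finite (supp f)"
  shows "finite (supp (gact (Edge e) f))"
    "cns e ` supp (gact (Edge e) f) \<subseteq> T \<Longrightarrow> finite T \<Longrightarrow> card (supp (gact (Edge e) f)) \<le> card T"
proof -
  have inj: "inj_on (cns e) (supp (gact (Edge e) f))"
    by (rule inj_on_subset[OF inj_cns[OF e]]) (auto simp: supp_edge[OF e])
  have "cns e ` supp (gact (Edge e) f) \<subseteq> supp f" by (auto simp: supp_edge[OF e])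
  then show "finite (supp (gact (Edge e) f))" using inj f finite_subset finite_imageD by blast
  show "cns e ` supp (gact (Edge e) f) \<subseteq> T \<Longrightarrow> finite T \<Longrightarrow> card (supp (gact (Edge e) f)) \<le> card T"
    using inj card_image[OF inj] card_mono by metis
qed

lemma Fin_gact: "f \<in> Fin \<Longrightarrow> gact g f \<in> Fin"
proof (cases g)
  case (Vertex v)
  assume f: "f \<in> Fin"
  have "supp (gact g f) \<subseteq> supp f" by (auto simp: supp_def Vertex)
  then show ?thesis using f by (auto simp: Fin_def intro: finite_subset)
next
  case (Edge e)
  assume f: "f \<in> Fin"
  show ?thesis
  proof (cases "e \<in> arcs E")
    case True
    then show ?thesis using f card_supp_edge(1)[OF True, of f] by (auto simp: Fin_def Edge supp_edge)
  next
    case False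
    then have "gact g f = (\<lambda>_. 0)" by (auto simp: Edge)
    then show ?thesis using Fin_zero by simp
  qed
next
  case (Ghost e)
  assume f: "f \<in> Fin"
  have "supp (gact g f) \<subseteq> cns e ` supp f"
    using nxt_Some by (force simp: supp_def Ghost split: if_splits)
  moreover have "supp (gact g f) \<subseteq> Y" by (auto simp: supp_def Ghost split: if_splits)
  ultimately show ?thesis using f by (auto simp: Fin_def intro: finite_subset)
qed

lemma Fin_act:
  assumes "f \<in> Fin" "a \<in> FA"
  shows "act f a \<in> Fin"
  using assms(2)
proof (induction rule: FA_induct)
  case (word gs c)
  have one: "act f 1 = f" for f using act_cst[of f 1] by simp
  have "act f (prod_list (map gen gs)) \<in> Fin" if "f \<in> Fin" for f
    using that by (induction gs arbitrary: f) (simp_all add: one act_mult act_gen Fin_gact)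
  then show ?case using Fin_scale[OF assms(1)] by (simp add: act_mult act_cst)
qed (simp_all add: act_add act_zero Fin_add Fin_zero)

lemma Fin_\<delta>: "y \<in> Y \<Longrightarrow> \<delta> y \<in> Fin"
  by (simp add: Fin_def supp_def \<delta>_def)

definition path_module :: "('s \<Rightarrow> 'k) ring" where
  "path_module = \<lparr>carrier = Fin, mult = undefined, one = undefined, zero = (\<lambda>_. 0), add = (\<lambda>f g y. f y + g y)\<rparr>"

definition module_act :: "('s \<Rightarrow> 'k) \<Rightarrow> ('v, 'e, 'k) words set \<Rightarrow> 's \<Rightarrow> 'k" where
  "module_act f X = act f (SOME a. a \<in> FA \<and> X = proj a)"

text \<open>The chosen representative does not matter, because \<open>L\<close> acts as
  zero.\<close>

lemma module_act: "a \<in> FA \<Longrightarrow> module_act f (proj a) = act f a"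
proof -
  assume a: "a \<in> FA"
  define b where "b = (SOME b. b \<in> FA \<and> proj a = proj b)"
  have b: "b \<in> FA" "proj a = proj b"
    using someI[of "\<lambda>b. b \<in> FA \<and> proj a = proj b" a] a by (simp_all add: b_def)
  then have "a - b \<in> ker" using proj_eq_iff a lid_ker by (auto simp: lid_def)
  then have "act f (a - b) = (\<lambda>_. 0)" by (simp add: ker_def)
  then have "act f a = act f b" by (simp add: act_diff fun_eq_iff)
  then show ?thesis by (simp add: module_act_def b_def)
qed

lemma path_module_sel: "carrier path_module = Fin" "\<zero>\<^bsub>path_module\<^esub> = (\<lambda>_. 0)"
  "f \<oplus>\<^bsub>path_module\<^esub> g = (\<lambda>y. f y + g y)"
  by (simp_all add: path_module_def)

lemma path_module: "right_rng_module (LPA K E) path_module module_act"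
proof -
  have "abelian_group path_module"
  proof (rule abelian_groupI)
    fix f assume "f \<in> carrier path_module"
    then show "\<exists>g\<in>carrier path_module. g \<oplus>\<^bsub>path_module\<^esub> f = \<zero>\<^bsub>path_module\<^esub>"
      using Fin_scale[of f "- 1"] by (intro bexI[of _ "\<lambda>y. - f y"]) (simp_all add: path_module_sel)
  qed (auto simp: path_module_sel Fin_add Fin_zero add_ac)
  then show ?thesis
    by (intro right_rng_module.intro rng_LPA' right_rng_module_axioms.intro)
      (auto simp: carrier_LPA path_module_sel module_act Fin_act act_add_fun act_add act_mult proj_add proj_mult FA_words)
qed

lemma V_annihilator:
  assumes "v \<in> verts E"
  shows "proj (V v) \<in> module_annihilator (LPA K E) path_module module_act \<longleftrightarrow> v \<notin> src ` Y"
proof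
  assume a: "proj (V v) \<in> module_annihilator (LPA K E) path_module module_act"
  show "v \<notin> src ` Y"
  proof
    assume "v \<in> src ` Y"
    then obtain y where y: "y \<in> Y" "v = src y" by blast
    then have "act (\<delta> y) (V v) = (\<lambda>_. 0)"
      using a Fin_\<delta>[OF y(1)] assms by (auto simp: module_annihilator_def path_module_sel module_act)
    then have "\<delta> y y = 0" using act_\<delta>(1)[OF y(1)] y(2) by simp
    then show False by (simp add: \<delta>_def)
  qed
next
  assume "v \<notin> src ` Y"
  then have "act f (V v) = (\<lambda>_. 0)" for f by (auto simp: V_def act_gen fun_eq_iff)
  then show "proj (V v) \<in> module_annihilator (LPA K E) path_module module_act"
    using assms by (simp add: module_annihilator_def path_module_sel module_act proj_closed)
qed

end

section \<open>The orbit of a single boundary path\<close>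

context leavitt
begin

text \<open>The tail equivalence class of \<open>p\<close>: paths that agree with \<open>p\<close>
  once finitely many edges have been dropped from each. No edge counter is kept, since here the
  powers of a cycle should not be separated.\<close>

inductive_set orbit :: "(nat \<Rightarrow> 'v \<times> 'e option) \<Rightarrow> (nat \<Rightarrow> 'v \<times> 'e option) set" for p where
  base: "p \<in> orbit p"
| shift: "x \<in> orbit p \<Longrightarrow> snd (x 0) = Some e \<Longrightarrow> shift x \<in> orbit p"
| extend: "x \<in> orbit p \<Longrightarrow> e \<in> arcs E \<Longrightarrow> fst (x 0) = head E e \<Longrightarrow> extend e x \<in> orbit p"

lemma boundary_path_orbit: "x \<in> orbit p \<Longrightarrow> boundary_path p \<Longrightarrow> boundary_path x"
  by (induction rule: orbit.induct) (auto intro: boundary_path_shift boundary_path_extend)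

lemma branching_orbit:
  assumes p: "boundary_path p"
  shows "branching E (orbit p) (\<lambda>x. fst (x 0)) (\<lambda>x. snd (x 0)) shift extend"
proof (intro branching.intro branching_axioms.intro leavitt_axioms, goal_cases)
  case (3 x e)
  then show ?case
    using boundary_pathD(3)[OF boundary_path_orbit[OF 3(1) p] 3(2)] orbit.shift[OF 3]
      extend_shift[OF boundary_path_orbit[OF 3(1) p] 3(2)] by (simp add: shift_def)
next
  case (4 e x)
  then show ?case using orbit.extend by simp
qed (use boundary_pathD(1,2) boundary_path_orbit[OF _ p] in blast)+

lemma boundary_path_const:
  assumes "boundary_path x" "snd (x 0) = None"
  shows "x i = x 0"
proof (induction i)
  case (Suc i)
  then show ?case using boundary_pathD(2)[OF assms(1), of i] assms(2) by simp
qed simp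

text \<open>In a nonzero submodule, a nonzero function of least support is supported at one point.
  Up to a scalar it is a point mass, and edges and ghost edges carry it to all other point masses of
  the orbit.\<close>

theorem path_module_simple:
  assumes p: "boundary_path p"
  shows "\<exists>P. primitive_ideal P (LPA K E) \<and>
    (\<forall>v\<in>verts E. proj (V v) \<in> P \<longleftrightarrow> v \<notin> (\<lambda>x. fst (x 0)) ` orbit p)"
proof -
  interpret B: branching E K "orbit p" "\<lambda>x. fst (x 0)" "\<lambda>x. snd (x 0)" shift extend
    by (rule branching_orbit[OF p])
  note bp = boundary_path_orbit[OF _ p]
  \<comment> \<open>If two points of the support differ at index \<open>0\<close>, either their
    sources differ and a vertex separates them, or their first edges differ and the first edge of
    \<open>y\<close> keeps \<open>y\<close> while it kills \<open>z\<close>.\<close>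
  have smaller0: "\<exists>g\<in>N. g \<noteq> (\<lambda>_. 0) \<and> card (B.supp g) < card (B.supp f)"
    if N: "\<And>f a. f \<in> N \<Longrightarrow> a \<in> FA \<Longrightarrow> B.act f a \<in> N" and "N \<subseteq> B.Fin"
      and 0: "f \<in> N" "y \<in> B.supp f" "z \<in> B.supp f" "y 0 \<noteq> z 0" for N f y z
  proof -
    have fin: "finite (B.supp f)" "B.supp f \<subseteq> orbit p" using 0(1) \<open>N \<subseteq> B.Fin\<close> by (auto simp: B.Fin_def)
    then have yz: "boundary_path y" "boundary_path z" "y \<in> orbit p" "z \<in> orbit p" using 0 bp by auto
    show ?thesis
    proof (cases "fst (y 0) = fst (z 0)")
      case False
      define g where "g = B.act f (V (fst (y 0)))"
      have supp: "B.supp g = {x \<in> B.supp f. fst (x 0) = fst (y 0)}"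
        using fin(2) by (auto simp: g_def V_def B.act_gen B.supp_def)
      have "y \<in> B.supp g" "z \<notin> B.supp g" "B.supp g \<subseteq> B.supp f" using 0 False supp by auto
      then have "y \<in> B.supp g" "B.supp g \<subset> B.supp f" using 0 by blast+
      then have "card (B.supp g) < card (B.supp f)" "g \<noteq> (\<lambda>_. 0)"
        using psubset_card_mono[OF fin(1)] by (auto simp: B.supp_def)
      moreover have "g \<in> N"
        unfolding g_def by (rule N[OF 0(1) V_FA[OF boundary_pathD(1)[OF yz(1)]]])
      ultimately show ?thesis by blast
    next
      case True
      \<comment> \<open>At a common sink neither path has a first edge, so they would agree at index
        \<open>0\<close>.\<close>
      have "snd (y 0) \<noteq> None"
      proof
        assume n: "snd (y 0) = None"
        then have "out_arcs E (fst (z 0)) = {}" using boundary_pathD(2)[OF yz(1) n] True by simp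
        then have "snd (z 0) = None" using boundary_pathD(3)[OF yz(2), of 0] by (cases "snd (z 0)") auto
        then show False using n True 0(4) by (simp add: prod_eq_iff)
      qed
      then obtain e where e: "snd (y 0) = Some e" by blast
      then have ez: "snd (z 0) \<noteq> Some e" using True 0(4) by (auto simp: prod_eq_iff)
      have ea: "e \<in> arcs E" using boundary_pathD(3)[OF yz(1) e] by simp
      define g where "g = B.act f (ed e)"
      have g: "g = B.gact (Edge e) f" by (simp add: g_def ed_def B.act_gen)
      have "shift y \<in> B.supp g"
        using B.nxt_Some[OF yz(3) e] 0(2) unfolding g B.supp_edge[OF ea] by simp
      then have "g \<noteq> (\<lambda>_. 0)" by (auto simp: B.supp_def)
      moreover have "extend e ` B.supp g \<subseteq> B.supp f - {z}"
        using ez unfolding g B.supp_edge[OF ea] by auto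
      then have "card (B.supp g) \<le> card (B.supp f - {z})"
        unfolding g using fin(1) by (intro B.card_supp_edge(2)[OF ea]) auto
      moreover have "card (B.supp f - {z}) < card (B.supp f)" using fin(1) 0(3) by (rule card_Diff1_less)
      ultimately show ?thesis using N[OF 0(1) ed_FA[OF ea]] by (intro bexI[of _ g]) (auto simp: g_def)
    qed
  qed
  \<comment> \<open>A common first edge can be stripped without enlarging the support, which lowers
    the index at which the two points differ.\<close>
  have smaller: "\<exists>g\<in>N. g \<noteq> (\<lambda>_. 0) \<and> card (B.supp g) < card (B.supp f)"
    if N: "\<And>f a. f \<in> N \<Longrightarrow> a \<in> FA \<Longrightarrow> B.act f a \<in> N" "N \<subseteq> B.Fin"
      and "f \<in> N" "y \<in> B.supp f" "z \<in> B.supp f" "y i \<noteq> z i" for N f y z i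
    using that(3-)
  proof (induction i arbitrary: f y z)
    case (0 f y z)
    then show ?case using smaller0[of N f y z] N by blast
  next
    case (Suc i f y z)
    show ?case
    proof (cases "y 0 = z 0")
      case False
      then show ?thesis using smaller0[of N f y z] N Suc.prems by blast
    next
      case True
      have fin: "finite (B.supp f)" "B.supp f \<subseteq> orbit p" using Suc.prems(1) N(2) by (auto simp: B.Fin_def)
      then have yz: "boundary_path y" "boundary_path z" "y \<in> orbit p" "z \<in> orbit p" using Suc.prems bp by auto
      have "snd (y 0) \<noteq> None"
      proof
        assume n: "snd (y 0) = None"
        then have "snd (z 0) = None" using True by simp
        from boundary_path_const[OF yz(1) n, of "Suc i"] boundary_path_const[OF yz(2) this, of "Suc i"]
        show False using True Suc.prems(4) by (simp del: One_nat_def)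
      qed
      then obtain e where e: "snd (y 0) = Some e" by blast
      have ea: "e \<in> arcs E" using boundary_pathD(3)[OF yz(1) e] by simp
      define g where "g = B.act f (ed e)"
      have g: "g = B.gact (Edge e) f" by (simp add: g_def ed_def B.act_gen)
      have "shift y \<in> B.supp g" "shift z \<in> B.supp g"
        using B.nxt_Some[OF yz(3) e] B.nxt_Some[OF yz(4), of e] e True Suc.prems(2,3)
        unfolding g B.supp_edge[OF ea] by simp_all
      moreover have "g \<in> N" using N(1)[OF Suc.prems(1) ed_FA[OF ea]] by (simp add: g_def)
      moreover have "shift y i \<noteq> shift z i" using Suc.prems(4) by (simp add: shift_def)
      ultimately obtain g' where g': "g' \<in> N" "g' \<noteq> (\<lambda>_. 0)" "card (B.supp g') < card (B.supp g)"
        using Suc.IH by blast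
      have "extend e ` B.supp g \<subseteq> B.supp f" unfolding g B.supp_edge[OF ea] by auto
      then have "card (B.supp g) \<le> card (B.supp f)"
        unfolding g using fin(1) by (intro B.card_supp_edge(2)[OF ea]) auto
      then show ?thesis using g' by (intro bexI[of _ g']) auto
    qed
  qed
  have simple: "N = {\<lambda>_. 0} \<or> N = B.Fin"
    if sub: "additive_subgroup N B.path_module" and cl: "\<And>f a. f \<in> N \<Longrightarrow> a \<in> FA \<Longrightarrow> B.act f a \<in> N" for N
  proof (rule disjCI)
    interpret N: additive_subgroup N B.path_module by (rule sub)
    have NF: "N \<subseteq> B.Fin" using N.a_subset by (simp add: B.path_module_sel)
    have add: "f \<in> N \<Longrightarrow> g \<in> N \<Longrightarrow> (\<lambda>y. f y + g y) \<in> N" for f g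
      using N.a_closed[of f g] by (simp add: B.path_module_sel)
    have zero: "(\<lambda>_. 0) \<in> N" using N.zero_closed by (simp add: B.path_module_sel)
    assume n: "N \<noteq> B.Fin"
    show "N = {\<lambda>_. 0}"
    proof (rule ccontr)
      assume "N \<noteq> {\<lambda>_. 0}"
      then obtain f0 where f0: "f0 \<in> N \<and> f0 \<noteq> (\<lambda>_. 0)" using zero by blast
      from ex_has_least_nat[of "\<lambda>f. f \<in> N \<and> f \<noteq> (\<lambda>_. 0)", OF f0, of "\<lambda>f. card (B.supp f)"]
      obtain f where ff: "(f \<in> N \<and> f \<noteq> (\<lambda>_. 0)) \<and>
        (\<forall>g. g \<in> N \<and> g \<noteq> (\<lambda>_. 0) \<longrightarrow> card (B.supp f) \<le> card (B.supp g))"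
        by (rule exE)
      have f: "f \<in> N" "f \<noteq> (\<lambda>_. 0)"
        and least: "\<And>g. g \<in> N \<Longrightarrow> g \<noteq> (\<lambda>_. 0) \<Longrightarrow> card (B.supp f) \<le> card (B.supp g)"
        using ff by simp_all
      obtain y where y: "y \<in> B.supp f" using f(2) by (auto simp: B.supp_def)
      have "z = y" if z: "z \<in> B.supp f" for z
      proof (rule ccontr)
        assume "z \<noteq> y"
        then obtain i where i: "z i \<noteq> y i" by blast
        have "\<exists>g\<in>N. g \<noteq> (\<lambda>_. 0) \<and> card (B.supp g) < card (B.supp f)"
          by (rule smaller[OF _ NF f(1) z y i]) (rule cl)
        then obtain g where g: "g \<in> N" "g \<noteq> (\<lambda>_. 0)" "card (B.supp g) < card (B.supp f)"
          by (elim bexE conjE)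
        then show False using least[OF g(1,2)] by simp
      qed
      then have fy: "f z = 0" if "z \<noteq> y" for z using that by (auto simp: B.supp_def)
      have yY: "y \<in> orbit p" using y f(1) NF by (auto simp: B.Fin_def)
      have vy: "fst (y 0) \<in> verts E" using boundary_pathD(1)[OF bp[OF yY]] .
      \<comment> \<open>The vertex fixes the point mass at \<open>y\<close> and brings the scalar
        into \<open>FA\<close>, which contains no nonzero constants.\<close>
      have "B.act f (cst (1 / f y) * V (fst (y 0))) = B.\<delta> y"
      proof
        fix z
        have "B.act f (cst (1 / f y) * V (fst (y 0))) z =
          (if z \<in> orbit p \<and> fst (z 0) = fst (y 0) then 1 / f y * f z else 0)"
          by (simp add: B.act_mult B.act_cst V_def B.act_gen)
        also have "\<dots> = B.\<delta> y z"
          using y yY by (cases "z = y") (simp_all add: B.\<delta>_def B.supp_def fy)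
        finally show "B.act f (cst (1 / f y) * V (fst (y 0))) z = B.\<delta> y z" .
      qed
      then have \<delta>y: "B.\<delta> y \<in> N" using cl[OF f(1), of "cst (1 / f y) * V (fst (y 0))"] vy by simp
      have step: "B.\<delta> x \<in> N \<longleftrightarrow> B.\<delta> (shift x) \<in> N" if x: "x \<in> orbit p" "snd (x 0) = Some e" for x e
      proof -
        note s = B.nxt_Some[OF x]
        have "B.act (B.\<delta> x) (ed e) = B.\<delta> (shift x)" by (rule B.act_\<delta>(2)[OF x])
        moreover have "B.act (B.\<delta> (shift x)) (gh e) = B.\<delta> x" using B.act_\<delta>(3)[of "shift x" e] s by simp
        ultimately show ?thesis using cl[of "B.\<delta> x" "ed e"] cl[of "B.\<delta> (shift x)" "gh e"] s by auto
      qed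
      have all: "B.\<delta> x \<in> N \<longleftrightarrow> B.\<delta> p \<in> N" if "x \<in> orbit p" for x
        using that
      proof induction
        case (shift x e)
        then show ?case using step by blast
      next
        case (extend x e)
        then show ?case using step[of "extend e x" e] B.cns[of e x] by simp
      qed simp
      have \<delta>N: "B.\<delta> x \<in> N" if "x \<in> orbit p" for x using all[OF that] all[OF yY] \<delta>y by blast
      have part: "(\<lambda>z. if z \<in> S then f z else 0) \<in> N" if "finite S" "S \<subseteq> orbit p" for S f
        using that
      proof (induction S)
        case empty
        then show ?case using zero by simp
      next
        case (insert x S)
        have "(\<lambda>z. f x * B.\<delta> x z) = B.act (B.\<delta> x) (cst (f x) * V (fst (x 0)))"
          using B.act_\<delta>(1)[of x] insert.prems by (simp add: B.act_mult B.act_cst B.act_scale)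
        then have "(\<lambda>z. f x * B.\<delta> x z) \<in> N"
          using cl[OF \<delta>N[of x], of "cst (f x) * V (fst (x 0))"] insert.prems boundary_pathD(1)[OF bp[of x]] by simp
        from add[OF this insert.IH] insert
        have "(\<lambda>z. f x * B.\<delta> x z + (if z \<in> S then f z else 0)) \<in> N" by simp
        moreover have "(\<lambda>z. f x * B.\<delta> x z + (if z \<in> S then f z else 0)) = (\<lambda>z. if z \<in> insert x S then f z else 0)"
          using insert.hyps by (intro ext) (auto simp: B.\<delta>_def)
        ultimately show ?case by simp
      qed
      have "f \<in> N" if f: "f \<in> B.Fin" for f
      proof -
        have "(\<lambda>z. if z \<in> B.supp f then f z else 0) = f" by (auto simp: B.supp_def fun_eq_iff)
        then show ?thesis using part[of "B.supp f" f] f by (simp add: B.Fin_def)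
      qed
      then show False using n NF by blast
    qed
  qed
  have "simple_right_module (LPA K E) B.path_module B.module_act"
    unfolding simple_right_module_def
  proof (intro conjI allI impI)
    show "right_rng_module (LPA K E) B.path_module B.module_act" by (rule B.path_module)
    have v: "fst (p 0) \<in> verts E" using boundary_pathD(1)[OF p] .
    have "B.module_act (B.\<delta> p) (proj (V (fst (p 0)))) = B.\<delta> p"
      using B.act_\<delta>(1)[OF orbit.base] v by (simp add: B.module_act)
    moreover have "B.\<delta> p p \<noteq> 0" by (simp add: B.\<delta>_def)
    then have "B.\<delta> p \<noteq> (\<lambda>_. 0)" by auto
    ultimately show "\<exists>m\<in>carrier B.path_module. \<exists>a\<in>carrier (LPA K E). B.module_act m a \<noteq> \<zero>\<^bsub>B.path_module\<^esub>"
      using B.Fin_\<delta>[OF orbit.base] proj_closed[OF V_FA[OF v]] unfolding B.path_module_sel by metis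
    fix N assume N: "additive_subgroup N B.path_module \<and> (\<forall>n\<in>N. \<forall>a\<in>carrier (LPA K E). B.module_act n a \<in> N)"
    have "B.act f a \<in> N" if "f \<in> N" "a \<in> FA" for f a
      using N that proj_closed[OF that(2)] B.module_act[OF that(2)] by metis
    then show "N = {\<zero>\<^bsub>B.path_module\<^esub>} \<or> N = carrier B.path_module"
      using simple N unfolding B.path_module_sel by blast
  qed
  then show ?thesis using primitive_idealI B.V_annihilator by blast
qed

text \<open>All vertices of an orbit path connect to \<open>p\<close>, which is why the induction
  runs over every index \<open>j\<close>. Conversely the orbit contains the shifts of
  \<open>p\<close>, and these can be extended backwards along any walk.\<close>

lemma orbit_sources:
  assumes p: "boundary_path p"
  shows "(\<lambda>x. fst (x 0)) ` orbit p = {w \<in> verts E. \<exists>i. connects E w (fst (p i))}"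
proof (intro equalityI subsetI)
  fix w assume "w \<in> (\<lambda>x. fst (x 0)) ` orbit p"
  then obtain x where x: "x \<in> orbit p" "w = fst (x 0)" by blast
  have refl: "connects E u u" if "u \<in> verts E" for u
    using that awalk_Nil_iff unfolding connects_def by blast
  have "\<exists>i. connects E (fst (x j)) (fst (p i))" for j
    using x(1)
  proof (induction arbitrary: j)
    case base
    then show ?case using refl boundary_pathD(1)[OF p] by blast
  next
    case (shift x e)
    then show ?case by (simp add: shift_def)
  next
    case (extend x e)
    show ?case
    proof (cases j)
      case 0
      have "awalk (tail E e) [e] (head E e)" using extend by (simp add: awalk_Cons_iff awalk_Nil_iff)
      then have "connects E (tail E e) (head E e)" unfolding connects_def by blast
      moreover obtain i where "connects E (head E e) (fst (p i))" using extend.IH[of 0] extend.hyps by auto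
      ultimately show ?thesis using connects_trans 0 by auto
    qed (use extend.IH in auto)
  qed
  then show "w \<in> {w \<in> verts E. \<exists>i. connects E w (fst (p i))}"
    using x boundary_pathD(1)[OF boundary_path_orbit[OF x(1) p]] by auto
next
  fix w assume "w \<in> {w \<in> verts E. \<exists>i. connects E w (fst (p i))}"
  then obtain i q where q: "awalk w q (fst (p i))" by (auto simp: connects_def)
  have "\<exists>x\<in>orbit p. x 0 = p i"
  proof -
    have "\<exists>x\<in>orbit p. \<forall>j. x j = p (i + j)"
    proof (induction i)
      case (Suc i)
      then obtain x where x: "x \<in> orbit p" "\<forall>j. x j = p (i + j)" by blast
      show ?case
      proof (cases "snd (x 0)")
        case None
        then have "x (Suc j) = x j" for j
          using boundary_path_const[OF boundary_path_orbit[OF x(1) p]] by metis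
        then have "x j = p (Suc i + j)" for j using x(2)[rule_format, of "Suc j"] by simp
        then show ?thesis using x(1) by blast
      next
        case (Some e)
        then show ?thesis using x orbit.shift[OF x(1)] by (intro bexI[of _ "shift x"]) (simp_all add: shift_def)
      qed
    qed (auto intro: orbit.base)
    then show ?thesis by (metis add_0_right)
  qed
  then obtain x where x: "x \<in> orbit p" "fst (x 0) = fst (p i)" by metis
  have "\<exists>x\<in>orbit p. fst (x 0) = w" using q
  proof (induction q arbitrary: w)
    case Nil
    then show ?case using x by (auto simp: awalk_Nil_iff)
  next
    case (Cons e q)
    then have e: "e \<in> arcs E" "w = tail E e" "awalk (head E e) q (fst (p i))" by (auto simp: awalk_Cons_iff)
    then obtain x where "x \<in> orbit p" "fst (x 0) = head E e" using Cons.IH by blast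
    then show ?case using orbit.extend[of x p e] e by (intro bexI[of _ "extend e x"]) auto
  qed
  then show "w \<in> (\<lambda>x. fst (x 0)) ` orbit p" by blast
qed

text \<open>Each vertex of the path connects to all later ones, so two vertices that reach the path
  at \<open>i\<close> and \<open>j\<close> both reach it at \<open>i + j\<close>.\<close>

lemma boundary_path_tail:
  assumes x: "boundary_path x"
  shows "{w \<in> verts E. \<exists>i. connects E w (fst (x i))} \<in> maximal_tails E"
proof -
  have refl: "connects E u u" if "u \<in> verts E" for u
    using that awalk_Nil_iff unfolding connects_def by blast
  have next_con: "connects E (fst (x i)) (fst (x (Suc i)))" for i
  proof (cases "snd (x i)")
    case None
    then show ?thesis using boundary_pathD[OF x, of i] refl by simp
  next
    case (Some e)
    then have "awalk (fst (x i)) [e] (fst (x (Suc i)))"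
      using boundary_pathD(3)[OF x Some] by (auto simp: awalk_Cons_iff awalk_Nil_iff)
    then show ?thesis unfolding connects_def by blast
  qed
  have con: "connects E (fst (x i)) (fst (x (i + k)))" for i k
    by (induction k) (use refl boundary_pathD(1)[OF x] next_con connects_trans in \<open>auto intro: connects_trans\<close>)
  define M where "M = {w \<in> verts E. \<exists>i. connects E w (fst (x i))}"
  have xM: "fst (x i) \<in> M" for i using refl boundary_pathD(1)[OF x] by (auto simp: M_def)
  have "M \<in> maximal_tails E"
    unfolding maximal_tails_def
  proof (rule CollectI, intro conjI ballI impI)
    show "M \<subseteq> verts E" by (auto simp: M_def)
    show "M \<noteq> {}" using xM by blast
  next
    fix v w assume "v \<in> verts E" "w \<in> M" "connects E v w"
    then show "v \<in> M" using connects_trans unfolding M_def by blast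
  next
    fix v assume v: "v \<in> M" "out_arcs E v \<noteq> {}"
    then obtain i q where q: "awalk v q (fst (x i))" by (auto simp: M_def connects_def)
    show "\<exists>e\<in>arcs E. tail E e = v \<and> head E e \<in> M"
    proof (cases q)
      case Nil
      then have vi: "v = fst (x i)" using q by (simp add: awalk_Nil_iff)
      then obtain e where "snd (x i) = Some e" using boundary_pathD(2)[OF x] v(2) by blast
      then show ?thesis using boundary_pathD(3)[OF x] vi xM[of "Suc i"] by metis
    next
      case (Cons e q')
      then have "e \<in> arcs E" "v = tail E e" "awalk (head E e) q' (fst (x i))" using q by (auto simp: awalk_Cons_iff)
      then show ?thesis unfolding M_def connects_def by blast
    qed
  next
    fix v w assume "v \<in> M" "w \<in> M"
    then obtain i j where "connects E v (fst (x i))" "connects E w (fst (x j))" by (auto simp: M_def)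
    then have "connects E v (fst (x (i + j)))" "connects E w (fst (x (i + j)))"
      using con[of i j] con[of j i] connects_trans by (auto simp: add.commute)
    then show "\<exists>y\<in>M. connects E v y \<and> connects E w y" using xM by blast
  qed
  then show ?thesis by (simp add: M_def)
qed

text \<open>For each of the finitely many maximal tails \<open>t\<close> properly inside
  \<open>M\<close>, a vertex of \<open>M\<close> outside \<open>t\<close> is chosen. By directedness
  these vertices all connect to one \<open>y \<in> M\<close>. The tail of a path in \<open>M\<close>
  that starts at \<open>y\<close> contains all of them, so it is none of the smaller tails.\<close>

lemma finite_tails_path:
  assumes fin: "finite (maximal_tails E)" and M: "M \<in> maximal_tails E"
  shows "\<exists>x. boundary_path x \<and> {w \<in> verts E. \<exists>i. connects E w (fst (x i))} = M"
proof (rule ccontr)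
  assume n: "\<not> ?thesis"
  have refl: "connects E u u" if "u \<in> verts E" for u
    using that awalk_Nil_iff unfolding connects_def by blast
  note MD = maximal_tailsD[OF M]
  define T where "T = {T \<in> maximal_tails E. T \<subset> M}"
  define g where "g t = (SOME v. v \<in> M - t)" for t
  have g: "g t \<in> M - t" if "t \<in> T" for t
    unfolding g_def by (rule someI_ex) (use that in \<open>auto simp: T_def\<close>)
  have "finite (g ` T)" using fin by (simp add: T_def)
  moreover have "\<exists>y\<in>M. \<forall>s\<in>S. connects E s y" if "finite S" "S \<subseteq> M" for S
    using that
  proof (induction S)
    case empty
    then show ?case using MD(2) by blast
  next
    case (insert s S)
    then obtain y where y: "y \<in> M" "\<forall>s\<in>S. connects E s y" by blast
    obtain z where "z \<in> M" "connects E s z" "connects E y z" using MD(5)[of s y] insert y by blast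
    then show ?case using y connects_trans by (intro bexI[of _ z]) auto
  qed
  moreover have "g ` T \<subseteq> M" using g by blast
  ultimately obtain y where y: "y \<in> M" "\<forall>s\<in>g ` T. connects E s y" by metis
  obtain x where x: "x \<in> tail_paths M" "fst (x 0) = y" using tail_paths_exist[OF M y(1)] by blast
  then have bx: "boundary_path x" "\<And>i. fst (x i) \<in> M" by (auto simp: tail_paths_def)
  define Tx where "Tx = {w \<in> verts E. \<exists>i. connects E w (fst (x i))}"
  have "Tx \<subseteq> M" using MD(3) bx(2) by (auto simp: Tx_def)
  moreover have "Tx \<noteq> M" using n bx(1) by (auto simp: Tx_def)
  ultimately have TxT: "Tx \<in> T" using boundary_path_tail[OF bx(1)] by (auto simp: T_def Tx_def)
  have "connects E (g Tx) (fst (x 0))" using y(2) TxT x(2) by blast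
  then have "g Tx \<in> Tx" using g[OF TxT] MD(1) by (auto simp: Tx_def)
  then show False using g[OF TxT] by blast
qed

end

section \<open>Strata\<close>

lemma cring_type_ring: "cring (type_ring :: 'a::comm_ring_1 ring)"
proof (rule cringI)
  show "abelian_group (type_ring :: 'a ring)"
    by (rule abelian_groupI) (auto simp: type_ring_def algebra_simps intro: exI[of _ "- x" for x])
  show "comm_monoid (type_ring :: 'a ring)"
    by (rule comm_monoidI) (simp_all add: type_ring_def algebra_simps)
qed (simp add: type_ring_def algebra_simps)

lemma Spec_field_ring: "Spec (field_ring (K :: 'k::field itself)) = {{0}}"
proof -
  interpret cring "field_ring K" unfolding field_ring_def by (rule cring_type_ring)
  have "P = {0}" if "primeideal P (field_ring K)" for P
  proof -
    interpret P: primeideal P "field_ring K" by fact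
    have "x = 0" if x: "x \<in> P" for x
    proof (rule ccontr)
      assume "x \<noteq> 0"
      then have "y \<in> P" for y
        using P.I_l_closed[OF x, of "y / x"] by (simp add: field_ring_def type_ring_def)
      then show False using P.I_notcarr by (auto simp: field_ring_def type_ring_def)
    qed
    moreover have "0 \<in> P" using P.zero_closed by (simp add: field_ring_def type_ring_def)
    ultimately show ?thesis by blast
  qed
  moreover have "primeideal {0} (field_ring K)"
  proof (rule primeidealI)
    show "ideal {0} (field_ring K)" using zeroideal by (simp add: field_ring_def type_ring_def)
    show "cring (field_ring K)" by (rule cring_axioms)
    have "(1 :: 'k) \<in> carrier (field_ring K)" "(1 :: 'k) \<notin> {0}" by (simp_all add: field_ring_def type_ring_def)
    then show "carrier (field_ring K) \<noteq> {0}" by metis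
  qed (simp add: field_ring_def type_ring_def)
  ultimately show ?thesis unfolding Spec_eq_primeideals by blast
qed

lemma homeomorphic_space_singletons:
  assumes "topspace X = {a}" "topspace Y = {b}"
  shows "X homeomorphic_space Y"
  unfolding homeomorphic_space_def homeomorphic_maps_def
  by (intro exI[of _ "\<lambda>_. b"] exI[of _ "\<lambda>_. a"]) (simp add: assms)

context leavitt
begin

lemma Spec_in_stratum:
  assumes "P \<in> Spec (LPA K E)"
  shows "\<exists>M\<in>maximal_tails E. P \<in> stratum K E M"
proof -
  note P = SpecD[OF assms]
  interpret P: leavitt_ideal E K "pre P" by (rule leavitt_idealI[OF P(2)])
  have "{v \<in> verts E. V v \<notin> pre P} \<in> maximal_tails E"
    by (rule P.prime_maximal_tail[OF P(3,5)])
  then show ?thesis using assms by (intro bexI) (auto simp: stratum_iff)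
qed

lemma stratum_vertices_unique:
  assumes "M \<in> maximal_tails E" "M' \<in> maximal_tails E" "P \<in> stratum K E M" "P \<in> stratum K E M'"
  shows "M = M'"
  using assms maximal_tailsD(1)[OF assms(1)] maximal_tailsD(1)[OF assms(2)] by (auto simp: stratum_iff)

lemma tail_ideal_stratum:
  assumes M: "M \<in> maximal_tails E" and P: "P \<in> stratum K E M"
  shows "tail_ideal M \<subseteq> pre P"
  using P SpecD(2) by (intro tail_ideal_least) (auto simp: stratum_iff[OF M])

text \<open>An ideal that is not inside the tail ideal contains a vertex of \<open>M\<close>. A
  prime in the stratum contains no such vertex, so it equals the tail ideal. Conversely, two ideals
  outside the tail ideal contain vertices of \<open>M\<close> and hence a common successor
  \<open>V y\<close>. Their product then contains the idempotent \<open>V y\<close>, which the tail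
  ideal omits; so it is prime.\<close>

lemma gamma_stratum:
  assumes M: "M \<in> maximal_tails_gamma E"
  shows "stratum K E M = {proj ` tail_ideal M}"
proof -
  have M': "M \<in> maximal_tails E" using M by (simp add: maximal_tails_gamma_def)
  note lidI = lid_tail_ideal[of M]
  interpret I: leavitt_ideal E K "tail_ideal M" by (rule leavitt_idealI[OF lidI])
  have vertex: "\<exists>u\<in>M. V u \<in> J" if J: "lid J" and a: "a \<in> J" "a \<notin> tail_ideal M" for J a
  proof -
    interpret J: leavitt_ideal E K J by (rule leavitt_idealI[OF J])
    show ?thesis
      by (rule J.ideal_contains_vertex[OF I.leavitt_ideal_axioms V_tail_ideal[OF M'] gamma_exit[OF M] a])
  qed
  have "P = proj ` tail_ideal M" if P: "P \<in> stratum K E M" for P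
  proof -
    have PS: "P \<in> Spec (LPA K E)" and PM: "\<forall>v\<in>verts E. V v \<in> pre P \<longleftrightarrow> v \<notin> M"
      using P by (simp_all add: stratum_iff[OF M'])
    have "pre P \<subseteq> tail_ideal M"
    proof (rule subsetI, rule ccontr)
      fix a assume "a \<in> pre P" "a \<notin> tail_ideal M"
      then obtain u where "u \<in> M" "V u \<in> pre P" using vertex[OF SpecD(2)[OF PS]] by blast
      then show False using PM maximal_tailsD(1)[OF M'] by blast
    qed
    then show ?thesis using tail_ideal_stratum[OF M' P] SpecD(4)[OF PS] by blast
  qed
  moreover have "proj ` tail_ideal M \<in> stratum K E M"
  proof -
    note T = ideal_proj[OF lidI]
    have "rng_prime_ideal (proj ` tail_ideal M) (LPA K E)"
      unfolding rng_prime_ideal_def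
    proof (intro conjI allI impI)
      show "rng_ideal (proj ` tail_ideal M) (LPA K E)" by (rule T(1))
      obtain u where u: "u \<in> M" "u \<in> verts E" using maximal_tailsD(1,2)[OF M'] by blast
      then have "proj (V u) \<notin> proj ` tail_ideal M" using proj_mem_iff[OF lidI] V_tail_ideal[OF M'] by simp
      then show "proj ` tail_ideal M \<noteq> carrier (LPA K E)" using proj_closed[OF V_FA[OF u(2)]] by blast
      fix J1 J2
      assume J: "rng_ideal J1 (LPA K E) \<and> rng_ideal J2 (LPA K E) \<and> J1 \<cdot>\<^bsub>LPA K E\<^esub> J2 \<subseteq> proj ` tail_ideal M"
      show "J1 \<subseteq> proj ` tail_ideal M \<or> J2 \<subseteq> proj ` tail_ideal M"
      proof (rule ccontr)
        assume n: "\<not> (J1 \<subseteq> proj ` tail_ideal M \<or> J2 \<subseteq> proj ` tail_ideal M)"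
        have u: "\<exists>u\<in>M. V u \<in> pre J" if J: "rng_ideal J (LPA K E)" "\<not> J \<subseteq> proj ` tail_ideal M" for J
        proof -
          obtain X where X: "X \<in> J" "X \<notin> proj ` tail_ideal M" using J(2) by blast
          obtain a where a: "a \<in> pre J" "X = proj a"
            using subsetD[OF equalityD1[OF lid_pre(2)[OF J(1)]] X(1)] by blast
          then have "a \<notin> tail_ideal M" using X(2) by blast
          then show ?thesis by (rule vertex[OF lid_pre(1)[OF J(1)] a(1)])
        qed
        obtain u where u1: "u \<in> M" "V u \<in> pre J1" using u[OF conjunct1[OF J]] n by blast
        obtain w where u2: "w \<in> M" "V w \<in> pre J2" using u[OF conjunct1[OF conjunct2[OF J]]] n by blast
        obtain y where y: "y \<in> M" "connects E u y" "connects E w y" using maximal_tailsD(5)[OF M' u1(1) u2(1)] by blast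
        have yv: "y \<in> verts E" using y(1) maximal_tailsD(1)[OF M'] by blast
        interpret J1: leavitt_ideal E K "pre J1" by (rule leavitt_idealI[OF lid_pre(1)[OF conjunct1[OF J]]])
        interpret J2: leavitt_ideal E K "pre J2"
          by (rule leavitt_idealI[OF lid_pre(1)[OF conjunct1[OF conjunct2[OF J]]]])
        have "proj (V y) \<in> J1" "proj (V y) \<in> J2"
          using J1.V_mem_connects[OF y(2) u1(2)] J2.V_mem_connects[OF y(3) u2(2)] by (simp_all add: pre_def)
        then have "proj (V y) \<otimes>\<^bsub>LPA K E\<^esub> proj (V y) \<in> proj ` tail_ideal M"
          by (rule subsetD[OF conjunct2[OF conjunct2[OF J]] ideal_prod.prod])
        then have "V y * V y \<in> tail_ideal M"
          using proj_mem_iff[OF lidI, of "V y * V y"] yv by (simp add: proj_mult FA_words)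
        then have "V y \<in> tail_ideal M" using I.cg_mem[OF I.vertex_edge(1)[OF yv]] by blast
        then show False using V_tail_ideal[OF M' yv] y(1) by blast
      qed
    qed
    then show ?thesis
      using V_tail_ideal[OF M'] by (simp add: stratum_iff[OF M'] Spec_def T(2))
  qed
  ultimately show ?thesis by blast
qed

lemma cong_mod_proj:
  assumes "lid J" "f \<in> FA" "g \<in> FA"
  shows "rng.cong_mod (LPA K E) (proj ` J) (proj f) (proj g) \<longleftrightarrow> f - g \<in> J"
proof -
  interpret R: rng "LPA K E" by (rule rng_LPA')
  show ?thesis using assms proj_mem_iff[of J "f - g"] by (simp add: R.cong_mod_def proj_closed proj_minus)
qed

text \<open>Multiplicativity and surjectivity of the evaluation at the cycle come from the absence
  of exits, injectivity from the action on the periodic boundary path.\<close>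

lemma tau_corner:
  assumes c: "no_exit_cycle M v c"
  shows "commutative_corner (LPA K E) (proj ` tail_ideal M) (laurent_ring K) (proj (V v))
    (\<lambda>f. proj (laurent_eval v c f))"
proof -
  note lidI = lid_tail_ideal[of M]
  have M: "M \<in> maximal_tails E" and c': "awalk v c v" using c by (auto simp: no_exit_cycle_def)
  have v: "v \<in> verts E" using awalkD[OF c'] by simp
  interpret I: leavitt_ideal E K "tail_ideal M" by (rule leavitt_idealI[OF lidI])
  have IM: "V u \<in> tail_ideal M" if "u \<in> verts E" "u \<notin> M" for u using that V_tail_ideal[OF M] by blast
  note FA = laurent_eval_FA[OF c']
  note cg = cong_mod_proj[OF lidI]
  have sel: "carrier (laurent_ring K) = UNIV" "\<one>\<^bsub>laurent_ring K\<^esub> = 1" "\<zero>\<^bsub>laurent_ring K\<^esub> = 0"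
    "f \<oplus>\<^bsub>laurent_ring K\<^esub> g = f + g" "f \<otimes>\<^bsub>laurent_ring K\<^esub> g = f * g" for f g
    by (simp_all add: laurent_ring_def type_ring_def)
  show ?thesis
  proof (intro commutative_corner.intro locally_unital_LPA ideal_proj(1)[OF lidI] commutative_corner_axioms.intro)
    show "cring (laurent_ring K)" unfolding laurent_ring_def by (rule cring_type_ring)
    show "proj (V v) \<in> carrier (LPA K E)" using v by (simp add: proj_closed)
    show "proj (V v) \<otimes>\<^bsub>LPA K E\<^esub> proj (V v) = proj (V v)"
    proof -
      interpret L: leavitt_ideal E K L by (rule leavitt_idealI) (simp add: lid_def L_ideal)
      show ?thesis using v L.vertex_edge(1)[OF v] by (simp add: proj_mult proj_eq_iff L.cg_def FA_words)
    qed
    fix f g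
    show "proj (laurent_eval v c f) \<in> carrier (LPA K E)" using FA by (simp add: proj_closed)
    show "proj (laurent_eval v c \<one>\<^bsub>laurent_ring K\<^esub>) = proj (V v)" by (simp add: sel laurent_eval_one)
    show "rng.cong_mod (LPA K E) (proj ` tail_ideal M) (proj (laurent_eval v c (f \<oplus>\<^bsub>laurent_ring K\<^esub> g)))
      (proj (laurent_eval v c f) \<oplus>\<^bsub>LPA K E\<^esub> proj (laurent_eval v c g))"
      using I.P_basic(2) FA by (simp add: sel proj_add cg laurent_eval_add)
    show "rng.cong_mod (LPA K E) (proj ` tail_ideal M) (proj (laurent_eval v c (f \<otimes>\<^bsub>laurent_ring K\<^esub> g)))
      (proj (laurent_eval v c f) \<otimes>\<^bsub>LPA K E\<^esub> proj (laurent_eval v c g))"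
      using I.laurent_eval_mult[OF c IM] FA by (simp add: sel proj_mult cg I.cg_def FA_words)
    show "f = \<zero>\<^bsub>laurent_ring K\<^esub>" if "proj (laurent_eval v c f) \<in> proj ` tail_ideal M"
      using that laurent_eval_tail_ideal[OF c] proj_mem_iff[OF lidI] FA by (simp add: sel)
  next
    fix x assume "x \<in> carrier (LPA K E)"
    then obtain a where a: "a \<in> FA" "x = proj a" by (auto simp: carrier_LPA)
    obtain f where f: "V v * a * V v - laurent_eval v c f \<in> tail_ideal M"
      using I.laurent_eval_surj[OF c IM a(1)] by (auto simp: I.cg_def)
    then show "\<exists>f\<in>carrier (laurent_ring K). rng.cong_mod (LPA K E) (proj ` tail_ideal M)
      (proj (V v) \<otimes>\<^bsub>LPA K E\<^esub> x \<otimes>\<^bsub>LPA K E\<^esub> proj (V v)) (proj (laurent_eval v c f))"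
      using a v FA by (intro bexI[of _ f]) (simp_all add: sel proj_mult cg FA_words)
  qed
qed

text \<open>Every vertex of \<open>M\<close> connects to \<open>v\<close>, so a prime that misses
  \<open>v\<close> misses all of \<open>M\<close>.\<close>

lemma tau_stratum:
  assumes c: "no_exit_cycle M v c"
  shows "stratum K E M =
    {P \<in> Spec (LPA K E). proj ` tail_ideal M \<subseteq> P \<and> proj (V v) \<notin> P}"
proof -
  have M: "M \<in> maximal_tails E" and vM: "v \<in> M" and c': "awalk v c v" using c by (auto simp: no_exit_cycle_def)
  have v: "v \<in> verts E" using awalkD[OF c'] by simp
  have "P \<in> stratum K E M \<longleftrightarrow> proj ` tail_ideal M \<subseteq> P \<and> proj (V v) \<notin> P" if P: "P \<in> Spec (LPA K E)" for P
  proof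
    assume PM: "P \<in> stratum K E M"
    have "proj ` tail_ideal M \<subseteq> P"
      using tail_ideal_stratum[OF M PM] SpecD(4)[OF P] by blast
    moreover have "V v \<notin> pre P" using PM vM v by (simp add: stratum_iff[OF M])
    ultimately show "proj ` tail_ideal M \<subseteq> P \<and> proj (V v) \<notin> P" using v by (simp add: pre_def)
  next
    assume a: "proj ` tail_ideal M \<subseteq> P \<and> proj (V v) \<notin> P"
    interpret P: leavitt_ideal E K "pre P" by (rule leavitt_idealI[OF SpecD(2)[OF P]])
    have "V u \<in> pre P \<longleftrightarrow> u \<notin> M" if u: "u \<in> verts E" for u
    proof
      show "V u \<in> pre P" if "u \<notin> M"
        using that u a V_tail_ideal[OF M u] by (auto simp: pre_def)
      show "u \<notin> M" if "V u \<in> pre P"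
        using P.V_mem_connects[OF connects_to_cycle[OF c] that] a by (auto simp: pre_def)
    qed
    then show "P \<in> stratum K E M" using P by (simp add: stratum_iff[OF M])
  qed
  moreover have "stratum K E M \<subseteq> Spec (LPA K E)" by (auto simp: stratum_def)
  ultimately show ?thesis by blast
qed

theorem tau_homeomorphic:
  assumes "M \<in> maximal_tails_tau E"
  shows "stratum_space K E M homeomorphic_space zariski (laurent_ring K)"
proof -
  obtain v c where c: "no_exit_cycle M v c" using tau_no_exit_cycle[OF assms] by blast
  interpret C: commutative_corner "LPA K E" "proj ` tail_ideal M" "laurent_ring K" "proj (V v)"
    "\<lambda>f. proj (laurent_eval v c f)" by (rule tau_corner[OF c])
  show ?thesis
    using C.corner_homeomorphic by (simp add: stratum_space_def tau_stratum[OF c] C.corner_primes_def)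
qed

theorem gamma_homeomorphic:
  assumes "M \<in> maximal_tails_gamma E"
  shows "stratum_space K E M homeomorphic_space zariski (field_ring K)"
proof (rule homeomorphic_space_singletons)
  interpret F: cring "field_ring K" unfolding field_ring_def by (rule cring_type_ring)
  have "stratum K E M \<subseteq> Spec (LPA K E)" by (auto simp: stratum_def)
  then show "topspace (stratum_space K E M) = {proj ` tail_ideal M}"
    using gamma_stratum[OF assms] by (auto simp: stratum_space_def rng.topspace_zariski[OF rng_LPA'])
  show "topspace (zariski (field_ring K)) = {{0}}"
    by (simp add: rng.topspace_zariski[OF F.rng] Spec_field_ring)
qed

text \<open>If all cycles of \<open>M\<close> have exits, the stratum is a single point, so
  maximality is automatic and primitivity is what needs an argument: the annihilator of the path
  module is a prime that omits the same vertices, hence it is that point.\<close>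

theorem primitive_iff_maximal_in_stratum:
  assumes fin: "finite (maximal_tails E)"
  shows "primitive_ideal P (LPA K E) \<longleftrightarrow> P \<in> Spec (LPA K E) \<and>
    (\<exists>M\<in>maximal_tails E. P \<in> stratum K E M \<and> (\<forall>Q\<in>stratum K E M. P \<subseteq> Q \<longrightarrow> Q = P))"
proof
  interpret R: locally_unital_rng "LPA K E" by (rule locally_unital_LPA)
  assume prim: "primitive_ideal P (LPA K E)"
  then have P: "P \<in> Spec (LPA K E)" using R.primitive_imp_prime by (simp add: Spec_def)
  obtain M where M: "M \<in> maximal_tails E" "P \<in> stratum K E M" using Spec_in_stratum[OF P] by blast
  have "Q = P" if Q: "Q \<in> stratum K E M" "P \<subseteq> Q" for Q
  proof (cases "M \<in> maximal_tails_gamma E")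
    case True
    then show ?thesis using M(2) Q(1) by (simp add: gamma_stratum)
  next
    case False
    then obtain v c where c: "no_exit_cycle M v c"
      using tau_no_exit_cycle M(1) unfolding maximal_tails_tau_def by blast
    interpret C: commutative_corner "LPA K E" "proj ` tail_ideal M" "laurent_ring K" "proj (V v)"
      "\<lambda>f. proj (laurent_eval v c f)" by (rule tau_corner[OF c])
    have "stratum K E M = C.corner_primes" by (simp add: tau_stratum[OF c] C.corner_primes_def)
    then show ?thesis using M(2) Q by (intro C.primitive_imp_maximal[OF _ prim]) simp_all
  qed
  then show "P \<in> Spec (LPA K E) \<and>
    (\<exists>M\<in>maximal_tails E. P \<in> stratum K E M \<and> (\<forall>Q\<in>stratum K E M. P \<subseteq> Q \<longrightarrow> Q = P))"
    using P M by (intro conjI bexI[of _ M]) simp_all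
next
  interpret R: locally_unital_rng "LPA K E" by (rule locally_unital_LPA)
  assume "P \<in> Spec (LPA K E) \<and>
    (\<exists>M\<in>maximal_tails E. P \<in> stratum K E M \<and> (\<forall>Q\<in>stratum K E M. P \<subseteq> Q \<longrightarrow> Q = P))"
  then obtain M where M: "M \<in> maximal_tails E" "P \<in> stratum K E M"
    and max: "\<And>Q. Q \<in> stratum K E M \<Longrightarrow> P \<subseteq> Q \<Longrightarrow> Q = P" by blast
  show "primitive_ideal P (LPA K E)"
  proof (cases "M \<in> maximal_tails_gamma E")
    case True
    obtain x where x: "boundary_path x" "{w \<in> verts E. \<exists>i. connects E w (fst (x i))} = M"
      using finite_tails_path[OF fin M(1)] by blast
    obtain Q where Q: "primitive_ideal Q (LPA K E)" "\<forall>v\<in>verts E. proj (V v) \<in> Q \<longleftrightarrow> v \<notin> M"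
      using path_module_simple[OF x(1)] unfolding orbit_sources[OF x(1)] x(2) by blast
    have "Q \<in> Spec (LPA K E)" using R.primitive_imp_prime[OF Q(1)] by (simp add: Spec_def)
    then have "Q \<in> stratum K E M" using Q(2) by (simp add: stratum_iff[OF M(1)] pre_def)
    then have "Q = P" using M(2) by (simp add: gamma_stratum[OF True])
    then show ?thesis using Q(1) by simp
  next
    case False
    then obtain v c where c: "no_exit_cycle M v c"
      using tau_no_exit_cycle M(1) unfolding maximal_tails_tau_def by blast
    interpret C: commutative_corner "LPA K E" "proj ` tail_ideal M" "laurent_ring K" "proj (V v)"
      "\<lambda>f. proj (laurent_eval v c f)" by (rule tau_corner[OF c])
    have "stratum K E M = C.corner_primes" by (simp add: tau_stratum[OF c] C.corner_primes_def)
    then show ?thesis using M(2) max by (intro C.maximal_imp_primitive) simp_all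
  qed
qed

end

theorem theorem2:
  fixes K :: "'k::field itself" and E :: "('v, 'e) pre_digraph"
  assumes "wf_digraph E" and "row_finite E"
  shows
    "(Spec (LPA K E) = (\<Union>M\<in>maximal_tails E. stratum K E M) \<and>
      disjoint_family_on (stratum K E) (maximal_tails E)) \<and>
     (\<forall>M\<in>maximal_tails_tau E.
        stratum_space K E M homeomorphic_space zariski (laurent_ring K)) \<and>
     (\<forall>M\<in>maximal_tails E - maximal_tails_tau E.
        stratum_space K E M homeomorphic_space zariski (field_ring K)) \<and>
     (finite (maximal_tails E) \<longrightarrow>
        (finite (stratum K E ` maximal_tails E) \<and>
         Spec (LPA K E) = \<Union> (stratum K E ` maximal_tails E)) \<and>
        (\<forall>M\<in>maximal_tails E.
           stratum_space K E M homeomorphic_space zariski (field_ring K) \<or>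
           stratum_space K E M homeomorphic_space zariski (laurent_ring K)) \<and>
        {P. primitive_ideal P (LPA K E)} =
          {P \<in> Spec (LPA K E). \<exists>M\<in>maximal_tails E. P \<in> stratum K E M \<and>
             (\<forall>Q\<in>stratum K E M. P \<subseteq> Q \<longrightarrow> Q = P)})"
proof -
  interpret leavitt E K
    using assms by (intro leavitt.intro leavitt_axioms.intro)
  have union: "Spec (LPA K E) = (\<Union>M\<in>maximal_tails E. stratum K E M)"
    using Spec_in_stratum by (auto simp: stratum_def)
  have disjoint: "disjoint_family_on (stratum K E) (maximal_tails E)"
    unfolding disjoint_family_on_def using stratum_vertices_unique by blast
  have gamma: "stratum_space K E M homeomorphic_space zariski (field_ring K)"
    if "M \<in> maximal_tails E - maximal_tails_tau E" for M
    using that by (intro gamma_homeomorphic) (auto simp: maximal_tails_tau_def)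
  have primitive: "{P. primitive_ideal P (LPA K E)} =
      {P \<in> Spec (LPA K E). \<exists>M\<in>maximal_tails E. P \<in> stratum K E M \<and>
        (\<forall>Q\<in>stratum K E M. P \<subseteq> Q \<longrightarrow> Q = P)}" if "finite (maximal_tails E)"
    using primitive_iff_maximal_in_stratum[OF that] by (intro Collect_cong)
  show ?thesis
    using union disjoint tau_homeomorphic gamma primitive
    by (intro conjI ballI impI) (auto simp: maximal_tails_tau_def)
qed

end
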